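(* Let $\xi$ be a sub-Gaussian complex random variable with bounded density. Given $A\in\mathbb{C}^{n\times n}$ with $\|A\|=1$ and $\delta\in(0,1)$, there are $C_1,C_2$ depending only on $\xi$ such that \[\mathbb{P}\left[\kappa_V(A+\delta G_n)\le C_1n^2\delta^{-1}\text{ and }\|\delta G_n\|\le C_2\delta\right]\ge\frac12\] for $G_n=G_n(\xi)$.
   Context: $\|\cdot\|$ denotes the $\ell^2\to\ell^2$ operator norm. A complex random variable $X$ is sub-Gaussian if there are constants $c,C>0$ with $\mathbb{P}[|X|>t]\le Ce^{-ct^2}$ for all $t\ge 0$. The density of $\xi$ (with respect to Lebesgue measure on $\mathbb{C}\cong\mathbb{R}^2$) is continuous and bounded by some constant. $G_n(\xi)$ is the random $n\times n$ matrix such that the entries of $n^{1/2}G_n(\xi)$ are independent copies of $\xi$. For a diagonalizable matrix $M\in\mathbb{C}^{n\times n}$, $\kappa_V(M):=\inf\{\|W\|\,\|W^{-1}\| : W\text{ invertible},\ M=WDW^{-1},\ D\text{ diagonal}\}$ (complex $W,D$); for non-diagonalizable $M$ the infimum is over the empty set and equals $+\infty$.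
   Formalization: The formal statement adds E[ξ]=0: if E[ξ]=m≠0, then ‖G_n‖ ≥ |m|√n − O(1) with high probability (e.g. ξ = 10 + standard complex Gaussian), so no C_2 depending only on ξ can work for all n. *)

theory Defs
  imports "HOL-Probability.Probability" "Jordan_Normal_Form.Matrix"
begin

definition vec_l2 :: "complex vec \<Rightarrow> real" where
  "vec_l2 v = L2_set (\<lambda>i. cmod (v $ i)) {..<dim_vec v}"

definition op_norm :: "complex mat \<Rightarrow> real" where
  "op_norm A = Sup {vec_l2 (A *\<^sub>v v) | v. v \<in> carrier_vec (dim_col A) \<and> vec_l2 v \<le> 1}"

(* similar_mat_wit A D W V says that A, D, W, V are square of the same size, V is the
   two-sided inverse of W, and A = W * D * V.  The value lies in ereal, where the infimum
   of the empty set is \<infinity>, as required for a non-diagonalizable A. *)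
definition kappa_V :: "complex mat \<Rightarrow> ereal" where
  "kappa_V A = Inf {ereal (op_norm W * op_norm V) | W V D.
     similar_mat_wit A D W V \<and> diagonal_mat D}"

(* The tail condition alone: it does not include that X has mean zero. *)
definition sub_gaussian :: "'a measure \<Rightarrow> ('a \<Rightarrow> complex) \<Rightarrow> bool" where
  "sub_gaussian M X \<longleftrightarrow> (\<exists>c>0. \<exists>C>0. \<forall>t\<ge>0.
     measure M {\<omega> \<in> space M. cmod (X \<omega>) > t} \<le> C * exp (- c * t\<^sup>2))"

definition has_bounded_density :: "'a measure \<Rightarrow> ('a \<Rightarrow> complex) \<Rightarrow> bool" where
  "has_bounded_density M X \<longleftrightarrow> (\<exists>(f :: complex \<Rightarrow> real) K.
     continuous_on UNIV f \<and> (\<forall>z. 0 \<le> f z \<and> f z \<le> K) \<and>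
     distributed M lborel X (\<lambda>z. ennreal (f z)))"

(* G, defined on the probability space N, is a realization of G_n(xi) for xi defined on M:
   the entries of sqrt n * G are independent and each has the law of xi. *)
definition scaled_iid_matrix ::
  "'a measure \<Rightarrow> ('a \<Rightarrow> complex) \<Rightarrow> nat \<Rightarrow> 'b measure \<Rightarrow> ('b \<Rightarrow> complex mat) \<Rightarrow> bool" where
  "scaled_iid_matrix M \<xi> n N G \<longleftrightarrow>
     (\<forall>\<omega>\<in>space N. G \<omega> \<in> carrier_mat n n) \<and>
     prob_space.indep_vars N (\<lambda>_. borel)
       (\<lambda>ij \<omega>. complex_of_real (sqrt (real n)) * G \<omega> $$ ij) ({..<n} \<times> {..<n}) \<and>
     (\<forall>ij \<in> {..<n} \<times> {..<n}.
       distr N borel (\<lambda>\<omega>. complex_of_real (sqrt (real n)) * G \<omega> $$ ij) = distr M borel \<xi>)"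

end

theory Submission
  imports Defs "Jordan_Normal_Form.Jordan_Normal_Form_Existence"
begin

text \<open>
  Let M be the perturbed matrix A + \<delta> G and suppose that M = W D V, where V is the inverse of W, the columns of
  W are unit vectors and D has distinct diagonal entries l_k.  Then the condition number is at most
  the product of the Frobenius norms of W and V, that is, sqrt n times the Frobenius norm of V, so it
  suffices to show that the square of the latter is O(n^3 / \<delta>^2) with high probability.

  This square is read off from the area of pseudospectra.  The entry (j,i) of the resolvent of M at z
  is the sum over k of W_jk V_ki / (l_k - z).  For small e it exceeds 1/e in modulus at
  least on discs of radius e |W_jk V_ki| / 2 about the eigenvalues, so the area of its superlevel
  set is at least \<pi>/4 e^2 times the sum over k of |W_jk V_ki|^2 (\<open>pole_superlevel_area\<close>).  Summed over i and
  j this is \<pi>/4 e^2 times the squared Frobenius norm of V (\<open>area_density_lower_bound\<close>).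

  The same entry is also a cofactor divided by the determinant of M - z.  The determinant is an affine
  function of the matrix entry M_ij whose slope is that cofactor, and the cofactor does not depend on
  M_ij.  Hence the resolvent entry exceeds 1/e only if the random variable M_ij hits a disc
  of radius e that is determined by the other entries.  As the density of sqrt n G_ij is
  bounded, this has probability O(e^2 n / \<delta>^2) (\<open>near_singular_fibre_prob\<close>).  Integrating over a fixed disc of
  points z and summing over the n^2 entries bounds the expected area by O(e^2 n^3 / \<delta>^2), and
  Fatou's lemma and Markov's inequality (\<open>area_density_large_prob\<close>) give the required bound.

  Three more facts are needed.  The spectrum is almost surely simple, because the discriminant is a
  polynomial in the entries that does not vanish identically (\<open>AE_simple_spectrum\<close>).  The norm of G is
  bounded with probability at least 3/4, by exponential moments and a net argument
  (\<open>op_norm_bound_whp\<close>); this also confines the eigenvalues to a fixed disc.  Finally, the event in question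
  is measurable (\<open>kappa_V_event_measurable\<close>).
\<close>

section \<open>The operator norm and the Frobenius norm\<close>

text \<open>The Frobenius norm.  It bounds the operator norm and is a plain sum over entries, which is the
  form in which the condition number is estimated below.\<close>
definition frob :: "complex mat \<Rightarrow> real" where
  "frob A = L2_set (\<lambda>ij. cmod (A $$ ij)) ({..<dim_row A} \<times> {..<dim_col A})"

lemma frob_nonneg: "frob A \<ge> 0"
  unfolding frob_def by (rule L2_set_nonneg)

lemma frob_sq:
  assumes "A \<in> carrier_mat m n"
  shows "(frob A)\<^sup>2 = (\<Sum>i<m. \<Sum>j<n. (cmod (A $$ (i,j)))\<^sup>2)"
  using assms by (simp add: frob_def L2_set_def sum_nonneg sum.cartesian_product)

lemma vec_l2_nonneg: "vec_l2 v \<ge> 0"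
  unfolding vec_l2_def by (rule L2_set_nonneg)

lemma vec_l2_sq: "v \<in> carrier_vec n \<Longrightarrow> (vec_l2 v)\<^sup>2 = (\<Sum>i<n. (cmod (v $ i))\<^sup>2)"
  by (auto simp: vec_l2_def L2_set_def sum_nonneg)

lemma vec_l2_zero [simp]: "vec_l2 (0\<^sub>v n) = 0"
  by (simp add: vec_l2_def L2_set_def)

lemma vec_l2_smult: "vec_l2 (c \<cdot>\<^sub>v v) = cmod c * vec_l2 v"
proof -
  have "vec_l2 (c \<cdot>\<^sub>v v) = L2_set (\<lambda>i. cmod c * cmod (v $ i)) {..<dim_vec v}"
    unfolding vec_l2_def by (intro L2_set_cong) (auto simp: norm_mult)
  then show ?thesis by (simp add: vec_l2_def L2_set_right_distrib)
qed

lemma vec_l2_eq_0: "v \<in> carrier_vec n \<Longrightarrow> vec_l2 v = 0 \<Longrightarrow> v = 0\<^sub>v n"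
  by (intro eq_vecI) (auto simp: vec_l2_def L2_set_eq_0_iff)

lemma vec_l2_add:
  assumes "v \<in> carrier_vec n" "w \<in> carrier_vec n"
  shows "vec_l2 (v + w) \<le> vec_l2 v + vec_l2 w"
proof -
  have "vec_l2 (v + w) \<le> L2_set (\<lambda>i. cmod (v $ i) + cmod (w $ i)) {..<n}"
    using assms unfolding vec_l2_def by (auto intro!: L2_set_mono norm_triangle_ineq)
  also have "\<dots> \<le> vec_l2 v + vec_l2 w"
    using assms unfolding vec_l2_def by (auto intro: L2_set_triangle_ineq)
  finally show ?thesis .
qed

lemma mult_mat_vec_nth:
  assumes "A \<in> carrier_mat m n" "v \<in> carrier_vec n" "i < m"
  shows "(A *\<^sub>v v) $ i = (\<Sum>j<n. A $$ (i,j) * v $ j)"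
  using assms by (auto simp: scalar_prod_def atLeast0LessThan intro!: sum.cong)

lemma vec_l2_mult_frob:
  assumes A: "A \<in> carrier_mat m n" and v: "v \<in> carrier_vec n"
  shows "vec_l2 (A *\<^sub>v v) \<le> frob A * vec_l2 v"
proof (rule power2_le_imp_le)
  have "(vec_l2 (A *\<^sub>v v))\<^sup>2 = (\<Sum>i<m. (cmod (\<Sum>j<n. A $$ (i,j) * v $ j))\<^sup>2)"
    using A v by (subst vec_l2_sq[of _ m]) (auto simp: mult_mat_vec_nth[OF A v] simp del: index_mult_mat_vec intro!: sum.cong)
  also have "\<dots> \<le> (\<Sum>i<m. (\<Sum>j<n. (cmod (A $$ (i,j)))\<^sup>2) * (vec_l2 v)\<^sup>2)"
  proof (rule sum_mono)
    fix i assume "i \<in> {..<m}"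
    have "cmod (\<Sum>j<n. A $$ (i,j) * v $ j) \<le> (\<Sum>j<n. \<bar>cmod (A $$ (i,j))\<bar> * \<bar>cmod (v $ j)\<bar>)"
      by (rule order_trans[OF norm_sum]) (simp add: norm_mult)
    also have "\<dots> \<le> L2_set (\<lambda>j. cmod (A $$ (i,j))) {..<n} * L2_set (\<lambda>j. cmod (v $ j)) {..<n}"
      by (rule L2_set_mult_ineq)
    finally have "(cmod (\<Sum>j<n. A $$ (i,j) * v $ j))\<^sup>2 \<le> (L2_set (\<lambda>j. cmod (A $$ (i,j))) {..<n} * L2_set (\<lambda>j. cmod (v $ j)) {..<n})\<^sup>2"
      by (intro power_mono) auto
    also have "\<dots> = (\<Sum>j<n. (cmod (A $$ (i,j)))\<^sup>2) * (vec_l2 v)\<^sup>2"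
      using v by (simp add: power_mult_distrib vec_l2_def) (simp add: L2_set_def sum_nonneg)
    finally show "(cmod (\<Sum>j<n. A $$ (i,j) * v $ j))\<^sup>2 \<le> \<dots>" .
  qed
  also have "\<dots> = (frob A * vec_l2 v)\<^sup>2"
    by (simp add: power_mult_distrib frob_sq[OF A] sum_distrib_right)
  finally show "(vec_l2 (A *\<^sub>v v))\<^sup>2 \<le> (frob A * vec_l2 v)\<^sup>2" .
qed (simp add: frob_nonneg vec_l2_nonneg)

lemma op_norm_upper_unit:
  assumes A: "A \<in> carrier_mat m n" and v: "v \<in> carrier_vec n" "vec_l2 v \<le> 1"
  shows "vec_l2 (A *\<^sub>v v) \<le> op_norm A"
  unfolding op_norm_def
proof (rule cSup_upper)
  show "bdd_above {vec_l2 (A *\<^sub>v v) |v. v \<in> carrier_vec (dim_col A) \<and> vec_l2 v \<le> 1}"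
  proof (rule bdd_aboveI[of _ "frob A"])
    fix x assume "x \<in> {vec_l2 (A *\<^sub>v v) |v. v \<in> carrier_vec (dim_col A) \<and> vec_l2 v \<le> 1}"
    then obtain v where "x = vec_l2 (A *\<^sub>v v)" "v \<in> carrier_vec n" "vec_l2 v \<le> 1" using A by auto
    then show "x \<le> frob A"
      using vec_l2_mult_frob[OF A, of v] mult_left_mono[of "vec_l2 v" 1 "frob A"] frob_nonneg[of A] by simp
  qed
  show "vec_l2 (A *\<^sub>v v) \<in> {vec_l2 (A *\<^sub>v v) |v. v \<in> carrier_vec (dim_col A) \<and> vec_l2 v \<le> 1}"
    by (rule CollectI, rule exI[of _ v]) (use A v in simp)
qed

lemma op_norm_le:
  assumes A: "A \<in> carrier_mat m n"
    and "\<And>v. v \<in> carrier_vec n \<Longrightarrow> vec_l2 v \<le> 1 \<Longrightarrow> vec_l2 (A *\<^sub>v v) \<le> c"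
  shows "op_norm A \<le> c"
  unfolding op_norm_def
proof (rule cSup_least)
  have "vec_l2 (A *\<^sub>v 0\<^sub>v n) \<in> {vec_l2 (A *\<^sub>v v) |v. v \<in> carrier_vec (dim_col A) \<and> vec_l2 v \<le> 1}"
    by (rule CollectI, rule exI[of _ "0\<^sub>v n"]) (use A in simp)
  then show "{vec_l2 (A *\<^sub>v v) |v. v \<in> carrier_vec (dim_col A) \<and> vec_l2 v \<le> 1} \<noteq> {}" by blast
  fix x assume "x \<in> {vec_l2 (A *\<^sub>v v) |v. v \<in> carrier_vec (dim_col A) \<and> vec_l2 v \<le> 1}"
  then obtain v where "x = vec_l2 (A *\<^sub>v v)" "v \<in> carrier_vec n" "vec_l2 v \<le> 1" using A by blast
  then show "x \<le> c" using assms(2) by simp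
qed

lemma op_norm_nonneg:
  assumes A: "A \<in> carrier_mat m n"
  shows "op_norm A \<ge> 0"
  using order_trans[OF vec_l2_nonneg op_norm_upper_unit[OF A, of "0\<^sub>v n"]] by simp

lemma op_norm_upper:
  assumes A: "A \<in> carrier_mat m n" and v: "v \<in> carrier_vec n"
  shows "vec_l2 (A *\<^sub>v v) \<le> op_norm A * vec_l2 v"
proof (cases "vec_l2 v = 0")
  case True
  then have "v = 0\<^sub>v n" using v vec_l2_eq_0 by blast
  moreover have "A *\<^sub>v 0\<^sub>v n = 0\<^sub>v m" using A by auto
  ultimately show ?thesis by simp
next
  case False
  define s where "s = vec_l2 v"
  have s: "s > 0" using False vec_l2_nonneg[of v] by (simp add: s_def)
  let ?w = "complex_of_real (1/s) \<cdot>\<^sub>v v"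
  have "vec_l2 ?w = 1" using s by (simp add: vec_l2_smult norm_divide flip: s_def)
  then have "vec_l2 (A *\<^sub>v ?w) \<le> op_norm A" using op_norm_upper_unit[OF A, of ?w] v by auto
  moreover have "A *\<^sub>v ?w = complex_of_real (1/s) \<cdot>\<^sub>v (A *\<^sub>v v)" using A v by (rule mult_mat_vec)
  ultimately show ?thesis using s by (simp add: vec_l2_smult norm_divide field_simps flip: s_def)
qed

lemma op_norm_le_frob:
  assumes A: "A \<in> carrier_mat m n"
  shows "op_norm A \<le> frob A"
proof (rule op_norm_le[OF A])
  fix v :: "complex vec" assume v: "v \<in> carrier_vec n" "vec_l2 v \<le> 1"
  show "vec_l2 (A *\<^sub>v v) \<le> frob A"
    using vec_l2_mult_frob[OF A v(1)] mult_left_mono[OF v(2) frob_nonneg[of A]] by simp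
qed

lemma op_norm_add:
  assumes A: "A \<in> carrier_mat m n" and B: "B \<in> carrier_mat m n"
  shows "op_norm (A + B) \<le> op_norm A + op_norm B"
proof (rule op_norm_le)
  fix v :: "complex vec" assume v: "v \<in> carrier_vec n" "vec_l2 v \<le> 1"
  have "(A + B) *\<^sub>v v = A *\<^sub>v v + B *\<^sub>v v" using A B v by (auto simp: add_mult_distrib_mat_vec)
  then have "vec_l2 ((A + B) *\<^sub>v v) \<le> vec_l2 (A *\<^sub>v v) + vec_l2 (B *\<^sub>v v)"
    using A B v vec_l2_add[of "A *\<^sub>v v" m "B *\<^sub>v v"] by auto
  then show "vec_l2 ((A + B) *\<^sub>v v) \<le> op_norm A + op_norm B"
    using op_norm_upper_unit[OF A v] op_norm_upper_unit[OF B v] by linarith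
qed (use A B in auto)

lemma op_norm_smult_le:
  assumes A: "A \<in> carrier_mat m n"
  shows "op_norm (c \<cdot>\<^sub>m A) \<le> cmod c * op_norm A"
proof (rule op_norm_le)
  fix v :: "complex vec" assume v: "v \<in> carrier_vec n" "vec_l2 v \<le> 1"
  have "(c \<cdot>\<^sub>m A) *\<^sub>v v = c \<cdot>\<^sub>v (A *\<^sub>v v)" using A v by auto
  then show "vec_l2 ((c \<cdot>\<^sub>m A) *\<^sub>v v) \<le> cmod c * op_norm A"
    using op_norm_upper_unit[OF A v] by (auto simp: vec_l2_smult intro: mult_left_mono)
qed (use A in auto)

text \<open>Any single diagonalization bounds the infimum from above, so it is enough to exhibit one whose
  two factors have controlled Frobenius norms.\<close>
lemma kappa_V_le_frob:
  assumes "similar_mat_wit M D W V" "diagonal_mat D"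
  shows "kappa_V M \<le> ereal (frob W * frob V)"
proof -
  have c: "W \<in> carrier_mat (dim_row M) (dim_row M)" "V \<in> carrier_mat (dim_row M) (dim_row M)"
    using similar_mat_witD[OF refl assms(1)] by blast+
  have "kappa_V M \<le> ereal (op_norm W * op_norm V)"
    unfolding kappa_V_def by (rule Inf_lower) (use assms in blast)
  also have "\<dots> \<le> ereal (frob W * frob V)"
    using op_norm_le_frob[OF c(1)] op_norm_le_frob[OF c(2)] op_norm_nonneg[OF c(2)] frob_nonneg[of W]
    by (simp add: mult_mono)
  finally show ?thesis .
qed

section \<open>Matrices with simple spectrum\<close>

definition power_trace :: "complex mat \<Rightarrow> nat \<Rightarrow> complex" where
  "power_trace A k = (\<Sum>i<dim_row A. (A ^\<^sub>m k) $$ (i,i))"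

text \<open>The Hankel determinant of the power sums of the eigenvalues.  It equals the squared Vandermonde
  determinant of the eigenvalues, hence the discriminant of the characteristic polynomial, but it is
  visibly a polynomial in the entries of the matrix.\<close>
definition spectral_disc :: "complex mat \<Rightarrow> complex" where
  "spectral_disc A = det (mat (dim_row A) (dim_row A) (\<lambda>(a,b). power_trace A (a + b)))"

lemma mult_mat_nth:
  assumes "A \<in> carrier_mat m n" "B \<in> carrier_mat n p" "i < m" "j < p"
  shows "(A * B) $$ (i,j) = (\<Sum>k<n. A $$ (i,k) * B $$ (k,j))"
  using assms by (auto simp: scalar_prod_def atLeast0LessThan intro!: sum.cong)

lemma trace_mult_commute:
  fixes A B :: "complex mat"
  assumes A: "A \<in> carrier_mat n n" and B: "B \<in> carrier_mat n n"
  shows "(\<Sum>i<n. (A * B) $$ (i,i)) = (\<Sum>i<n. (B * A) $$ (i,i))"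
proof -
  have "(\<Sum>i<n. (A * B) $$ (i,i)) = (\<Sum>i<n. \<Sum>k<n. A $$ (i,k) * B $$ (k,i))"
    by (intro sum.cong refl mult_mat_nth[OF A B]) auto
  also have "\<dots> = (\<Sum>k<n. \<Sum>i<n. A $$ (i,k) * B $$ (k,i))" by (rule sum.swap)
  also have "\<dots> = (\<Sum>i<n. (B * A) $$ (i,i))"
    by (intro sum.cong refl, subst mult_mat_nth[OF B A]) (auto simp: mult.commute)
  finally show ?thesis .
qed

lemma upper_triangular_pow:
  fixes J :: "complex mat"
  assumes J: "J \<in> carrier_mat n n" and ut: "\<And>i j. i < n \<Longrightarrow> j < i \<Longrightarrow> J $$ (i,j) = 0"
  shows "(\<forall>i<n. \<forall>j<i. (J ^\<^sub>m k) $$ (i,j) = 0) \<and> (\<forall>i<n. (J ^\<^sub>m k) $$ (i,i) = (J $$ (i,i)) ^ k)"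
proof (induction k)
  case 0
  then show ?case using J by auto
next
  case (Suc k)
  have Jk: "J ^\<^sub>m k \<in> carrier_mat n n" using J by simp
  have e: "(J ^\<^sub>m Suc k) $$ (i,j) = (\<Sum>l<n. (J ^\<^sub>m k) $$ (i,l) * J $$ (l,j))" if "i < n" "j < n" for i j
    using mult_mat_nth[OF Jk J that] by simp
  have "(J ^\<^sub>m Suc k) $$ (i,j) = 0" if "i < n" "j < i" for i j
  proof -
    have "(\<Sum>l<n. (J ^\<^sub>m k) $$ (i,l) * J $$ (l,j)) = 0"
    proof (rule sum.neutral, rule ballI)
      fix l assume "l \<in> {..<n}"
      then show "(J ^\<^sub>m k) $$ (i,l) * J $$ (l,j) = 0"
        using Suc that ut[of l j] by (cases "l < i") auto
    qed
    then show ?thesis using e[of i j] that by simp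
  qed
  moreover have "(J ^\<^sub>m Suc k) $$ (i,i) = (J $$ (i,i)) ^ Suc k" if "i < n" for i
  proof -
    have "(\<Sum>l<n. (J ^\<^sub>m k) $$ (i,l) * J $$ (l,i)) = (\<Sum>l<n. if l = i then (J ^\<^sub>m k) $$ (i,i) * J $$ (i,i) else 0)"
    proof (rule sum.cong[OF refl])
      fix l assume "l \<in> {..<n}"
      then show "(J ^\<^sub>m k) $$ (i,l) * J $$ (l,i) = (if l = i then (J ^\<^sub>m k) $$ (i,i) * J $$ (i,i) else 0)"
        using Suc that ut[of l i] by (cases l i rule: linorder_cases) auto
    qed
    also have "\<dots> = (J $$ (i,i)) ^ Suc k" using Suc that by simp
    finally show ?thesis using e[of i i] that by simp
  qed
  ultimately show ?case by blast
qed

text \<open>Traces of powers are similarity invariants, and for a triangular matrix the diagonal of a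
  power is the power of the diagonal.\<close>
lemma power_trace_similar:
  assumes M: "M \<in> carrier_mat n n" and sim: "similar_mat_wit M J P Q"
    and ut: "\<And>i j. i < n \<Longrightarrow> j < i \<Longrightarrow> J $$ (i,j) = 0"
  shows "power_trace M k = (\<Sum>i<n. (J $$ (i,i)) ^ k)"
proof -
  note s = similar_mat_witD2[OF M sim]
  have Jk: "J ^\<^sub>m k \<in> carrier_mat n n" using s by simp
  have "M ^\<^sub>m k = P * J ^\<^sub>m k * Q" using sim by (rule similar_mat_wit_pow_id)
  also have "\<dots> = P * (J ^\<^sub>m k * Q)" using s Jk by (intro assoc_mult_mat) auto
  finally have "power_trace M k = (\<Sum>i<n. (P * (J ^\<^sub>m k * Q)) $$ (i,i))"
    using M by (simp add: power_trace_def)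
  also have "\<dots> = (\<Sum>i<n. (J ^\<^sub>m k * Q * P) $$ (i,i))"
    using s Jk by (intro trace_mult_commute) auto
  also have "J ^\<^sub>m k * Q * P = J ^\<^sub>m k * (Q * P)" using s Jk by (intro assoc_mult_mat) auto
  also have "\<dots> = J ^\<^sub>m k" unfolding s(2) using Jk by (rule right_mult_one_mat)
  also have "(\<Sum>i<n. (J ^\<^sub>m k) $$ (i,i)) = (\<Sum>i<n. (J $$ (i,i)) ^ k)"
    using upper_triangular_pow[OF s(5) ut, of k] by (intro sum.cong) auto
  finally show ?thesis .
qed

text \<open>The Hankel matrix factors as the transposed Vandermonde matrix times the Vandermonde matrix.\<close>
lemma det_power_sums:
  fixes l :: "nat \<Rightarrow> complex"
  shows "det (mat n n (\<lambda>(a,b). \<Sum>i<n. l i ^ (a + b))) = (det (mat n n (\<lambda>(i,a). l i ^ a)))\<^sup>2"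
proof -
  let ?V = "mat n n (\<lambda>(i,a). l i ^ a)"
  have V: "?V \<in> carrier_mat n n" "transpose_mat ?V \<in> carrier_mat n n" by auto
  have "mat n n (\<lambda>(a,b). \<Sum>i<n. l i ^ (a + b)) = transpose_mat ?V * ?V"
  proof (rule eq_matI)
    fix a b assume "a < dim_row (transpose_mat ?V * ?V)" "b < dim_col (transpose_mat ?V * ?V)"
    then have ab: "a < n" "b < n" by auto
    show "mat n n (\<lambda>(a,b). \<Sum>i<n. l i ^ (a + b)) $$ (a,b) = (transpose_mat ?V * ?V) $$ (a,b)"
      using ab by (subst mult_mat_nth[OF V(2,1)]) (auto simp: power_add)
  qed auto
  then show ?thesis using det_mult[OF V(2,1)] det_transpose[OF V(1)] by (simp add: power2_eq_square)
qed

text \<open>A kernel vector of the Vandermonde matrix would be the coefficient vector of a nonzero polynomial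
  of degree less than n with n distinct roots.\<close>
lemma det_vandermonde_nonzero:
  fixes l :: "nat \<Rightarrow> complex"
  assumes inj: "inj_on l {..<n}"
  shows "det (mat n n (\<lambda>(i,a). l i ^ a)) \<noteq> 0"
proof
  let ?V = "mat n n (\<lambda>(i,a). l i ^ a)"
  have V: "?V \<in> carrier_mat n n" by auto
  assume "det ?V = 0"
  then obtain v where v: "v \<in> carrier_vec n" "v \<noteq> 0\<^sub>v n" "?V *\<^sub>v v = 0\<^sub>v n"
    using det_0_iff_vec_prod_zero_field[OF V] by auto
  define p where "p = Poly (map (\<lambda>a. v $ a) [0..<n])"
  have cp: "coeff p a = (if a < n then v $ a else 0)" for a
    by (simp add: p_def coeff_Poly_eq nth_default_def)
  have pz: "p \<noteq> 0"
  proof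
    assume "p = 0"
    then have "v $ a = 0" if "a < n" for a using cp[of a] that by simp
    then show False using v(1,2) by (metis eq_vecI carrier_vecD index_zero_vec)
  qed
  have n: "n > 0" using v(1,2) by (cases n) auto
  have deg: "degree p < n" using degree_le[of "n-1" p] cp n by fastforce
  have ev: "poly p z = (\<Sum>a<n. v $ a * z ^ a)" for z
  proof -
    have "poly p z = (\<Sum>a<n. coeff p a * z ^ a)"
      unfolding poly_altdef using deg by (intro sum.mono_neutral_left) (auto simp: coeff_eq_0)
    then show ?thesis by (simp add: cp)
  qed
  have "poly p (l i) = 0" if "i < n" for i
  proof -
    have "(?V *\<^sub>v v) $ i = 0" using v that by simp
    then show ?thesis using mult_mat_vec_nth[OF V v(1) that] that by (simp add: ev mult.commute)
  qed
  then have "l ` {..<n} \<subseteq> {z. poly p z = 0}" by auto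
  then have "card (l ` {..<n}) \<le> card {z. poly p z = 0}" using poly_roots_finite[OF pz] by (rule card_mono[rotated])
  also have "\<dots> \<le> degree p" by (rule card_poly_roots_bound[OF pz])
  finally show False using deg card_image[OF inj] by simp
qed

lemma spectral_disc_similar:
  assumes M: "M \<in> carrier_mat n n" and sim: "similar_mat_wit M J P Q"
    and ut: "\<And>i j. i < n \<Longrightarrow> j < i \<Longrightarrow> J $$ (i,j) = 0"
  shows "spectral_disc M = (det (mat n n (\<lambda>(i,a). (J $$ (i,i)) ^ a)))\<^sup>2"
  using M power_trace_similar[OF M sim ut] det_power_sums[of n "\<lambda>i. J $$ (i,i)"]
  by (simp add: spectral_disc_def)

text \<open>Off-diagonal ones occur only inside a block, where the diagonal is constant.  Hence a Jordan
  matrix with distinct diagonal entries is diagonal.\<close>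
lemma jordan_matrix_offdiag:
  fixes n_as :: "(nat \<times> complex) list"
  assumes "i < sum_list (map fst n_as)" "j < sum_list (map fst n_as)" "i \<noteq> j"
    and "jordan_matrix n_as $$ (i,j) \<noteq> 0"
  shows "jordan_matrix n_as $$ (i,i) = jordan_matrix n_as $$ (j,j)"
  using assms
proof (induction n_as arbitrary: i j)
  case Nil
  then show ?case by simp
next
  case (Cons na n_as)
  obtain n a where na: "na = (n,a)" by force
  show ?case
    using Cons.prems Cons.IH[of "i - n" "j - n"] unfolding na jordan_matrix_Cons
    by (auto split: if_splits)
qed

text \<open>If two diagonal entries of the Jordan form agreed, the Vandermonde matrix would have two equal
  rows and the discriminant would vanish.  So the Jordan form is diagonal, and rescaling the
  eigenvectors gives unit columns.\<close>
lemma simple_spectrum_diagonalization: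
  assumes M: "M \<in> carrier_mat n n" and disc: "spectral_disc M \<noteq> 0"
  obtains W V l where "W \<in> carrier_mat n n" "V \<in> carrier_mat n n" "W * V = 1\<^sub>m n" "V * W = 1\<^sub>m n"
    "inj_on l {..<n}" "M = W * mat_diag n l * V" "\<And>k. k < n \<Longrightarrow> vec_l2 (col W k) = 1"
proof -
  obtain as where "char_poly M = (\<Prod>a\<leftarrow>as. [:- a, 1:])" using char_poly_factorized[OF M] by blast
  from jordan_nf_exists[OF M this] obtain n_as where "jordan_nf M n_as" by blast
  then obtain P Q where sim: "similar_mat_wit M (jordan_matrix n_as) P Q"
    by (auto simp: jordan_nf_def similar_mat_def)
  define J where "J = jordan_matrix n_as"
  note s = similar_mat_witD2[OF M sim, folded J_def]
  have n: "sum_list (map fst n_as) = n" using s(5) by (auto simp: J_def)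
  have ut: "\<And>i j. i < n \<Longrightarrow> j < i \<Longrightarrow> J $$ (i,j) = 0"
    using jordan_matrix_upper_triangular[of _ n_as] by (simp add: J_def n)
  define l where "l = (\<lambda>i. J $$ (i,i))"
  have inj: "inj_on l {..<n}"
  proof (rule inj_onI, rule ccontr)
    fix i j assume ij: "i \<in> {..<n}" "j \<in> {..<n}" "l i = l j" "i \<noteq> j"
    have "det (mat n n (\<lambda>(i,a). l i ^ a)) = 0"
      by (rule Determinant.det_identical_rows[of _ n i j]) (use ij in \<open>auto intro!: eq_vecI\<close>)
    then show False using disc spectral_disc_similar[OF M sim ut[unfolded J_def]] by (simp add: l_def J_def)
  qed
  have JD: "J = mat_diag n l"
  proof (rule eq_matI)
    fix i j assume "i < dim_row (mat_diag n l)" "j < dim_col (mat_diag n l)"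
    then have ij: "i < n" "j < n" by (auto simp: mat_diag_def)
    show "J $$ (i,j) = mat_diag n l $$ (i,j)"
    proof (cases "i = j")
      case False
      then have "J $$ (i,j) = 0"
        using jordan_matrix_offdiag[of i n_as j] inj ij by (auto simp: n J_def l_def inj_on_def)
      then show ?thesis using ij False by (simp add: mat_diag_def)
    qed (use ij in \<open>simp add: mat_diag_def l_def\<close>)
  qed (use s in \<open>auto simp: mat_diag_def\<close>)
  \<comment> \<open>Multiplying the columns of P by 1 / c and the rows of Q by c changes neither
    the inverse relation nor the product, because diagonal matrices commute.\<close>
  define c where "c k = complex_of_real (vec_l2 (col P k))" for k
  have c0: "c k \<noteq> 0" if k: "k < n" for k
  proof
    assume "c k = 0"
    then have "col P k = 0\<^sub>v n" using vec_l2_eq_0[of "col P k" n] s by (auto simp: c_def)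
    then have "(Q * P) $$ (k,k) = 0" using k s(6,7) by auto
    then show False using k s(2) by simp
  qed
  define W where "W = P * mat_diag n (\<lambda>k. 1 / c k)"
  define V where "V = mat_diag n c * Q"
  have cQ: "mat_diag n f * Q \<in> carrier_mat n n" for f
    by (rule mult_carrier_mat[OF mat_diag_dim s(7)])
  have cW: "W \<in> carrier_mat n n" unfolding W_def by (rule mult_carrier_mat[OF s(6) mat_diag_dim])
  have cV: "V \<in> carrier_mat n n" unfolding V_def by (rule cQ)
  have d1: "mat_diag n (\<lambda>k. 1 / c k) * mat_diag n c = 1\<^sub>m n" "mat_diag n c * mat_diag n (\<lambda>k. 1 / c k) = 1\<^sub>m n"
    using c0 by (auto simp: mat_diag_diag intro!: eq_matI) (auto simp: mat_diag_def)
  have WV: "W * V = 1\<^sub>m n"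
  proof -
    have "W * V = P * (mat_diag n (\<lambda>k. 1 / c k) * (mat_diag n c * Q))"
      unfolding W_def V_def by (rule assoc_mult_mat[OF s(6) mat_diag_dim cQ])
    also have "mat_diag n (\<lambda>k. 1 / c k) * (mat_diag n c * Q) = (mat_diag n (\<lambda>k. 1 / c k) * mat_diag n c) * Q"
      by (rule assoc_mult_mat[symmetric, OF mat_diag_dim mat_diag_dim s(7)])
    finally show ?thesis unfolding d1(1) using s(1) left_mult_one_mat[OF s(7)] by simp
  qed
  then have VW: "V * W = 1\<^sub>m n" using mat_mult_left_right_inverse[OF cW cV] by simp
  have cd: "mat_diag n l * (mat_diag n c * Q) = mat_diag n c * (mat_diag n l * Q)"
    by (subst (1 2) assoc_mult_mat[symmetric, of _ n n _ n _ n]) (use s(7) in \<open>auto simp: mult.commute\<close>)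
  have "M = P * (mat_diag n l * Q)" using s(3)[unfolded JD] s(6,7) by (metis assoc_mult_mat mat_diag_dim)
  also have "\<dots> = P * (1\<^sub>m n * (mat_diag n l * Q))" by (simp only: left_mult_one_mat[OF cQ])
  also have "\<dots> = P * (mat_diag n (\<lambda>k. 1 / c k) * (mat_diag n c * (mat_diag n l * Q)))"
    unfolding d1(1)[symmetric] by (simp only: assoc_mult_mat[OF mat_diag_dim mat_diag_dim cQ])
  also have "\<dots> = W * (mat_diag n l * V)"
    unfolding W_def V_def cd[symmetric] by (rule assoc_mult_mat[symmetric, OF s(6) mat_diag_dim mult_carrier_mat[OF mat_diag_dim cQ]])
  also have "\<dots> = W * mat_diag n l * V" using cW cV by (intro assoc_mult_mat[symmetric]) auto
  finally have M': "M = W * mat_diag n l * V" .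
  have un: "vec_l2 (col W k) = 1" if k: "k < n" for k
  proof -
    have "col W k = (1 / c k) \<cdot>\<^sub>v col P k"
      unfolding W_def using s k by (auto simp: mat_diag_mult_right[of _ n] intro!: eq_vecI)
    then have "vec_l2 (col W k) = cmod (1 / c k) * vec_l2 (col P k)" by (simp add: vec_l2_smult)
    then show ?thesis using c0[OF k] vec_l2_nonneg[of "col P k"] by (simp add: c_def norm_divide)
  qed
  show ?thesis by (rule that[OF cW cV WV VW inj M' un])
qed

lemma diagonalization_eigenvalue_le:
  assumes M: "M \<in> carrier_mat n n" and W: "W \<in> carrier_mat n n" and V: "V \<in> carrier_mat n n"
    and VW: "V * W = 1\<^sub>m n" and eq: "M = W * mat_diag n l * V"
    and k: "k < n" and un: "vec_l2 (col W k) = 1"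
  shows "cmod (l k) \<le> op_norm M"
proof -
  have "M * W = W * mat_diag n l * (V * W)"
    unfolding eq using W V by (intro assoc_mult_mat[of _ n n _ n]) auto
  also have "\<dots> = W * mat_diag n l" using W VW by (simp add: right_mult_one_mat[of _ n n])
  finally have MW: "M * W = W * mat_diag n l" .
  have cW: "col W k \<in> carrier_vec n" using W by auto
  have "M *\<^sub>v col W k = col (M * W) k" using M W k by (simp add: col_mult2[of _ n n _ n])
  also have "\<dots> = l k \<cdot>\<^sub>v col W k"
    unfolding MW using W k by (auto simp: mat_diag_mult_right[of _ n] intro!: eq_vecI)
  finally have "vec_l2 (M *\<^sub>v col W k) = cmod (l k)" using un by (simp add: vec_l2_smult)
  then show ?thesis using op_norm_upper[OF M cW] un by simp
qed

text \<open>The two descriptions of the resolvent whose comparison drives the proof: through cofactors, where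
  the dependence on a single matrix entry is transparent, and through partial fractions, where the
  coefficients are products of entries of the two eigenvector matrices.\<close>
lemma cofactor_resolvent:
  fixes M W V :: "complex mat" and z :: complex
  assumes W: "W \<in> carrier_mat n n" and V: "V \<in> carrier_mat n n"
    and WV: "W * V = 1\<^sub>m n" and VW: "V * W = 1\<^sub>m n" and eq: "M = W * mat_diag n l * V"
    and z: "\<And>k. k < n \<Longrightarrow> l k \<noteq> z" and ij: "i < n" "j < n"
  shows "det (M - z \<cdot>\<^sub>m 1\<^sub>m n) \<noteq> 0"
    and "cofactor (M - z \<cdot>\<^sub>m 1\<^sub>m n) i j =
      det (M - z \<cdot>\<^sub>m 1\<^sub>m n) * (\<Sum>k<n. W $$ (j,k) * V $$ (k,i) / (l k - z))"
proof -
  have M: "M \<in> carrier_mat n n" unfolding eq using W V by auto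
  define B where "B = M - z \<cdot>\<^sub>m 1\<^sub>m n"
  have B: "B \<in> carrier_mat n n" unfolding B_def using M by auto
  let ?D = "mat_diag n (\<lambda>k. l k - z)" and ?E = "mat_diag n (\<lambda>k. 1 / (l k - z))"
  define R where "R = W * (?E * V)"
  note E = mat_diag_dim[of n "\<lambda>k. 1 / (l k - z)"]
  note EV = mult_carrier_mat[OF E V]
  have R: "R \<in> carrier_mat n n" unfolding R_def by (rule mult_carrier_mat[OF W EV])
  have nth: "(W * mat_diag n f * V) $$ (i,j) = (\<Sum>k<n. W $$ (i,k) * f k * V $$ (k,j))" if "i < n" "j < n" for f i j
    using W V that by (subst mult_mat_nth[of _ n n _ n]) (auto simp: mat_diag_mult_right[of _ n])
  have one: "(\<Sum>k<n. W $$ (i,k) * V $$ (k,j)) = (1\<^sub>m n) $$ (i,j)" if "i < n" "j < n" for i j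
    using mult_mat_nth[OF W V that] WV by simp
  have BD: "B = W * ?D * V"
  proof (rule eq_matI)
    fix i j assume "i < dim_row (W * ?D * V)" "j < dim_col (W * ?D * V)"
    then have ij: "i < n" "j < n" using W V by auto
    have "B $$ (i,j) = (\<Sum>k<n. W $$ (i,k) * l k * V $$ (k,j)) - z * (1\<^sub>m n) $$ (i,j)"
      unfolding B_def eq using ij W V by (simp add: nth del: index_mult_mat)
    also have "\<dots> = (\<Sum>k<n. W $$ (i,k) * l k * V $$ (k,j)) - z * (\<Sum>k<n. W $$ (i,k) * V $$ (k,j))"
      using one[OF ij] by simp
    also have "\<dots> = (\<Sum>k<n. W $$ (i,k) * (l k - z) * V $$ (k,j))"
      by (simp add: sum_distrib_left algebra_simps flip: sum_subtractf)
    finally show "B $$ (i,j) = (W * ?D * V) $$ (i,j)" using nth[OF ij] by simp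
  qed (use B W V in auto)
  have DE: "?D * ?E = 1\<^sub>m n"
  proof -
    have "(l k - z) * (1 / (l k - z)) = 1" if "k < n" for k
    proof -
      have "l k - z \<noteq> 0" using z[OF that] by simp
      then show ?thesis unfolding divide_inverse mult_1_left by (rule right_inverse)
    qed
    note h = this
    show ?thesis unfolding mat_diag_diag by (intro eq_matI) (simp_all add: mat_diag_def h del: times_divide_eq_right mult_1_right)
  qed
  have BR: "B * R = 1\<^sub>m n"
  proof -
    note D = mat_diag_dim[of n "\<lambda>k. l k - z"]
    have "B * R = W * ?D * (V * (W * (?E * V)))"
      unfolding BD R_def by (rule assoc_mult_mat[OF mult_carrier_mat[OF W D] V mult_carrier_mat[OF W EV]])
    also have "V * (W * (?E * V)) = (V * W) * (?E * V)" by (rule assoc_mult_mat[OF V W EV, symmetric])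
    also have "\<dots> = ?E * V" unfolding VW by (rule left_mult_one_mat[OF EV])
    also have "W * ?D * (?E * V) = W * (?D * (?E * V))" by (rule assoc_mult_mat[OF W D EV])
    also have "?D * (?E * V) = (?D * ?E) * V" by (rule assoc_mult_mat[OF D E V, symmetric])
    also have "\<dots> = V" unfolding DE by (rule left_mult_one_mat[OF V])
    finally show ?thesis using WV by simp
  qed
  have "det B * det R = 1" using det_mult[OF B R] BR by simp
  then show "det (M - z \<cdot>\<^sub>m 1\<^sub>m n) \<noteq> 0" unfolding B_def[symmetric] by auto
  have "adj_mat B = adj_mat B * (B * R)" unfolding BR using adj_mat(1)[OF B] by (simp add: right_mult_one_mat[of _ n n])
  also have "\<dots> = (adj_mat B * B) * R" by (rule assoc_mult_mat[OF adj_mat(1)[OF B] B R, symmetric])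
  also have "\<dots> = det B \<cdot>\<^sub>m R" unfolding adj_mat(3)[OF B] using R by (simp add: mult_smult_assoc_mat[of _ n n _ n] left_mult_one_mat[of _ n n])
  finally have "adj_mat B $$ (j,i) = det B * R $$ (j,i)" using R ij by simp
  moreover have "adj_mat B $$ (j,i) = cofactor B i j" using B ij by (auto simp: adj_mat_def)
  moreover have "R = W * ?E * V" unfolding R_def by (rule assoc_mult_mat[OF W E V, symmetric])
  ultimately have "cofactor B i j = det B * (\<Sum>k<n. W $$ (j,k) * (1 / (l k - z)) * V $$ (k,i))"
    using nth[OF ij(2,1)] by simp
  then show "cofactor (M - z \<cdot>\<^sub>m 1\<^sub>m n) i j =
      det (M - z \<cdot>\<^sub>m 1\<^sub>m n) * (\<Sum>k<n. W $$ (j,k) * V $$ (k,i) / (l k - z))"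
    unfolding B_def by simp
qed

section \<open>Superlevel sets of sums of simple poles\<close>

lemma emeasure_ball_complex: "0 \<le> r \<Longrightarrow> emeasure lborel (ball (c::complex) r) = ennreal (pi * r\<^sup>2)"
  by (simp add: emeasure_ball unit_ball_vol_2)

text \<open>Near the k-th pole the sum behaves like its k-th term, which exceeds 1/e in modulus on
  the disc of radius e |a k|.  Halving the radius leaves room for the other terms, which stay
  bounded there; for small e these smaller discs are disjoint and their areas add up.\<close>
lemma pole_superlevel_area:
  fixes l a :: "nat \<Rightarrow> complex"
  assumes inj: "inj_on l {..<n}" and R: "\<And>k. k < n \<Longrightarrow> cmod (l k) < R"
  shows "\<exists>e0>0. \<forall>e. 0 < e \<longrightarrow> e < e0 \<longrightarrow> (\<forall>S \<in> sets borel.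
     (\<forall>z. cmod z < R \<longrightarrow> z \<notin> l ` {..<n} \<longrightarrow> 1 < e * cmod (\<Sum>k<n. a k / (l k - z)) \<longrightarrow> z \<in> S) \<longrightarrow>
     ennreal (pi / 4 * e\<^sup>2 * (\<Sum>k<n. (cmod (a k))\<^sup>2)) \<le> emeasure lborel S)"
proof -
  define L where "L = (\<Sum>k<n. cmod (a k))"
  have L: "L \<ge> 0" unfolding L_def by (simp add: sum_nonneg)
  have aL: "cmod (a k) \<le> L" if "k < n" for k
    unfolding L_def using member_le_sum[of k "{..<n}" "\<lambda>k. cmod (a k)"] that by auto
  \<comment> \<open>The radius r separates the poles from each other and from the boundary of the large disc;
    the 1 only keeps the set nonempty when there are no poles.\<close>
  define G where "G = insert 1 ((\<lambda>k. R - cmod (l k)) ` {..<n} \<union> (\<lambda>(k,m). cmod (l k - l m) / 2) ` {(k,m). k < n \<and> m < n \<and> k \<noteq> m})"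
  have fG: "finite G"
  proof -
    have "{(k,m). k < n \<and> m < n \<and> k \<noteq> m} \<subseteq> {..<n} \<times> {..<n}" by auto
    then have "finite {(k,m). k < n \<and> m < n \<and> k \<noteq> m}" using finite_subset by blast
    then show ?thesis by (simp add: G_def)
  qed
  define r where "r = Min G"
  have pos: "\<forall>g\<in>G. g > 0" using R inj by (auto simp: G_def inj_on_def)
  have r: "r > 0" unfolding r_def using fG pos by (subst Min_gr_iff) (auto simp: G_def)
  have r1: "r \<le> R - cmod (l k)" if "k < n" for k
    unfolding r_def using that fG by (intro Min_le) (auto simp: G_def)
  have r2: "2 * r \<le> cmod (l k - l m)" if "k < n" "m < n" "k \<noteq> m" for k m
  proof -
    have "cmod (l k - l m) / 2 \<in> G" unfolding G_def using that by (intro insertI2 UnI2 image_eqI[of _ _ "(k,m)"]) auto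
    then show ?thesis using Min_le[OF fG, of "cmod (l k - l m) / 2"] by (simp add: r_def)
  qed
  show ?thesis
  \<comment> \<open>With this threshold e L < r: the small discs have radius below r, and the remaining
    poles contribute at most L / r < 1 / e.\<close>
  proof (intro exI[of _ "r / (L + 1)"] conjI allI impI ballI)
    show "r / (L + 1) > 0" using r L by simp
    fix e S assume e: "0 < e" "e < r / (L + 1)" and S: "S \<in> sets borel"
      and sup: "\<forall>z. cmod z < R \<longrightarrow> z \<notin> l ` {..<n} \<longrightarrow> 1 < e * cmod (\<Sum>k<n. a k / (l k - z)) \<longrightarrow> z \<in> S"
    have eL: "e * L < r"
    proof -
      have "e * (L + 1) < r" using e L by (simp add: pos_less_divide_eq)
      then show ?thesis using e by (simp add: algebra_simps)
    qed
    define D where "D k = ball (l k) (e * cmod (a k) / 2)" for k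
    have rad: "e * cmod (a k) / 2 < r" if "k < n" for k
    proof -
      have "e * cmod (a k) \<le> e * L" using mult_left_mono[OF aL[OF that], of e] e by simp
      then show ?thesis using eL r by linarith
    qed
    have sub: "D k - l ` {..<n} \<subseteq> S" if k: "k < n" for k
    proof
      fix z assume z: "z \<in> D k - l ` {..<n}"
      define d where "d = cmod (l k - z)"
      have d: "d < e * cmod (a k) / 2" using z by (simp add: D_def d_def dist_norm)
      have d0: "d > 0" using z k by (auto simp: d_def)
      have dr: "d < r" using d rad[OF k] by simp
      have "cmod z \<le> cmod (l k) + d" unfolding d_def using norm_triangle_ineq4[of "l k" "l k - z"] by simp
      then have zR: "cmod z < R" using dr r1[OF k] by simp
      have oth: "cmod (a m / (l m - z)) \<le> cmod (a m) / r" if m: "m < n" "m \<noteq> k" for m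
      proof -
        have "cmod (l k - l m) \<le> d + cmod (l m - z)"
          unfolding d_def using norm_triangle_ineq4[of "l k - z" "l m - z"] by simp
        then have "r \<le> cmod (l m - z)" using r2[of k m] m k dr by simp
        then show ?thesis using r by (simp add: norm_divide frac_le)
      qed
      have "cmod (\<Sum>m\<in>{..<n} - {k}. a m / (l m - z)) \<le> (\<Sum>m\<in>{..<n} - {k}. cmod (a m) / r)"
        by (rule order_trans[OF norm_sum]) (use oth in \<open>auto intro!: sum_mono\<close>)
      also have "\<dots> \<le> L / r" unfolding L_def sum_divide_distrib using r by (intro sum_mono2) auto
      finally have rest: "cmod (\<Sum>m\<in>{..<n} - {k}. a m / (l m - z)) \<le> L / r" .
      have split: "(\<Sum>m<n. a m / (l m - z)) = a k / (l k - z) + (\<Sum>m\<in>{..<n} - {k}. a m / (l m - z))"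
        using k by (intro sum.remove) auto
      have "cmod (a k) / d - L / r \<le> cmod (\<Sum>m<n. a m / (l m - z))"
        using rest norm_diff_ineq[of "a k / (l k - z)" "\<Sum>m\<in>{..<n} - {k}. a m / (l m - z)"]
        unfolding split by (simp add: norm_divide d_def)
      moreover have "e * (cmod (a k) / d) > 2" using d d0 by (simp add: field_simps)
      moreover have "e * (L / r) < 1" using eL r by (simp add: field_simps)
      ultimately have "1 < e * cmod (\<Sum>m<n. a m / (l m - z))"
        using mult_left_mono[of "cmod (a k) / d - L / r" _ e] e by (smt (verit) right_diff_distrib)
      then show "z \<in> S" using sup zR z by blast
    qed
    have disj: "disjoint_family_on (\<lambda>k. D k - l ` {..<n}) {..<n}"
      unfolding disjoint_family_on_def
    proof (intro ballI impI, rule ccontr)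
      fix k m assume km: "k \<in> {..<n}" "m \<in> {..<n}" "k \<noteq> m" "(D k - l ` {..<n}) \<inter> (D m - l ` {..<n}) \<noteq> {}"
      then obtain z where "dist (l k) z < e * cmod (a k) / 2" "dist (l m) z < e * cmod (a m) / 2"
        by (auto simp: D_def)
      then have "dist (l k) (l m) < r + r"
        using rad[of k] rad[of m] km dist_triangle[of "l k" "l m" z] by (simp add: dist_commute)
      then show False using r2[of k m] km by (simp add: dist_norm)
    qed
    have me: "D k - l ` {..<n} \<in> sets lborel" for k
      unfolding D_def by (simp add: finite_imp_closed borel_closed sets.Diff)
    have em: "emeasure lborel (D k - l ` {..<n}) = ennreal (pi / 4 * e\<^sup>2 * (cmod (a k))\<^sup>2)" for k
    proof -
      have "l ` {..<n} \<in> null_sets lborel" by (rule finite_imp_null_set_lborel) simp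
      then have "emeasure lborel (D k - l ` {..<n}) = emeasure lborel (D k)"
        by (intro emeasure_Diff_null_set) (auto simp: D_def)
      also have "\<dots> = ennreal (pi / 4 * e\<^sup>2 * (cmod (a k))\<^sup>2)"
        unfolding D_def using e by (subst emeasure_ball_complex) (auto simp: power_mult_distrib power_divide)
      finally show ?thesis .
    qed
    have "ennreal (pi / 4 * e\<^sup>2 * (\<Sum>k<n. (cmod (a k))\<^sup>2)) = (\<Sum>k<n. emeasure lborel (D k - l ` {..<n}))"
      unfolding em by (simp add: sum_distrib_left sum_ennreal)
    also have "\<dots> = emeasure lborel (\<Union>k<n. D k - l ` {..<n})"
      by (rule sum_emeasure) (use me disj in auto)
    also have "\<dots> \<le> emeasure lborel S"
      by (rule emeasure_mono) (use sub S in auto)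
    finally show "ennreal (pi / 4 * e\<^sup>2 * (\<Sum>k<n. (cmod (a k))\<^sup>2)) \<le> emeasure lborel S" .
  qed
qed

section \<open>The expected area of pseudospectra\<close>

text \<open>Determinants and cofactors are polynomial expressions in the entries, so they inherit every
  property that constants and entries have and that sums and products preserve.  This is used for
  measurability and for being a polynomial in one chosen entry.\<close>
lemma det_closed:
  fixes F :: "('x \<Rightarrow> complex) \<Rightarrow> bool"
  assumes const: "\<And>a. F (\<lambda>x. a)"
    and add: "\<And>f g. F f \<Longrightarrow> F g \<Longrightarrow> F (\<lambda>x. f x + g x)"
    and mult: "\<And>f g. F f \<Longrightarrow> F g \<Longrightarrow> F (\<lambda>x. f x * g x)"
    and B: "\<And>x. B x \<in> carrier_mat n n"
    and entries: "\<And>i j. i < n \<Longrightarrow> j < n \<Longrightarrow> F (\<lambda>x. B x $$ (i,j))"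
  shows "F (\<lambda>x. det (B x))"
proof -
  have F_sum: "F (\<lambda>x. \<Sum>s\<in>S. f s x)" if "\<And>s. s \<in> S \<Longrightarrow> F (f s)" for S :: "(nat \<Rightarrow> nat) set" and f
    using that by (induction S rule: infinite_finite_induct) (auto intro: const add)
  have F_prod: "F (\<lambda>x. \<Prod>s\<in>S. f s x)" if "\<And>s. s \<in> S \<Longrightarrow> F (f s)" for S :: "nat set" and f
    using that by (induction S rule: infinite_finite_induct) (auto intro: const mult)
  have "F (\<lambda>x. \<Sum>p\<in>{p. p permutes {0..<n}}. signof p * (\<Prod>i = 0..<n. B x $$ (i, p i)))"
    by (intro F_sum mult const F_prod entries) (auto simp: permutes_in_image)
  then show ?thesis using det_def'[OF B] by simp
qed

lemma cofactor_closed: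
  fixes F :: "('x \<Rightarrow> complex) \<Rightarrow> bool"
  assumes const: "\<And>a. F (\<lambda>x. a)"
    and add: "\<And>f g. F f \<Longrightarrow> F g \<Longrightarrow> F (\<lambda>x. f x + g x)"
    and mult: "\<And>f g. F f \<Longrightarrow> F g \<Longrightarrow> F (\<lambda>x. f x * g x)"
    and B: "\<And>x. B x \<in> carrier_mat n n"
    and entries: "\<And>i j. i < n \<Longrightarrow> j < n \<Longrightarrow> F (\<lambda>x. B x $$ (i,j))"
  shows "F (\<lambda>x. cofactor (B x) i j)"
  unfolding cofactor_def
proof (intro mult const)
  show "F (\<lambda>x. det (mat_delete (B x) i j))"
  proof (rule det_closed[of F _ "n - 1", OF const add mult])
    fix x show "mat_delete (B x) i j \<in> carrier_mat (n-1) (n-1)" using B[of x] by (auto simp: mat_delete_def)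
  next
    fix i' j' assume ij: "i' < n-1" "j' < n-1"
    have "mat_delete (B x) i j $$ (i',j') = B x $$ (if i' < i then i' else Suc i', if j' < j then j' else Suc j')" for x
      using B[of x] ij by (auto simp: mat_delete_def)
    then show "F (\<lambda>x. mat_delete (B x) i j $$ (i',j'))" using ij by (auto intro!: entries)
  qed auto
qed

lemma cofactor_cong:
  assumes B: "B \<in> carrier_mat n n" and C: "C \<in> carrier_mat n n"
    and eq: "\<And>i' j'. i' < n \<Longrightarrow> j' < n \<Longrightarrow> i' \<noteq> i \<Longrightarrow> B $$ (i',j') = C $$ (i',j')"
  shows "cofactor B i j = cofactor C i j"
proof -
  have "mat_delete B i j = mat_delete C i j"
    by (rule eq_matI) (use B C in \<open>auto simp: mat_delete_def eq\<close>)
  then show ?thesis by (simp add: cofactor_def)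
qed

text \<open>The determinant is affine in each entry, with the cofactor, which does not involve that entry,
  as slope.\<close>
lemma det_change_entry:
  fixes B C :: "complex mat"
  assumes B: "B \<in> carrier_mat n n" and C: "C \<in> carrier_mat n n" and ij: "i < n" "j < n"
    and eq: "\<And>i' j'. i' < n \<Longrightarrow> j' < n \<Longrightarrow> (i',j') \<noteq> (i,j) \<Longrightarrow> B $$ (i',j') = C $$ (i',j')"
  shows "det B = det C + (B $$ (i,j) - C $$ (i,j)) * cofactor C i j"
proof -
  have cof: "cofactor B i k = cofactor C i k" for k
    by (rule cofactor_cong[OF B C]) (use eq in auto)
  have "det B = (\<Sum>k<n. B $$ (i,k) * cofactor C i k)"
    using laplace_expansion_row[OF B ij(1)] by (simp add: cof)
  also have "\<dots> = (\<Sum>k<n. C $$ (i,k) * cofactor C i k + (if k = j then (B $$ (i,j) - C $$ (i,j)) * cofactor C i j else 0))"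
    using ij eq[of i] by (intro sum.cong) (auto simp: algebra_simps)
  also have "\<dots> = det C + (B $$ (i,j) - C $$ (i,j)) * cofactor C i j"
    using laplace_expansion_row[OF C ij(1)] ij by (simp add: sum.distrib)
  finally show ?thesis .
qed

definition perturbed :: "nat \<Rightarrow> complex mat \<Rightarrow> real \<Rightarrow> (nat \<times> nat \<Rightarrow> complex) \<Rightarrow> complex mat" where
  "perturbed n A c x = mat n n (\<lambda>(i,j). A $$ (i,j) + complex_of_real c * x (i,j))"

lemma perturbed_carrier [simp]: "perturbed n A c x \<in> carrier_mat n n"
  by (simp add: perturbed_def)
definition pencil :: "nat \<Rightarrow> complex mat \<Rightarrow> real \<Rightarrow> (nat \<times> nat \<Rightarrow> complex) \<Rightarrow> complex \<Rightarrow> complex mat" where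
  "pencil n A c x z = mat n n (\<lambda>(i,j). A $$ (i,j) + complex_of_real c * x (i,j) - (if i = j then z else 0))"

text \<open>The pairs of a matrix and a point z in the disc of radius R at which the entry (j,i) of
  the resolvent, a cofactor divided by the determinant, exceeds 1/e in modulus.  Multiplying out
  avoids any case distinction when the determinant vanishes, and the strict inequality excludes points
  where the cofactor is zero.\<close>
definition near_singular ::
  "nat \<Rightarrow> complex mat \<Rightarrow> real \<Rightarrow> real \<Rightarrow> real \<Rightarrow> nat \<times> nat \<Rightarrow> ((nat \<times> nat \<Rightarrow> complex) \<times> complex) set" where
  "near_singular n A c R e ij = {(x,z). cmod z < R \<and>
     cmod (det (pencil n A c x z)) < e * cmod (cofactor (pencil n A c x z) (fst ij) (snd ij))}"

lemma pencil_carrier [simp]: "pencil n A c x z \<in> carrier_mat n n"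
  by (simp add: pencil_def)

lemma pencil_perturbed: "pencil n A c x z = perturbed n A c x - z \<cdot>\<^sub>m 1\<^sub>m n"
  by (rule eq_matI) (auto simp: pencil_def perturbed_def)
abbreviation indices :: "nat \<Rightarrow> (nat \<times> nat) set" where "indices n \<equiv> {..<n} \<times> {..<n}"

text \<open>What remains of a bounded density: discs have mass at most a constant times their squared radius.\<close>
locale bounded_density_law = prob_space \<mu> for \<mu> :: "complex measure" +
  fixes K :: real
  assumes sets_mu [measurable_cong]: "sets \<mu> = sets borel"
    and K_nonneg: "K \<ge> 0"
    and ball_le: "\<And>a r. r \<ge> 0 \<Longrightarrow> emeasure \<mu> (ball a r) \<le> ennreal (K * r\<^sup>2)"
begin

abbreviation entries :: "nat \<Rightarrow> (nat \<times> nat \<Rightarrow> complex) measure" where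
  "entries n \<equiv> Pi\<^sub>M (indices n) (\<lambda>_. \<mu>)"

lemma prob_entries: "prob_space (entries n)"
  by (rule prob_space_PiM) (rule prob_space_axioms)

lemma component_measurable: "ij \<in> indices n \<Longrightarrow> (\<lambda>x. x ij) \<in> borel_measurable (entries n)"
  using measurable_component_singleton[of ij "indices n" "\<lambda>_. \<mu>"] sets_mu measurable_cong_sets by blast
lemma near_singular_measurable:
  assumes "ij \<in> indices n"
  shows "near_singular n A c R e ij \<inter> (space (entries n) \<times> UNIV) \<in> sets (entries n \<Otimes>\<^sub>M lborel)"
proof -
  let ?P = "entries n \<Otimes>\<^sub>M (lborel :: complex measure)"
  have ent: "(\<lambda>w. pencil n A c (fst w) (snd w) $$ (i,j)) \<in> borel_measurable ?P" if "i < n" "j < n" for i j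
  proof -
    have "(\<lambda>w. fst w (i,j)) \<in> borel_measurable ?P"
      using measurable_compose[OF measurable_fst component_measurable[of "(i,j)" n]] that by simp
    then show ?thesis using that unfolding pencil_def by (cases "i = j") (simp_all)
  qed
  have d: "(\<lambda>w. det (pencil n A c (fst w) (snd w))) \<in> borel_measurable ?P"
    by (rule det_closed[where n = n]) (auto intro: ent)
  have co: "(\<lambda>w. cofactor (pencil n A c (fst w) (snd w)) (fst ij) (snd ij)) \<in> borel_measurable ?P"
    by (rule cofactor_closed[where n = n]) (auto intro: ent)
  have "{w \<in> space ?P. cmod (snd w) < R \<and> cmod (det (pencil n A c (fst w) (snd w))) <
     e * cmod (cofactor (pencil n A c (fst w) (snd w)) (fst ij) (snd ij))} \<in> sets ?P"
    using d co by measurable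
  moreover have "{w \<in> space ?P. cmod (snd w) < R \<and> cmod (det (pencil n A c (fst w) (snd w))) <
     e * cmod (cofactor (pencil n A c (fst w) (snd w)) (fst ij) (snd ij))} = near_singular n A c R e ij \<inter> (space (entries n) \<times> UNIV)"
    by (auto simp: near_singular_def space_pair_measure)
  ultimately show ?thesis by simp
qed

text \<open>With all entries but x ij fixed, the determinant is an affine function of x ij whose slope is
  c times the cofactor.  Comparing its modulus with e times the cofactor therefore asks x ij to lie
  in a disc of radius e / c.\<close>
lemma near_singular_fibre_prob:
  assumes ij: "ij \<in> indices n" and c: "c > 0" and e: "e > 0"
  shows "emeasure (entries n) {x \<in> space (entries n). (x,z) \<in> near_singular n A c R e ij} \<le> ennreal (K * (e / c)\<^sup>2)"
proof -
  interpret pp: product_sigma_finite "\<lambda>_. \<mu>" by (rule product_sigma_finite.intro) (rule sigma_finite_measure_axioms)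
  obtain i j where ij': "ij = (i,j)" "i < n" "j < n" using ij by auto
  define J where "J = indices n - {ij}"
  have J: "finite J" "ij \<notin> J" "insert ij J = indices n" using ij by (auto simp: J_def)
  let ?S = "{x \<in> space (entries n). (x,z) \<in> near_singular n A c R e ij}"
  have "?S = (\<lambda>x. (x,z)) -` (near_singular n A c R e ij \<inter> (space (entries n) \<times> UNIV)) \<inter> space (entries n)"
    by auto
  also have "\<dots> \<in> sets (entries n)"
    using near_singular_measurable[OF ij] by (rule measurable_sets[rotated]) simp
  finally have S: "?S \<in> sets (entries n)" .
  interpret PJ: prob_space "Pi\<^sub>M J (\<lambda>_. \<mu>)" by (rule prob_space_PiM) (rule prob_space_axioms)
  have inner: "(\<integral>\<^sup>+ y. indicator ?S (x(ij := y)) \<partial>\<mu>) \<le> ennreal (K * (e / c)\<^sup>2)" for x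
  proof -
    define C where "C = pencil n A c (x(ij := 0)) z"
    define a where "a = - det C / (complex_of_real c * cofactor C i j)"
    have "indicator ?S (x(ij := y)) \<le> (indicator (ball a (e / c)) y :: ennreal)" for y
    proof (cases "(x(ij := y), z) \<in> near_singular n A c R e ij")
      case True
      define B where "B = pencil n A c (x(ij := y)) z"
      have BC: "B \<in> carrier_mat n n" "C \<in> carrier_mat n n" by (auto simp: B_def C_def)
      have eq: "B $$ (i',j') = C $$ (i',j')" if "i' < n" "j' < n" "(i',j') \<noteq> (i,j)" for i' j'
        using that ij' by (auto simp: B_def C_def pencil_def)
      have "B $$ (i,j) - C $$ (i,j) = complex_of_real c * y"
        using ij' by (auto simp: B_def C_def pencil_def)
      then have det: "det B = det C + complex_of_real c * y * cofactor C i j"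
        using det_change_entry[OF BC ij'(2,3) eq] by simp
      have cof: "cofactor B i j = cofactor C i j"
        by (rule cofactor_cong[OF BC]) (use eq in auto)
      have lt: "cmod (det C + complex_of_real c * y * cofactor C i j) < e * cmod (cofactor C i j)"
      proof -
        have "cmod (det B) < e * cmod (cofactor B i j)" using True by (simp add: near_singular_def B_def ij')
        then show ?thesis unfolding det cof .
      qed
      then have nz: "cofactor C i j \<noteq> 0" by auto
      have "det C + complex_of_real c * y * cofactor C i j = complex_of_real c * cofactor C i j * (y - a)"
        using nz c by (simp add: a_def field_simps)
      then have "cmod (cofactor C i j) * (c * cmod (y - a)) < cmod (cofactor C i j) * e"
        using lt c by (simp add: norm_mult mult_ac)
      then have "c * cmod (y - a) < e" using nz by simp
      then have "y \<in> ball a (e / c)" using c by (simp add: dist_norm norm_minus_commute field_simps)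
      then show ?thesis by (auto simp: indicator_def)
    qed (auto simp: indicator_def)
    then have "(\<integral>\<^sup>+ y. indicator ?S (x(ij := y)) \<partial>\<mu>) \<le> (\<integral>\<^sup>+ y. indicator (ball a (e / c)) y \<partial>\<mu>)"
      by (intro nn_integral_mono)
    also have "\<dots> = emeasure \<mu> (ball a (e / c))" by (simp add: sets_mu)
    also have "\<dots> \<le> ennreal (K * (e / c)\<^sup>2)" using c e by (intro ball_le) auto
    finally show ?thesis .
  qed
  have "emeasure (entries n) ?S = (\<integral>\<^sup>+ x. indicator ?S x \<partial>entries n)" using S by simp
  also have "\<dots> = (\<integral>\<^sup>+ x. (\<integral>\<^sup>+ y. indicator ?S (x(ij := y)) \<partial>\<mu>) \<partial>Pi\<^sub>M J (\<lambda>_. \<mu>))"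
    unfolding J(3)[symmetric] by (rule pp.product_nn_integral_insert[OF J(1,2)]) (use S J in simp)
  also have "\<dots> \<le> (\<integral>\<^sup>+ x. ennreal (K * (e / c)\<^sup>2) \<partial>Pi\<^sub>M J (\<lambda>_. \<mu>))"
    by (intro nn_integral_mono inner)
  also have "\<dots> = ennreal (K * (e / c)\<^sup>2)" by (simp add: PJ.emeasure_space_1)
  finally show ?thesis .
qed

definition singular_area :: "nat \<Rightarrow> complex mat \<Rightarrow> real \<Rightarrow> real \<Rightarrow> real \<Rightarrow> (nat \<times> nat \<Rightarrow> complex) \<Rightarrow> ennreal" where
  "singular_area n A c R e x =
     (\<Sum>ij\<in>indices n. emeasure lborel (Pair x -` (near_singular n A c R e ij \<inter> (space (entries n) \<times> UNIV))))"

lemma singular_area_measurable [measurable]: "singular_area n A c R e \<in> borel_measurable (entries n)"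
  unfolding singular_area_def
  by (intro borel_measurable_sum lborel.measurable_emeasure_Pair near_singular_measurable)

text \<open>By Tonelli the expected area is the integral over z of the probabilities just bounded.\<close>
lemma expected_singular_area:
  assumes c: "c > 0" and e: "e > 0" and R: "R \<ge> 0"
  shows "(\<integral>\<^sup>+ x. singular_area n A c R e x \<partial>entries n) \<le> ennreal ((real n)\<^sup>2 * (K * (e / c)\<^sup>2 * (pi * R\<^sup>2)))"
proof -
  interpret E: prob_space "entries n" by (rule prob_entries)
  interpret pr: pair_sigma_finite "entries n" "lborel :: complex measure" ..
  have one: "(\<integral>\<^sup>+ x. emeasure lborel (Pair x -` (near_singular n A c R e ij \<inter> (space (entries n) \<times> UNIV))) \<partial>entries n)
     \<le> ennreal (K * (e / c)\<^sup>2 * (pi * R\<^sup>2))" if ij: "ij \<in> indices n" for ij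
  proof -
    let ?Q = "near_singular n A c R e ij \<inter> (space (entries n) \<times> UNIV)"
    have Q: "?Q \<in> sets (entries n \<Otimes>\<^sub>M lborel)" by (rule near_singular_measurable[OF ij])
    have "(\<integral>\<^sup>+ x. emeasure lborel (Pair x -` ?Q) \<partial>entries n) = emeasure (entries n \<Otimes>\<^sub>M lborel) ?Q"
      by (rule lborel.emeasure_pair_measure_alt[symmetric, OF Q])
    also have "\<dots> = (\<integral>\<^sup>+ z. emeasure (entries n) ((\<lambda>x. (x, z)) -` ?Q) \<partial>lborel)"
      by (rule pr.emeasure_pair_measure_alt2[OF Q])
    also have "\<dots> \<le> (\<integral>\<^sup>+ z. ennreal (K * (e / c)\<^sup>2) * indicator (ball (0::complex) R) z \<partial>lborel)"
    proof (rule nn_integral_mono)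
      fix z :: complex
      have eq: "(\<lambda>x. (x, z)) -` ?Q = {x \<in> space (entries n). (x,z) \<in> near_singular n A c R e ij}" by auto
      show "emeasure (entries n) ((\<lambda>x. (x, z)) -` ?Q) \<le> ennreal (K * (e / c)\<^sup>2) * indicator (ball 0 R) z"
      proof (cases "z \<in> ball 0 R")
        case True
        then show ?thesis unfolding eq using near_singular_fibre_prob[OF ij c e] by simp
      next
        case False
        then have emp: "(\<lambda>x. (x, z)) -` ?Q = {}"
          by (auto simp: near_singular_def)
        show ?thesis unfolding emp by simp
      qed
    qed
    also have "\<dots> = ennreal (K * (e / c)\<^sup>2) * emeasure lborel (ball (0::complex) R)"
      by (rule nn_integral_cmult_indicator) simp
    also have "\<dots> = ennreal (K * (e / c)\<^sup>2 * (pi * R\<^sup>2))"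
      using R K_nonneg by (simp add: emeasure_ball_complex ennreal_mult)
    finally show ?thesis .
  qed
  have "(\<integral>\<^sup>+ x. singular_area n A c R e x \<partial>entries n) =
    (\<Sum>ij\<in>indices n. (\<integral>\<^sup>+ x. emeasure lborel (Pair x -` (near_singular n A c R e ij \<inter> (space (entries n) \<times> UNIV))) \<partial>entries n))"
    unfolding singular_area_def
    by (rule nn_integral_sum) (rule lborel.measurable_emeasure_Pair, erule near_singular_measurable)
  also have "\<dots> \<le> (\<Sum>ij\<in>indices n. ennreal (K * (e / c)\<^sup>2 * (pi * R\<^sup>2)))" by (intro sum_mono one)
  also have "\<dots> = ennreal ((real n)\<^sup>2 * (K * (e / c)\<^sup>2 * (pi * R\<^sup>2)))"
    using K_nonneg by (subst sum_ennreal) (auto simp: power2_eq_square)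
  finally show ?thesis .
qed

text \<open>The area per e squared as e tends to 0 along 1 / (m + 1).  A limit inferior along a sequence
  is what Fatou's lemma controls.\<close>
definition area_density :: "nat \<Rightarrow> complex mat \<Rightarrow> real \<Rightarrow> real \<Rightarrow> (nat \<times> nat \<Rightarrow> complex) \<Rightarrow> ennreal" where
  "area_density n A c R x = liminf (\<lambda>m. ennreal ((real (Suc m))\<^sup>2) * singular_area n A c R (1 / real (Suc m)) x)"

lemma area_density_measurable [measurable]: "area_density n A c R \<in> borel_measurable (entries n)"
  unfolding area_density_def[abs_def] by measurable

lemma expected_area_density:
  assumes c: "c > 0" and R: "R \<ge> 0"
  shows "(\<integral>\<^sup>+ x. area_density n A c R x \<partial>entries n) \<le> ennreal ((real n)\<^sup>2 * K * pi * R\<^sup>2 / c\<^sup>2)"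
proof -
  have "(\<integral>\<^sup>+ x. area_density n A c R x \<partial>entries n)
    \<le> liminf (\<lambda>m. \<integral>\<^sup>+ x. ennreal ((real (Suc m))\<^sup>2) * singular_area n A c R (1 / real (Suc m)) x \<partial>entries n)"
    unfolding area_density_def by (rule nn_integral_liminf) measurable
  also have "\<dots> \<le> liminf (\<lambda>m. ennreal ((real n)\<^sup>2 * K * pi * R\<^sup>2 / c\<^sup>2))"
  proof (rule Liminf_mono, rule always_eventually, rule allI)
    fix m
    have "(\<integral>\<^sup>+ x. ennreal ((real (Suc m))\<^sup>2) * singular_area n A c R (1 / real (Suc m)) x \<partial>entries n)
      = ennreal ((real (Suc m))\<^sup>2) * (\<integral>\<^sup>+ x. singular_area n A c R (1 / real (Suc m)) x \<partial>entries n)"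
      by (rule nn_integral_cmult) measurable
    also have "\<dots> \<le> ennreal ((real (Suc m))\<^sup>2) * ennreal ((real n)\<^sup>2 * (K * (1 / real (Suc m) / c)\<^sup>2 * (pi * R\<^sup>2)))"
      by (intro mult_left_mono expected_singular_area c R) auto
    also have "\<dots> = ennreal ((real (Suc m))\<^sup>2 * ((real n)\<^sup>2 * (K * (1 / real (Suc m) / c)\<^sup>2 * (pi * R\<^sup>2))))"
      using K_nonneg by (intro ennreal_mult[symmetric]) auto
    also have "(real (Suc m))\<^sup>2 * ((real n)\<^sup>2 * (K * (1 / real (Suc m) / c)\<^sup>2 * (pi * R\<^sup>2))) = (real n)\<^sup>2 * K * pi * R\<^sup>2 / c\<^sup>2"
    proof -
      have "s\<^sup>2 * ((real n)\<^sup>2 * (K * (1 / s / c)\<^sup>2 * (pi * R\<^sup>2))) = (real n)\<^sup>2 * K * pi * R\<^sup>2 / c\<^sup>2" if "s \<noteq> 0" for s :: real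
        using that c by (simp add: power_divide power_mult_distrib)
      then show ?thesis by (metis of_nat_eq_0_iff nat.distinct(2))
    qed
    finally show "(\<integral>\<^sup>+ x. ennreal ((real (Suc m))\<^sup>2) * singular_area n A c R (1 / real (Suc m)) x \<partial>entries n)
      \<le> ennreal ((real n)\<^sup>2 * K * pi * R\<^sup>2 / c\<^sup>2)" .
  qed
  also have "\<dots> = ennreal ((real n)\<^sup>2 * K * pi * R\<^sup>2 / c\<^sup>2)" by (simp add: Liminf_const)
  finally show ?thesis .
qed

lemma area_density_large_prob:
  assumes c: "c > 0" and R: "R > 0" and K: "K > 0" and n: "n > 0"
  shows "emeasure (entries n) {x \<in> space (entries n). ennreal (4 * (real n)\<^sup>2 * K * pi * R\<^sup>2 / c\<^sup>2) \<le> area_density n A c R x} \<le> ennreal (1/4)"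
proof -
  define b where "b = (real n)\<^sup>2 * K * pi * R\<^sup>2 / c\<^sup>2"
  have b: "b > 0" unfolding b_def using c R K n by simp
  have iff: "ennreal (4 * b) \<le> t \<longleftrightarrow> 1 \<le> ennreal (1 / (4 * b)) * t" for t
  proof (cases t)
    case (real r)
    have "1 \<le> ennreal (1 / (4 * b)) * t \<longleftrightarrow> ennreal 1 \<le> ennreal (1 / (4 * b) * r)"
      unfolding real(2) using real(1) b by (subst ennreal_mult[symmetric]) auto
    also have "\<dots> \<longleftrightarrow> 4 * b \<le> r" using b real by (subst ennreal_le_iff) (auto simp: field_simps)
    finally have f: "1 \<le> ennreal (1 / (4 * b)) * t \<longleftrightarrow> 4 * b \<le> r" .
    have "ennreal (4 * b) \<le> t \<longleftrightarrow> 4 * b \<le> r" using real b by simp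
    with f show ?thesis by blast
  next
    case top
    have "ennreal (1 / (4 * b)) \<noteq> 0" using b by simp
    then show ?thesis unfolding top by (simp add: ennreal_mult_top)
  qed
  have "emeasure (entries n) {x \<in> space (entries n). ennreal (4 * b) \<le> area_density n A c R x}
     = emeasure (entries n) {x \<in> space (entries n). 1 \<le> ennreal (1 / (4 * b)) * area_density n A c R x}"
    unfolding iff ..
  also have "\<dots> \<le> ennreal (1 / (4 * b)) * (\<integral>\<^sup>+ x. area_density n A c R x * indicator (space (entries n)) x \<partial>entries n)"
    by (rule nn_integral_Markov_inequality) simp_all
  also have "(\<integral>\<^sup>+ x. area_density n A c R x * indicator (space (entries n)) x \<partial>entries n) = (\<integral>\<^sup>+ x. area_density n A c R x \<partial>entries n)"
    by (rule nn_integral_cong) simp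
  also have "ennreal (1 / (4 * b)) * \<dots> \<le> ennreal (1 / (4 * b)) * ennreal b"
    using expected_area_density[OF c, of R n A] R unfolding b_def by (intro mult_left_mono) auto
  also have "\<dots> = ennreal (1 / 4)" using b by (simp add: ennreal_mult[symmetric])
  finally show ?thesis by (simp add: b_def mult_ac)
qed

end

section \<open>Almost sure simplicity of the spectrum\<close>

lemma spectral_disc_closed:
  fixes F :: "('x \<Rightarrow> complex) \<Rightarrow> bool"
  assumes const: "\<And>a. F (\<lambda>x. a)"
    and add: "\<And>f g. F f \<Longrightarrow> F g \<Longrightarrow> F (\<lambda>x. f x + g x)"
    and mult: "\<And>f g. F f \<Longrightarrow> F g \<Longrightarrow> F (\<lambda>x. f x * g x)"
    and B: "\<And>x. B x \<in> carrier_mat n n"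
    and entries: "\<And>i j. i < n \<Longrightarrow> j < n \<Longrightarrow> F (\<lambda>x. B x $$ (i,j))"
  shows "F (\<lambda>x. spectral_disc (B x))"
proof -
  have F_sum: "F (\<lambda>x. \<Sum>s\<in>S. f s x)" if "\<And>s. s \<in> S \<Longrightarrow> F (f s)" for S :: "nat set" and f
    using that by (induction S rule: infinite_finite_induct) (auto intro: const add)
  have pow: "F (\<lambda>x. (B x ^\<^sub>m k) $$ (i,j))" if "i < n" "j < n" for i j k
    using that
  proof (induction k arbitrary: i j)
    case 0
    have "(B x ^\<^sub>m 0) $$ (i,j) = (if i = j then 1 else 0)" for x using B[of x] 0 by simp
    then show ?case using const by simp
  next
    case (Suc k)
    have "(B x ^\<^sub>m Suc k) $$ (i,j) = (\<Sum>l<n. (B x ^\<^sub>m k) $$ (i,l) * B x $$ (l,j))" for x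
      using mult_mat_nth[of "B x ^\<^sub>m k" n n "B x" n i j] B[of x] Suc.prems by simp
    then show ?case using Suc by (simp only:) (intro F_sum mult entries, auto)
  qed
  have dim: "dim_row (B x) = n" for x using B[of x] by auto
  show ?thesis unfolding spectral_disc_def dim
  proof (rule det_closed[of F _ n, OF const add mult])
    fix i j assume "i < n" "j < n"
    then show "F (\<lambda>x. mat n n (\<lambda>(a,b). power_trace (B x) (a + b)) $$ (i,j))"
      by (simp add: power_trace_def dim) (intro F_sum pow, auto)
  qed auto
qed

lemma spectral_disc_diag_nonzero: "spectral_disc (mat_diag n of_nat) \<noteq> 0"
proof -
  let ?D = "mat_diag n of_nat :: complex mat"
  have D: "?D \<in> carrier_mat n n" by simp
  have "similar_mat_wit ?D ?D (1\<^sub>m n) (1\<^sub>m n)" by (rule similar_mat_wit_refl[OF D])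
  then have "spectral_disc ?D = (det (mat n n (\<lambda>(i,a). (?D $$ (i,i)) ^ a)))\<^sup>2"
    by (rule spectral_disc_similar[OF D]) (auto simp: mat_diag_def)
  also have "mat n n (\<lambda>(i,a). (?D $$ (i,i)) ^ a) = mat n n (\<lambda>(i,a). of_nat i ^ a)"
    by (rule eq_matI) (auto simp: mat_diag_def)
  finally have "spectral_disc ?D = (det (mat n n (\<lambda>(i,a). of_nat i ^ a)))\<^sup>2" .
  moreover have "det (mat n n (\<lambda>(i,a). (of_nat i :: complex) ^ a)) \<noteq> 0"
    by (rule det_vandermonde_nonzero) (auto simp: inj_on_def)
  ultimately show ?thesis by simp
qed

context bounded_density_law
begin

lemma singleton_null: "emeasure \<mu> {a} = 0"
proof -
  have "emeasure \<mu> {a} \<le> ennreal (K * r\<^sup>2)" if "r > 0" for r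
    by (rule order_trans[OF emeasure_mono ball_le[of r a]]) (use that in \<open>auto simp: sets_mu\<close>)
  note small = this
  have le_eps: "emeasure \<mu> {a} \<le> ennreal e" if "e > 0" for e
  proof -
    have "emeasure \<mu> {a} \<le> ennreal (K * (sqrt (e / (K + 1)))\<^sup>2)"
      using that K_nonneg by (intro small) simp
    also have "\<dots> \<le> ennreal e" using that K_nonneg by (intro ennreal_leI) (simp add: field_simps)
    finally show ?thesis .
  qed
  have "emeasure \<mu> {a} \<le> 0" by (rule ennreal_le_epsilon) (simp add: le_eps)
  then show ?thesis by simp
qed

lemma finite_null:
  assumes "finite S" shows "emeasure \<mu> S = 0"
proof -
  have "emeasure \<mu> S = (\<Sum>a\<in>S. emeasure \<mu> {a})"
    by (rule emeasure_eq_sum_singleton) (use assms in \<open>auto simp: sets_mu\<close>)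
  then show ?thesis by (simp add: singleton_null)
qed

text \<open>Start at a point y where f does not vanish and replace its coordinates one at a time by random
  ones.  At each step f is a polynomial in the new coordinate that is almost surely not the zero
  polynomial, since its value at the old coordinate is nonzero; and the law charges no finite set.\<close>
lemma polynomial_AE_nonzero:
  fixes f :: "(nat \<times> nat \<Rightarrow> complex) \<Rightarrow> complex"
  assumes meas: "f \<in> borel_measurable (entries n)"
    and poly: "\<And>x ij. ij \<in> indices n \<Longrightarrow> \<exists>q. \<forall>t. f (x(ij := t)) = poly q t"
    and y: "y \<in> space (entries n)" "f y \<noteq> 0"
  shows "AE x in entries n. f x \<noteq> 0"
proof -
  interpret pp: product_sigma_finite "\<lambda>_. \<mu>" by (rule product_sigma_finite.intro) (rule sigma_finite_measure_axioms)
  define glue where "glue S x = (\<lambda>ij\<in>indices n. if ij \<in> S then x ij else y ij)" for S :: "(nat \<times> nat) set" and x :: "nat \<times> nat \<Rightarrow> complex"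
  have yu: "y ij \<in> space \<mu>" if "ij \<in> indices n" for ij using y(1) that by (auto simp: space_PiM)
  have glue_meas: "glue S \<in> measurable (Pi\<^sub>M S (\<lambda>_. \<mu>)) (entries n)" for S
    unfolding glue_def
  proof (rule measurable_restrict)
    fix ij assume "ij \<in> indices n"
    then show "(\<lambda>x. if ij \<in> S then x ij else y ij) \<in> measurable (Pi\<^sub>M S (\<lambda>_. \<mu>)) \<mu>"
      using yu by (cases "ij \<in> S") auto
  qed
  have null: "emeasure (Pi\<^sub>M S (\<lambda>_. \<mu>)) {x \<in> space (Pi\<^sub>M S (\<lambda>_. \<mu>)). f (glue S x) = 0} = 0"
    if "finite S" "S \<subseteq> indices n" for S
    using that
  proof (induction S rule: finite_induct)
    case empty
    have "glue {} x = y" for x using y(1) by (auto simp: glue_def space_PiM PiE_def extensional_def)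
    then show ?case using y(2) by simp
  next
    case (insert i S)
    let ?I = "insert i S"
    have i: "i \<in> indices n" using insert.prems by auto
    let ?Z = "\<lambda>S. {x \<in> space (Pi\<^sub>M S (\<lambda>_. \<mu>)). f (glue S x) = 0}"
    have fg: "(\<lambda>x. f (glue S x)) \<in> borel_measurable (Pi\<^sub>M S (\<lambda>_. \<mu>))" for S
      using measurable_comp[OF glue_meas meas] by (simp add: comp_def)
    have Z: "?Z S \<in> sets (Pi\<^sub>M S (\<lambda>_. \<mu>))" for S using fg[of S] by measurable
    have ind: "(\<lambda>x. indicator (?Z ?I) x :: ennreal) \<in> borel_measurable (Pi\<^sub>M ?I (\<lambda>_. \<mu>))" using Z by simp
    have inner: "(\<integral>\<^sup>+ t. indicator (?Z ?I) (x(i := t)) \<partial>\<mu>) = 0" if x: "f (glue S x) \<noteq> 0" for x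
    proof -
      have gl: "glue ?I (x(i := t)) = (glue S x)(i := t)" for t
        using i insert.hyps by (auto simp: glue_def)
      obtain q where q: "\<And>t. f ((glue S x)(i := t)) = poly q t" using poly[OF i] by blast
      have "(glue S x)(i := y i) = glue S x" using i insert.hyps by (auto simp: glue_def)
      then have "poly q (y i) \<noteq> 0" using x q[of "y i"] by simp
      then have "q \<noteq> 0" by auto
      then have fin: "finite {t. poly q t = 0}" by (rule poly_roots_finite)
      have "(\<integral>\<^sup>+ t. indicator (?Z ?I) (x(i := t)) \<partial>\<mu>) \<le> (\<integral>\<^sup>+ t. indicator {t. poly q t = 0} t \<partial>\<mu>)"
        by (intro nn_integral_mono) (auto simp: indicator_def gl q)
      also have "\<dots> = emeasure \<mu> {t. poly q t = 0}"
        using fin by (intro nn_integral_indicator) (simp add: sets_mu finite_imp_closed borel_closed)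
      finally show ?thesis using finite_null[OF fin] by simp
    qed
    have "emeasure (Pi\<^sub>M ?I (\<lambda>_. \<mu>)) (?Z ?I) = (\<integral>\<^sup>+ x. indicator (?Z ?I) x \<partial>Pi\<^sub>M ?I (\<lambda>_. \<mu>))"
      using Z by simp
    also have "\<dots> = (\<integral>\<^sup>+ x. (\<integral>\<^sup>+ t. indicator (?Z ?I) (x(i := t)) \<partial>\<mu>) \<partial>Pi\<^sub>M S (\<lambda>_. \<mu>))"
      by (rule pp.product_nn_integral_insert[OF insert.hyps ind])
    also have "\<dots> = (\<integral>\<^sup>+ x. 0 \<partial>Pi\<^sub>M S (\<lambda>_. \<mu>))"
    proof (rule nn_integral_cong_AE)
      have "?Z S \<in> null_sets (Pi\<^sub>M S (\<lambda>_. \<mu>))" using insert Z by auto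
      then have "AE x in Pi\<^sub>M S (\<lambda>_. \<mu>). x \<notin> ?Z S" by (rule AE_not_in)
      then show "AE x in Pi\<^sub>M S (\<lambda>_. \<mu>). (\<integral>\<^sup>+ t. indicator (?Z ?I) (x(i := t)) \<partial>\<mu>) = 0"
        using AE_space by eventually_elim (rule inner, auto)
    qed
    finally show ?case by simp
  qed
  have gI: "glue (indices n) x = x" if "x \<in> space (entries n)" for x
    using that by (auto simp: glue_def space_PiM PiE_def extensional_def)
  have "{x \<in> space (entries n). f x = 0} = {x \<in> space (entries n). f (glue (indices n) x) = 0}"
    using gI by auto
  then have "emeasure (entries n) {x \<in> space (entries n). f x = 0} = 0" using null[of "indices n"] by simp
  moreover have "{x \<in> space (entries n). f x = 0} \<in> sets (entries n)" using meas by measurable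
  ultimately have "{x \<in> space (entries n). f x = 0} \<in> null_sets (entries n)" by auto
  then have "AE x in entries n. x \<notin> {x \<in> space (entries n). f x = 0}" by (rule AE_not_in)
  then show ?thesis using AE_space by eventually_elim auto
qed

text \<open>The discriminant is not identically zero: the perturbation can turn A into a diagonal matrix
  with the distinct entries 0, 1, ..., n - 1.\<close>
lemma AE_simple_spectrum:
  assumes c: "c > 0"
  shows "AE x in entries n. spectral_disc (perturbed n A c x) \<noteq> 0"
proof (rule polynomial_AE_nonzero)
  have ent: "(\<lambda>x. perturbed n A c x $$ (i,j)) \<in> borel_measurable (entries n)" if "i < n" "j < n" for i j
    using component_measurable[of "(i,j)" n] that by (simp add: perturbed_def)
  show "(\<lambda>x. spectral_disc (perturbed n A c x)) \<in> borel_measurable (entries n)"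
    by (rule spectral_disc_closed[where n = n and F = "\<lambda>f. f \<in> borel_measurable (entries n)" and B = "perturbed n A c"])
      (auto intro: ent)
  show "\<exists>q. \<forall>t. spectral_disc (perturbed n A c (x(ij := t))) = poly q t" if "ij \<in> indices n" for x ij
  proof (rule spectral_disc_closed[where n = n and F = "\<lambda>f. \<exists>q. \<forall>t. f t = poly q t" and B = "\<lambda>t. perturbed n A c (x(ij := t))"])
    fix a :: complex
    show "\<exists>q. \<forall>t. a = poly q t" by (rule exI[of _ "[:a:]"]) simp
  next
    fix f g :: "complex \<Rightarrow> complex"
    assume "\<exists>q. \<forall>t. f t = poly q t" "\<exists>q. \<forall>t. g t = poly q t"
    then obtain p q where pq: "\<forall>t. f t = poly p t" "\<forall>t. g t = poly q t" by blast
    show "\<exists>q. \<forall>t. f t + g t = poly q t" by (rule exI[of _ "p + q"]) (simp add: pq)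
    show "\<exists>q. \<forall>t. f t * g t = poly q t" by (rule exI[of _ "p * q"]) (simp add: pq)
  next
    fix i j assume ij': "i < n" "j < n"
    show "\<exists>q. \<forall>t. perturbed n A c (x(ij := t)) $$ (i,j) = poly q t"
    proof (cases "ij = (i,j)")
      case True
      show ?thesis by (rule exI[of _ "[:A $$ (i,j), complex_of_real c:]"]) (use True ij' in \<open>simp add: perturbed_def\<close>)
    next
      case False
      show ?thesis by (rule exI[of _ "[:A $$ (i,j) + complex_of_real c * x (i,j):]"]) (use False ij' in \<open>simp add: perturbed_def\<close>)
    qed
  qed simp
  let ?y = "\<lambda>ij\<in>indices n. (of_nat (if fst ij = snd ij then fst ij else 0) - A $$ ij) / complex_of_real c"
  show "?y \<in> space (entries n)"
    using sets_eq_imp_space_eq[OF sets_mu] by (auto simp: space_PiM)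
  have "perturbed n A c ?y = mat_diag n of_nat"
    by (rule eq_matI) (use c in \<open>auto simp: perturbed_def mat_diag_def\<close>)
  then show "spectral_disc (perturbed n A c ?y) \<noteq> 0" using spectral_disc_diag_nonzero by simp
qed

end

section \<open>Exponential moments of sub-Gaussian variables\<close>

text \<open>An inequality that removes the linear term: after integration against a centred variable only
  the quadratic exponential remains.\<close>
lemma exp_le_add_exp_square: "exp x \<le> x + exp (x\<^sup>2)" for x :: real
proof -
  consider "x \<ge> 1" | "x \<le> -1" | "0 \<le> x" "x \<le> 1" | "-1 \<le> x" "x \<le> 0" by linarith
  then show ?thesis
  proof cases
    case 1
    then have "x \<le> x\<^sup>2" by (simp add: power2_eq_square)
    then have "exp x \<le> exp (x\<^sup>2)" by simp
    then show ?thesis using 1 by linarith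
  next
    case 2
    have "exp x \<le> 1" using 2 by simp
    moreover have "- x * 1 \<le> - x * - x" using 2 by (intro mult_left_mono) auto
    then have "- x \<le> x\<^sup>2" by (simp add: power2_eq_square)
    moreover have "1 + x\<^sup>2 \<le> exp (x\<^sup>2)" by simp
    ultimately show ?thesis by linarith
  next
    case 3
    then have "exp x \<le> 1 + x + x\<^sup>2" by (rule exp_bound)
    moreover have "1 + x\<^sup>2 \<le> exp (x\<^sup>2)" by simp
    ultimately show ?thesis by linarith
  next
    case 4
    define u where "u = - x"
    have u: "0 \<le> u" "u \<le> 1" using 4 by (auto simp: u_def)
    have "1 + u + u\<^sup>2 / 2 \<le> exp u" using u(1) by (rule exp_lower_Taylor_quadratic)
    then have "(1 + u + u\<^sup>2 / 2) * exp (- u) \<le> 1" by (simp add: exp_minus field_simps)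
    moreover have "(1 + u + u\<^sup>2 / 2) * (1 - u + u\<^sup>2) = 1 + u\<^sup>2 / 2 + u ^ 3 / 2 + u ^ 4 / 2"
      by (simp add: field_simps power2_eq_square power3_eq_cube power4_eq_xxxx)
    moreover have "1 + u\<^sup>2 / 2 + u ^ 3 / 2 + u ^ 4 / 2 \<ge> 1" using u by simp
    ultimately have "(1 + u + u\<^sup>2 / 2) * exp (- u) \<le> (1 + u + u\<^sup>2 / 2) * (1 - u + u\<^sup>2)" by simp
    moreover have "1 + u + u\<^sup>2 / 2 > 0" using u(1) zero_le_power2[of u] by linarith
    ultimately have "exp (- u) \<le> 1 - u + u\<^sup>2" by (rule mult_left_le_imp_le)
    then have "exp x \<le> 1 + x + x\<^sup>2" by (simp add: u_def)
    moreover have "1 + x\<^sup>2 \<le> exp (x\<^sup>2)" by simp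
    ultimately show ?thesis by linarith
  qed
qed

lemma exp_scaled_le:
  fixes t u :: real
  assumes "0 \<le> t" "t \<le> 1"
  shows "exp (t * u) \<le> 1 + t * (exp u - 1)"
  using convex_onD[OF exp_convex, of t 0 u] assms by (simp add: algebra_simps)

locale sub_gaussian_law = prob_space \<mu> for \<mu> :: "complex measure" +
  fixes a0 C0 :: real
  assumes sets_eq [measurable_cong]: "sets \<mu> = sets borel"
    and a0: "a0 > 0" and C0: "C0 > 0"
    and tail: "\<And>t. t \<ge> 0 \<Longrightarrow> emeasure \<mu> {y. cmod y > t} \<le> ennreal (C0 * exp (- a0 * t\<^sup>2))"
    and mean_zero: "(\<integral>y. y \<partial>\<mu>) = 0"
begin

text \<open>The tail decays like exp (- a0 t), where t is the squared modulus, so an exponential with half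
  that rate is integrable.  The layers are the unit intervals of the squared modulus, which turns the
  bound into a geometric series.\<close>
lemma exp_square_moment:
  "(\<integral>\<^sup>+ y. ennreal (exp (a0 / 2 * (cmod y)\<^sup>2)) \<partial>\<mu>) \<le> ennreal (1 + C0 * exp (a0 / 2) / (1 - exp (- a0 / 2)))"
proof -
  define a where "a = a0 / 2"
  have a: "a > 0" using a0 by (simp add: a_def)
  let ?g = "\<lambda>m y. ennreal (exp (a * (real m + 1))) * indicator {y. (cmod y)\<^sup>2 > real m} y"
  have term_le: "f m \<le> (\<Sum>m. f m)" for f :: "nat \<Rightarrow> ennreal" and m
    using sum_le_suminf[of f "{m}"] by simp
  have ptw: "ennreal (exp (a * (cmod y)\<^sup>2)) \<le> 1 + (\<Sum>m. ?g m y)" for y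
  proof (cases "y = 0")
    case True
    then show ?thesis by simp
  next
    case False
    define m where "m = nat (\<lceil>(cmod y)\<^sup>2\<rceil> - 1)"
    have p: "(cmod y)\<^sup>2 > 0" using False by simp
    then have "\<lceil>(cmod y)\<^sup>2\<rceil> \<ge> 1" by (simp add: one_le_ceiling)
    then have m: "real m = of_int \<lceil>(cmod y)\<^sup>2\<rceil> - 1" by (simp add: m_def)
    have m1: "real m < (cmod y)\<^sup>2" and m2: "(cmod y)\<^sup>2 \<le> real m + 1" unfolding m by linarith+
    have "ennreal (exp (a * (cmod y)\<^sup>2)) \<le> ?g m y"
      using m1 m2 a by (simp add: ennreal_leI)
    also have "\<dots> \<le> (\<Sum>m. ?g m y)" by (rule term_le)
    finally show ?thesis by (simp add: add_increasing)
  qed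
  have g: "(\<integral>\<^sup>+ y. ?g m y \<partial>\<mu>) \<le> ennreal (C0 * exp a * exp (- a) ^ m)" for m
  proof -
    have ms: "{y. (cmod y)\<^sup>2 > real m} \<in> sets \<mu>" unfolding sets_eq by measurable
    have eq: "{y. (cmod y)\<^sup>2 > real m} = {y. cmod y > sqrt (real m)}"
      using real_less_lsqrt real_less_rsqrt by (auto simp: real_sqrt_less_iff) (metis abs_norm_cancel real_sqrt_abs real_sqrt_less_iff)+
    have "(\<integral>\<^sup>+ y. ?g m y \<partial>\<mu>) = ennreal (exp (a * (real m + 1))) * emeasure \<mu> {y. (cmod y)\<^sup>2 > real m}"
      using ms by (rule nn_integral_cmult_indicator)
    also have "\<dots> \<le> ennreal (exp (a * (real m + 1))) * ennreal (C0 * exp (- a0 * (sqrt (real m))\<^sup>2))"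
      unfolding eq by (intro mult_left_mono tail) auto
    also have "\<dots> = ennreal (exp (a * (real m + 1)) * (C0 * exp (- a0 * (sqrt (real m))\<^sup>2)))"
      using C0 by (simp add: ennreal_mult)
    also have "exp (a * (real m + 1)) * (C0 * exp (- a0 * (sqrt (real m))\<^sup>2)) = C0 * (exp (a * (real m + 1) - a0 * real m))"
      by (simp add: exp_diff exp_minus field_simps)
    also have "a * (real m + 1) - a0 * real m = a + real m * (- a)" by (simp add: a_def field_simps)
    also have "C0 * exp (a + real m * (- a)) = C0 * exp a * exp (- a) ^ m"
      unfolding exp_add exp_of_nat_mult by simp
    finally show ?thesis .
  qed
  have q: "norm (exp (- a)) < 1" using a by simp
  have "(\<integral>\<^sup>+ y. ennreal (exp (a * (cmod y)\<^sup>2)) \<partial>\<mu>) \<le> (\<integral>\<^sup>+ y. 1 + (\<Sum>m. ?g m y) \<partial>\<mu>)"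
    by (rule nn_integral_mono) (rule ptw)
  also have "\<dots> = (\<integral>\<^sup>+ y. 1 \<partial>\<mu>) + (\<integral>\<^sup>+ y. (\<Sum>m. ?g m y) \<partial>\<mu>)"
    by (rule nn_integral_add) (measurable)
  also have "(\<integral>\<^sup>+ y. (\<Sum>m. ?g m y) \<partial>\<mu>) = (\<Sum>m. \<integral>\<^sup>+ y. ?g m y \<partial>\<mu>)"
    by (rule nn_integral_suminf) measurable
  also have "\<dots> \<le> (\<Sum>m. ennreal (C0 * exp a * exp (- a) ^ m))"
    by (rule suminf_le) (auto intro: g)
  also have "\<dots> = ennreal (\<Sum>m. C0 * exp a * exp (- a) ^ m)"
    using C0 q by (intro suminf_ennreal2 summable_mult summable_geometric) auto
  also have "(\<Sum>m. C0 * exp a * exp (- a) ^ m) = C0 * exp a * (1 / (1 - exp (- a)))"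
    using q by (simp only: suminf_mult[OF summable_geometric] suminf_geometric)
  also have "(\<integral>\<^sup>+ y. 1 \<partial>\<mu>) + ennreal (C0 * exp a * (1 / (1 - exp (- a)))) = ennreal (1 + C0 * exp a / (1 - exp (- a)))"
  proof -
    have "C0 * exp a / (1 - exp (- a)) \<ge> 0" using C0 a by simp
    then have "ennreal 1 + ennreal (C0 * exp a / (1 - exp (- a))) = ennreal (1 + C0 * exp a / (1 - exp (- a)))"
      by (intro ennreal_plus[symmetric]) auto
    then show ?thesis by (simp add: emeasure_space_1)
  qed
  finally show ?thesis by (simp add: a_def add_left_mono)
qed

text \<open>Let a = a0 / 2.  If t = |w|^2 / a is at most 1, the inequality above reduces the claim to the t-th
  power of the square-exponential moment, and convexity of exp handles that power.  If t > 1, the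
  arithmetic-geometric mean inequality bounds Re (w y) by t + a |y|^2, and the constant moment
  is absorbed by exp (t L).\<close>
lemma linear_mgf_bound:
  "\<exists>B>0. \<forall>w. (\<integral>\<^sup>+ y. ennreal (exp (Re (w * y))) \<partial>\<mu>) \<le> ennreal (exp (B * (cmod w)\<^sup>2))"
proof -
  define a where "a = a0 / 2"
  define L where "L = 1 + C0 * exp (a0 / 2) / (1 - exp (- a0 / 2))"
  have a: "a > 0" using a0 by (simp add: a_def)
  have L: "L \<ge> 1" unfolding L_def using C0 a0 by simp
  have mom: "(\<integral>\<^sup>+ y. ennreal (exp (a * (cmod y)\<^sup>2)) \<partial>\<mu>) \<le> ennreal L"
    unfolding L_def a_def by (rule exp_square_moment)
  have ie: "integrable \<mu> (\<lambda>y. exp (a * (cmod y)\<^sup>2))"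
    by (rule integrableI_bounded) (simp_all add: le_less_trans[OF mom ennreal_less_top])
  have Ee: "(\<integral>y. exp (a * (cmod y)\<^sup>2) \<partial>\<mu>) \<le> L"
    using mom L nn_integral_eq_integral[OF ie] by (simp add: ennreal_le_iff)
  have absb: "cmod y \<le> exp (a * (cmod y)\<^sup>2) * (1 / a + 1)" for y
  proof (cases "cmod y \<le> 1")
    case True
    have "1 * 1 \<le> exp (a * (cmod y)\<^sup>2) * (1 / a + 1)" using a by (intro mult_mono) auto
    then show ?thesis using True by linarith
  next
    case False
    then have "cmod y * 1 \<le> cmod y * cmod y" by (intro mult_left_mono) auto
    then have "cmod y \<le> (cmod y)\<^sup>2" by (simp add: power2_eq_square)
    also have "\<dots> = a * (cmod y)\<^sup>2 * (1 / a)" using a by simp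
    also have "\<dots> \<le> exp (a * (cmod y)\<^sup>2) * (1 / a + 1)"
    proof (rule mult_mono)
      show "a * (cmod y)\<^sup>2 \<le> exp (a * (cmod y)\<^sup>2)" using exp_ge_add_one_self[of "a * (cmod y)\<^sup>2"] by linarith
    qed (use a in auto)
    finally show ?thesis .
  qed
  have iy: "integrable \<mu> (\<lambda>y. y)"
    by (rule Bochner_Integration.integrable_bound[OF integrable_mult_left[OF ie, of "1 / a + 1"]])
      (use absb a in \<open>auto intro: order_trans[OF _ abs_ge_self]\<close>)
  show ?thesis
  proof (intro exI[of _ "(L + 1) / a"] conjI allI)
    show "(L + 1) / a > 0" using L a by simp
    fix w :: complex
    define t where "t = (cmod w)\<^sup>2 / a"
    have t0: "t \<ge> 0" using a by (simp add: t_def)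
    have w2: "(cmod w)\<^sup>2 = t * a" using a by (simp add: t_def)
    have rw: "\<bar>Re (w * y)\<bar> \<le> cmod w * cmod y" for y
      by (metis abs_Re_le_cmod norm_mult)
    show "(\<integral>\<^sup>+ y. ennreal (exp (Re (w * y))) \<partial>\<mu>) \<le> ennreal (exp ((L + 1) / a * (cmod w)\<^sup>2))"
    proof (cases "t \<le> 1")
      case True
      have ptw: "exp (Re (w * y)) \<le> Re (w * y) + (1 + t * (exp (a * (cmod y)\<^sup>2) - 1))" for y
      proof -
        have "(Re (w * y))\<^sup>2 \<le> (cmod w * cmod y)\<^sup>2" using rw[of y] by (rule power2_le_iff_abs_le[THEN iffD2, rotated]) simp
        also have "\<dots> = t * (a * (cmod y)\<^sup>2)" by (simp add: power_mult_distrib w2)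
        finally have "exp ((Re (w * y))\<^sup>2) \<le> exp (t * (a * (cmod y)\<^sup>2))" by simp
        then show ?thesis using exp_le_add_exp_square[of "Re (w * y)"] exp_scaled_le[OF t0 True, of "a * (cmod y)\<^sup>2"] by linarith
      qed
      have i1: "integrable \<mu> (\<lambda>y. Re (w * y))" using iy by (intro integrable_Re integrable_mult_right)
      have i2: "integrable \<mu> (\<lambda>y. 1 + t * (exp (a * (cmod y)\<^sup>2) - 1))"
        using ie by (intro Bochner_Integration.integrable_add integrable_mult_right Bochner_Integration.integrable_diff) auto
      have "(\<integral>\<^sup>+ y. ennreal (exp (Re (w * y))) \<partial>\<mu>) \<le> (\<integral>\<^sup>+ y. ennreal (Re (w * y) + (1 + t * (exp (a * (cmod y)\<^sup>2) - 1))) \<partial>\<mu>)"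
        by (intro nn_integral_mono ennreal_leI ptw)
      also have "\<dots> = ennreal (\<integral>y. Re (w * y) + (1 + t * (exp (a * (cmod y)\<^sup>2) - 1)) \<partial>\<mu>)"
        by (intro nn_integral_eq_integral Bochner_Integration.integrable_add i1 i2 AE_I2 order_trans[OF less_imp_le[OF exp_gt_zero] ptw])
      also have "(\<integral>y. Re (w * y) + (1 + t * (exp (a * (cmod y)\<^sup>2) - 1)) \<partial>\<mu>) =
        Re (w * (\<integral>y. y \<partial>\<mu>)) + (1 + t * ((\<integral>y. exp (a * (cmod y)\<^sup>2) \<partial>\<mu>) - 1))"
        using i1 i2 ie iy by (simp add: integral_Re prob_space)
      also have "\<dots> \<le> 1 + t * L" using mean_zero t0 Ee by (simp add: mult_left_mono)
      also have "\<dots> \<le> exp (t * L)" by simp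
      also have "\<dots> \<le> exp ((L + 1) / a * (cmod w)\<^sup>2)" using t0 a by (simp add: w2 field_simps)
      finally show ?thesis by (simp add: ennreal_leI)
    next
      case False
      have ptw: "exp (Re (w * y)) \<le> exp t * exp (a * (cmod y)\<^sup>2)" for y
      proof -
        have "0 \<le> (cmod w - 2 * a * cmod y)\<^sup>2" by simp
        then have "4 * a * (cmod w * cmod y) \<le> (cmod w)\<^sup>2 + 4 * a * (a * (cmod y)\<^sup>2)"
          by (simp add: power2_eq_square algebra_simps)
        also have "\<dots> \<le> 4 * a * (t + a * (cmod y)\<^sup>2)" using w2 t0 a by (simp add: algebra_simps)
        finally have "cmod w * cmod y \<le> t + a * (cmod y)\<^sup>2" using a by simp
        then have "Re (w * y) \<le> t + a * (cmod y)\<^sup>2" using rw[of y] by linarith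
        then show ?thesis by (simp flip: exp_add)
      qed
      have "(\<integral>\<^sup>+ y. ennreal (exp (Re (w * y))) \<partial>\<mu>) \<le> (\<integral>\<^sup>+ y. ennreal (exp t) * ennreal (exp (a * (cmod y)\<^sup>2)) \<partial>\<mu>)"
        by (intro nn_integral_mono) (use ptw in \<open>simp add: ennreal_leI flip: ennreal_mult\<close>)
      also have "\<dots> = ennreal (exp t) * (\<integral>\<^sup>+ y. ennreal (exp (a * (cmod y)\<^sup>2)) \<partial>\<mu>)"
        by (rule nn_integral_cmult) measurable
      also have "\<dots> \<le> ennreal (exp t) * ennreal L" by (intro mult_left_mono mom) auto
      also have "\<dots> = ennreal (exp t * L)" using L by (simp add: ennreal_mult)
      also have "exp t * L \<le> exp t * exp (t * L)"
      proof (rule mult_left_mono)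
        have "1 + t * L \<le> exp (t * L)" by simp
        moreover have "1 * L \<le> t * L" using False L by (intro mult_right_mono) auto
        ultimately show "L \<le> exp (t * L)" by linarith
      qed simp
      also have "exp t * exp (t * L) = exp ((L + 1) / a * (cmod w)\<^sup>2)"
        using a by (simp add: w2 field_simps flip: exp_add)
      finally show ?thesis by (simp add: ennreal_leI)
    qed
  qed
qed

end

section \<open>The operator norm of a random matrix\<close>

text \<open>The net consists of points of the lattice with spacing 1 / (8 sqrt n).  Rounding a vector down to the
  lattice moves it by at most sqrt (2 n) / (8 sqrt n) < 1/4, so vectors of the unit ball are rounded to
  points of norm at most 5/4, whose integer coordinates have square sum at most 100 n.\<close>
definition lattice_point :: "nat \<Rightarrow> (nat \<Rightarrow> int \<times> int) \<Rightarrow> complex vec" where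
  "lattice_point n k = vec n (\<lambda>j. Complex (of_int (fst (k j))) (of_int (snd (k j))) / of_real (8 * sqrt (real n)))"

definition lattice_net :: "nat \<Rightarrow> (nat \<Rightarrow> int \<times> int) set" where
  "lattice_net n = {k \<in> {..<n} \<rightarrow>\<^sub>E {- int (10 * n)..int (10 * n)} \<times> {- int (10 * n)..int (10 * n)}.
     (\<Sum>j<n. (fst (k j))\<^sup>2 + (snd (k j))\<^sup>2) \<le> 100 * int n}"

lemma finite_lattice_net: "finite (lattice_net n)"
  unfolding lattice_net_def by (rule finite_subset[of _ "{..<n} \<rightarrow>\<^sub>E {- int (10 * n)..int (10 * n)} \<times> {- int (10 * n)..int (10 * n)}"]) (auto intro: finite_PiE)

lemma lattice_point_carrier [simp]: "lattice_point n k \<in> carrier_vec n"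
  by (simp add: lattice_point_def)

lemma dim_lattice_point [simp]: "dim_vec (lattice_point n k) = n"
  by (simp add: lattice_point_def)

lemma gaussian_sum_le: "(\<Sum>p\<in>{- int m..int m}. exp (- (real_of_int p)\<^sup>2)) \<le> 3 - 2 * (1/2) ^ m"
proof (induction m)
  case 0
  then show ?case by simp
next
  case (Suc m)
  have eq: "{- int (Suc m)..int (Suc m)} = insert (int (Suc m)) (insert (- int (Suc m)) {- int m..int m})" by auto
  have e: "exp (- (real (Suc m))\<^sup>2) \<le> (1/2) ^ Suc m"
  proof -
    have "real (Suc m) \<le> (real (Suc m))\<^sup>2" by (rule self_le_power) auto
    then have "- (real (Suc m))\<^sup>2 \<le> - real (Suc m)" by (simp only: neg_le_iff_le)
    then have "exp (- (real (Suc m))\<^sup>2) \<le> exp (- real (Suc m))" by (simp only: exp_le_cancel_iff)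
    also have "\<dots> = exp (-1) ^ Suc m" using exp_of_nat_mult[of "Suc m" "-1::real"] by (simp del: of_nat_Suc power_Suc)
    also have "\<dots> \<le> (1/2) ^ Suc m"
    proof (rule power_mono)
      have "(2::real) \<le> exp 1" using exp_ge_add_one_self[of "1::real"] by simp
      then show "exp (-1) \<le> (1/2 :: real)" by (simp add: exp_minus field_simps)
    qed simp
    finally show ?thesis .
  qed
  have "(\<Sum>p\<in>{- int (Suc m)..int (Suc m)}. exp (- (real_of_int p)\<^sup>2)) =
     exp (- (real (Suc m))\<^sup>2) + (exp (- (real (Suc m))\<^sup>2) + (\<Sum>p\<in>{- int m..int m}. exp (- (real_of_int p)\<^sup>2)))"
    unfolding eq by (subst sum.insert; (simp del: of_nat_Suc)?)+
  also have "\<dots> \<le> (1/2) ^ Suc m + ((1/2) ^ Suc m + (3 - 2 * (1/2) ^ m))"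
    by (intro add_mono e Suc.IH)
  finally show ?case by simp
qed

text \<open>The weight exp (100 n - |k|^2) is at least 1 on the net, and its sum over the whole box factors
  over the coordinates, each real coordinate contributing at most 3.  The exponent 104 comes from
  9 \<le> exp 4.\<close>
lemma card_lattice_net: "real (card (lattice_net n)) \<le> exp (104 * real n)"
proof -
  define I where "I = {- int (10 * n)..int (10 * n)}"
  define w where "w pq = exp (- (real_of_int (fst pq))\<^sup>2) * exp (- (real_of_int (snd pq))\<^sup>2)" for pq :: "int \<times> int"
  have sub: "lattice_net n \<subseteq> {..<n} \<rightarrow>\<^sub>E I \<times> I" by (auto simp: lattice_net_def I_def)
  have fin: "finite ({..<n} \<rightarrow>\<^sub>E I \<times> I)" by (rule finite_PiE) (auto simp: I_def)
  have one: "1 \<le> exp (100 * real n) * (\<Prod>j<n. w (k j))" if k: "k \<in> lattice_net n" for k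
  proof -
    have "(\<Sum>j<n. (fst (k j))\<^sup>2 + (snd (k j))\<^sup>2) \<le> 100 * int n" using k by (simp add: lattice_net_def)
    then have "real_of_int (\<Sum>j<n. (fst (k j))\<^sup>2 + (snd (k j))\<^sup>2) \<le> real_of_int (100 * int n)" by linarith
    then have le: "(\<Sum>j<n. (real_of_int (fst (k j)))\<^sup>2 + (real_of_int (snd (k j)))\<^sup>2) \<le> 100 * real n" by simp
    have "(\<Prod>j<n. w (k j)) = exp (\<Sum>j<n. - ((real_of_int (fst (k j)))\<^sup>2 + (real_of_int (snd (k j)))\<^sup>2))"
      by (simp add: exp_sum w_def exp_add exp_minus exp_diff field_simps)
    also have "\<dots> = exp (- (\<Sum>j<n. (real_of_int (fst (k j)))\<^sup>2 + (real_of_int (snd (k j)))\<^sup>2))"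
      by (simp only: sum_negf)
    finally show ?thesis using le by (simp flip: exp_add)
  qed
  have "real (card (lattice_net n)) = (\<Sum>k\<in>lattice_net n. 1)" by simp
  also have "\<dots> \<le> (\<Sum>k\<in>lattice_net n. exp (100 * real n) * (\<Prod>j<n. w (k j)))" by (intro sum_mono one)
  also have "\<dots> \<le> (\<Sum>k\<in>{..<n} \<rightarrow>\<^sub>E I \<times> I. exp (100 * real n) * (\<Prod>j<n. w (k j)))"
  proof (rule sum_mono2[OF fin sub])
    fix k show "0 \<le> exp (100 * real n) * (\<Prod>j<n. w (k j))"
      unfolding w_def by (intro mult_nonneg_nonneg prod_nonneg ballI) simp_all
  qed
  also have "\<dots> = exp (100 * real n) * (\<Prod>j<n. \<Sum>pq\<in>I \<times> I. w pq)"
    by (subst prod_sum_PiE) (auto simp: sum_distrib_left I_def)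
  also have "(\<Sum>pq\<in>I \<times> I. w pq) = (\<Sum>p\<in>I. exp (- (real_of_int p)\<^sup>2)) * (\<Sum>p\<in>I. exp (- (real_of_int p)\<^sup>2))"
    unfolding w_def by (simp add: sum_product sum.cartesian_product case_prod_unfold)
  also have "exp (100 * real n) * (\<Prod>j<n. (\<Sum>p\<in>I. exp (- (real_of_int p)\<^sup>2)) * (\<Sum>p\<in>I. exp (- (real_of_int p)\<^sup>2)))
    \<le> exp (100 * real n) * (\<Prod>j<n. 3 * 3)"
  proof -
    have "(\<Sum>p\<in>I. exp (- (real_of_int p)\<^sup>2)) \<le> 3" unfolding I_def
      by (rule order_trans[OF gaussian_sum_le]) simp
    then show ?thesis by (intro mult_left_mono prod_mono conjI mult_mono) (auto intro!: mult_nonneg_nonneg sum_nonneg)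
  qed
  also have "\<dots> = exp (100 * real n) * 9 ^ n" by simp
  also have "\<dots> \<le> exp (100 * real n) * exp 4 ^ n"
  proof -
    have "(2::real) \<le> exp 1" using exp_ge_add_one_self[of "1::real"] by simp
    then have "(2::real) ^ 4 \<le> exp 1 ^ 4" by (rule power_mono) simp
    then have "9 \<le> exp (4::real)" by (simp flip: exp_of_nat_mult)
    then show ?thesis by (intro mult_left_mono power_mono) auto
  qed
  also have "\<dots> = exp (104 * real n)" by (simp flip: exp_of_nat_mult exp_add)
  finally show ?thesis .
qed

lemma lattice_point_norm:
  assumes "n \<ge> 1"
  shows "(vec_l2 (lattice_point n k))\<^sup>2 = real_of_int (\<Sum>j<n. (fst (k j))\<^sup>2 + (snd (k j))\<^sup>2) / (64 * real n)"
proof -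
  have "(vec_l2 (lattice_point n k))\<^sup>2 = (\<Sum>j<n. (cmod (lattice_point n k $ j))\<^sup>2)"
    by (rule vec_l2_sq) simp
  also have "\<dots> = (\<Sum>j<n. ((real_of_int (fst (k j)))\<^sup>2 + (real_of_int (snd (k j)))\<^sup>2) / (64 * real n))"
    using assms by (intro sum.cong) (auto simp: lattice_point_def norm_divide power_divide cmod_power2 power_mult_distrib)
  finally show ?thesis by (simp only: of_int_sum of_int_add of_int_power sum_divide_distrib)
qed

lemma lattice_net_norm:
  assumes n: "n \<ge> 1" and k: "k \<in> lattice_net n"
  shows "vec_l2 (lattice_point n k) \<le> 5 / 4"
proof (rule power2_le_imp_le)
  have "real_of_int (\<Sum>j<n. (fst (k j))\<^sup>2 + (snd (k j))\<^sup>2) \<le> real_of_int (100 * int n)"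
    using k by (simp only: lattice_net_def of_int_le_iff mem_Collect_eq)
  then have "real_of_int (\<Sum>j<n. (fst (k j))\<^sup>2 + (snd (k j))\<^sup>2) / (64 * real n) \<le> 100 * real n / (64 * real n)"
    by (intro divide_right_mono) auto
  then show "(vec_l2 (lattice_point n k))\<^sup>2 \<le> (5 / 4)\<^sup>2"
    unfolding lattice_point_norm[OF n] using n by (simp add: power2_eq_square)
qed simp

lemma vec_l2_minus_commute: "v \<in> carrier_vec n \<Longrightarrow> w \<in> carrier_vec n \<Longrightarrow> vec_l2 (v - w) = vec_l2 (w - v)"
  by (auto simp: vec_l2_def norm_minus_commute intro!: L2_set_cong)

lemma lattice_net_approximates:
  assumes n: "n \<ge> 1" and v: "v \<in> carrier_vec n" "vec_l2 v \<le> 1"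
  shows "\<exists>k\<in>lattice_net n. vec_l2 (v - lattice_point n k) \<le> 1 / 4"
proof -
  define s where "s = 8 * sqrt (real n)"
  have s: "s > 0" using n by (simp add: s_def)
  have s2: "s\<^sup>2 = 64 * real n" by (simp add: s_def power_mult_distrib)
  define k where "k = restrict (\<lambda>j. (\<lfloor>s * Re (v $ j)\<rfloor>, \<lfloor>s * Im (v $ j)\<rfloor>)) {..<n}"
  have near: "vec_l2 (v - lattice_point n k) \<le> 1 / 4"
  proof (rule power2_le_imp_le)
    have "(vec_l2 (v - lattice_point n k))\<^sup>2 = (\<Sum>j<n. (cmod ((v - lattice_point n k) $ j))\<^sup>2)"
      by (rule vec_l2_sq) (use v in auto)
    also have "\<dots> \<le> (\<Sum>j<n. 2 / s\<^sup>2)"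
    proof (rule sum_mono)
      fix j assume j: "j \<in> {..<n}"
      have "(v - lattice_point n k) $ j = Complex (s * Re (v $ j) - of_int \<lfloor>s * Re (v $ j)\<rfloor>) (s * Im (v $ j) - of_int \<lfloor>s * Im (v $ j)\<rfloor>) / of_real s"
        using j v s by (simp add: lattice_point_def k_def complex_eq_iff s_def[symmetric] diff_divide_distrib)
      then have "(cmod ((v - lattice_point n k) $ j))\<^sup>2 =
        ((s * Re (v $ j) - of_int \<lfloor>s * Re (v $ j)\<rfloor>)\<^sup>2 + (s * Im (v $ j) - of_int \<lfloor>s * Im (v $ j)\<rfloor>)\<^sup>2) / s\<^sup>2"
        using s by (simp add: norm_divide power_divide cmod_power2)
      also have "\<dots> \<le> (1 + 1) / s\<^sup>2"
      proof -
        have "(r - of_int \<lfloor>r\<rfloor>)\<^sup>2 \<le> 1" for r :: real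
          by (rule power_le_one) linarith+
        then show ?thesis by (intro divide_right_mono add_mono) auto
      qed
      finally show "(cmod ((v - lattice_point n k) $ j))\<^sup>2 \<le> 2 / s\<^sup>2" by simp
    qed
    also have "\<dots> \<le> (1 / 4)\<^sup>2" unfolding s2 using n by (simp add: power2_eq_square)
    finally show "(vec_l2 (v - lattice_point n k))\<^sup>2 \<le> (1 / 4)\<^sup>2" .
  qed simp
  have "lattice_point n k = v + (lattice_point n k - v)" using v by (intro eq_vecI) auto
  then have "vec_l2 (lattice_point n k) \<le> vec_l2 v + vec_l2 (lattice_point n k - v)"
    using vec_l2_add[of v n "lattice_point n k - v"] v by auto
  then have "vec_l2 (lattice_point n k) \<le> 5 / 4"
    using near v vec_l2_minus_commute[OF v(1), of "lattice_point n k"] by simp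
  then have "(vec_l2 (lattice_point n k))\<^sup>2 \<le> (5 / 4)\<^sup>2"
    by (intro power_mono) (auto simp: vec_l2_nonneg)
  then have "real_of_int (\<Sum>j<n. (fst (k j))\<^sup>2 + (snd (k j))\<^sup>2) \<le> real_of_int (100 * int n)"
    unfolding lattice_point_norm[OF n] using n by (simp add: field_simps power2_eq_square)
  then have sum_le: "(\<Sum>j<n. (fst (k j))\<^sup>2 + (snd (k j))\<^sup>2) \<le> 100 * int n" by (simp only: of_int_le_iff)
  have box: "p \<in> {- int (10 * n)..int (10 * n)}" if "p\<^sup>2 \<le> 100 * int n" for p
  proof -
    have "int n * 1 \<le> int n * int n" using n by (intro mult_left_mono) auto
    then have "p\<^sup>2 \<le> (int (10 * n))\<^sup>2" using that by (simp add: power2_eq_square)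
    then have "\<bar>p\<bar> \<le> int (10 * n)" using abs_le_square_iff[of p "int (10 * n)"] by simp
    then show ?thesis by auto
  qed
  have "k j \<in> {- int (10 * n)..int (10 * n)} \<times> {- int (10 * n)..int (10 * n)}" if "j < n" for j
  proof -
    have "(fst (k j))\<^sup>2 + (snd (k j))\<^sup>2 \<le> (\<Sum>j<n. (fst (k j))\<^sup>2 + (snd (k j))\<^sup>2)"
      using that by (intro member_le_sum[of j "{..<n}" "\<lambda>j. (fst (k j))\<^sup>2 + (snd (k j))\<^sup>2"]) auto
    then have "(fst (k j))\<^sup>2 \<le> 100 * int n" "(snd (k j))\<^sup>2 \<le> 100 * int n"
      using sum_le by (smt (verit) zero_le_power2)+
    then show ?thesis using box by (metis mem_Times_iff)
  qed
  then have "k \<in> lattice_net n" using sum_le by (auto simp: lattice_net_def k_def)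
  then show ?thesis using near by blast
qed

lemma scalar_prod_le:
  fixes b w :: "complex vec"
  assumes "b \<in> carrier_vec n" "w \<in> carrier_vec n"
  shows "cmod (scalar_prod b w) \<le> vec_l2 b * vec_l2 w"
proof -
  have "scalar_prod b w = (\<Sum>i<n. b $ i * w $ i)"
    using assms by (auto simp: scalar_prod_def atLeast0LessThan)
  then have "cmod (scalar_prod b w) \<le> (\<Sum>i<n. \<bar>cmod (b $ i)\<bar> * \<bar>cmod (w $ i)\<bar>)"
    by (auto simp: norm_mult intro: order_trans[OF norm_sum])
  also have "\<dots> \<le> L2_set (\<lambda>i. cmod (b $ i)) {..<n} * L2_set (\<lambda>i. cmod (w $ i)) {..<n}"
    by (rule L2_set_mult_ineq)
  finally show ?thesis using assms by (simp add: vec_l2_def)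
qed

text \<open>Replacing both arguments of the bilinear form by net points costs at most 5/4 * 1/4 + 1/4 = 9/16
  of the operator norm, which is absorbed on the left.\<close>
lemma op_norm_le_net_sup:
  assumes n: "n \<ge> 1" and X: "X \<in> carrier_mat n n"
    and T: "\<And>k l. k \<in> lattice_net n \<Longrightarrow> l \<in> lattice_net n \<Longrightarrow>
      Re (scalar_prod (lattice_point n l) (X *\<^sub>v lattice_point n k)) \<le> T"
  shows "op_norm X \<le> 16 / 7 * T"
proof -
  define s where "s = op_norm X"
  have s0: "s \<ge> 0" unfolding s_def by (rule op_norm_nonneg[OF X])
  have "op_norm X \<le> T + 9 / 16 * s"
  proof (rule op_norm_le[OF X])
    fix v :: "complex vec" assume v: "v \<in> carrier_vec n" "vec_l2 v \<le> 1"
    define w where "w = X *\<^sub>v v"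
    have w: "w \<in> carrier_vec n" using X v by (simp add: w_def)
    \<comment> \<open>The dual vector of w; it is zero if w is zero, because division by zero gives zero.\<close>
    define b where "b = vec n (\<lambda>i. cnj (w $ i) / of_real (vec_l2 w))"
    have b: "b \<in> carrier_vec n" by (simp add: b_def)
    have bsq: "(vec_l2 b)\<^sup>2 = (vec_l2 w)\<^sup>2 / (vec_l2 w)\<^sup>2"
      unfolding vec_l2_sq[OF b] by (simp add: b_def norm_divide power_divide vec_l2_nonneg vec_l2_sq[OF w] flip: sum_divide_distrib)
    have b1: "vec_l2 b \<le> 1"
      by (rule power2_le_imp_le) (auto simp: bsq divide_le_eq_1)
    have bw: "Re (scalar_prod b w) = vec_l2 w"
    proof -
      have "scalar_prod b w = (\<Sum>i<n. of_real ((cmod (w $ i))\<^sup>2) / of_real (vec_l2 w))"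
      proof -
        have "cnj z / of_real r * z = of_real ((cmod z)\<^sup>2) / of_real r" for z r
          by (simp add: complex_norm_square mult.commute del: of_real_power)
        then show ?thesis
          using w by (auto simp: scalar_prod_def b_def atLeast0LessThan simp del: of_real_power intro!: sum.cong)
      qed
      also have "\<dots> = of_real ((vec_l2 w)\<^sup>2 / vec_l2 w)"
        unfolding vec_l2_sq[OF w] by (simp add: sum_divide_distrib)
      finally show ?thesis by (simp add: power2_eq_square)
    qed
    obtain k where k: "k \<in> lattice_net n" "vec_l2 (v - lattice_point n k) \<le> 1 / 4"
      using lattice_net_approximates[OF n v] by blast
    obtain l where l: "l \<in> lattice_net n" "vec_l2 (b - lattice_point n l) \<le> 1 / 4"
      using lattice_net_approximates[OF n b b1] by blast
    let ?v = "lattice_point n k" and ?b = "lattice_point n l"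
    have d: "v - ?v \<in> carrier_vec n" "b - ?b \<in> carrier_vec n" using v b by auto
    have c: "X *\<^sub>v ?v \<in> carrier_vec n" "X *\<^sub>v (v - ?v) \<in> carrier_vec n" using X d by auto
    have "w = X *\<^sub>v ?v + X *\<^sub>v (v - ?v)"
    proof -
      have "v = ?v + (v - ?v)" using v by (intro eq_vecI) auto
      then have "w = X *\<^sub>v (?v + (v - ?v))" by (simp add: w_def)
      also have "\<dots> = X *\<^sub>v ?v + X *\<^sub>v (v - ?v)" using X d by (intro mult_add_distrib_mat_vec) auto
      finally show ?thesis .
    qed
    moreover have "b = ?b + (b - ?b)" using b by (intro eq_vecI) auto
    ultimately have "scalar_prod b w = scalar_prod ?b (X *\<^sub>v ?v) + scalar_prod ?b (X *\<^sub>v (v - ?v)) + scalar_prod (b - ?b) w"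
    proof -
      assume e: "w = X *\<^sub>v ?v + X *\<^sub>v (v - ?v)" "b = ?b + (b - ?b)"
      have "scalar_prod b w = scalar_prod (?b + (b - ?b)) w" using e(2) by simp
      also have "\<dots> = scalar_prod ?b w + scalar_prod (b - ?b) w"
        using d w by (intro add_scalar_prod_distrib) auto
      also have "scalar_prod ?b w = scalar_prod ?b (X *\<^sub>v ?v + X *\<^sub>v (v - ?v))" using e(1) by simp
      also have "\<dots> = scalar_prod ?b (X *\<^sub>v ?v) + scalar_prod ?b (X *\<^sub>v (v - ?v))"
        using c by (intro scalar_prod_add_distrib) auto
      finally show ?thesis .
    qed
    then have "vec_l2 w \<le> Re (scalar_prod ?b (X *\<^sub>v ?v)) + cmod (scalar_prod ?b (X *\<^sub>v (v - ?v))) + cmod (scalar_prod (b - ?b) w)"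
      using bw complex_Re_le_cmod[of "scalar_prod ?b (X *\<^sub>v (v - ?v))"] complex_Re_le_cmod[of "scalar_prod (b - ?b) w"] by simp
    also have "\<dots> \<le> T + 5 / 4 * (s * (1 / 4)) + 1 / 4 * s"
    proof (intro add_mono T k l)
      have "vec_l2 (X *\<^sub>v (v - ?v)) \<le> s * (1 / 4)"
        using op_norm_upper[OF X d(1)] mult_left_mono[OF k(2) s0] by (simp add: s_def)
      then have "vec_l2 ?b * vec_l2 (X *\<^sub>v (v - ?v)) \<le> 5 / 4 * (s * (1 / 4))"
        using lattice_net_norm[OF n l(1)] by (intro mult_mono) (auto simp: vec_l2_nonneg)
      then show "cmod (scalar_prod ?b (X *\<^sub>v (v - ?v))) \<le> 5 / 4 * (s * (1 / 4))"
        using scalar_prod_le[OF lattice_point_carrier c(2)] by (rule order_trans[rotated])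
      have "vec_l2 w \<le> s" using op_norm_upper_unit[OF X v] by (simp add: w_def s_def)
      then have "vec_l2 (b - ?b) * vec_l2 w \<le> 1 / 4 * s"
        using l(2) by (intro mult_mono) (auto simp: vec_l2_nonneg)
      then show "cmod (scalar_prod (b - ?b) w) \<le> 1 / 4 * s"
        using scalar_prod_le[OF d(2) w] by (rule order_trans[rotated])
    qed
    finally show "vec_l2 (X *\<^sub>v v) \<le> T + 9 / 16 * s" by (simp add: w_def)
  qed
  then show ?thesis by (simp add: s_def)
qed

context sub_gaussian_law
begin

text \<open>Independence turns the moment generating function of the bilinear form into a product over
  the entries, and the coefficients b_i v_j have square sum |b|^2 |v|^2.\<close>
lemma bilinear_mgf_bound:
  assumes B: "\<And>w. (\<integral>\<^sup>+ y. ennreal (exp (Re (w * y))) \<partial>\<mu>) \<le> ennreal (exp (B * (cmod w)\<^sup>2))"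
    and b: "b \<in> carrier_vec n" and v: "v \<in> carrier_vec n"
  shows "(\<integral>\<^sup>+ x. ennreal (exp (t * Re (scalar_prod b (mat n n x *\<^sub>v v)))) \<partial>Pi\<^sub>M (indices n) (\<lambda>_. \<mu>))
    \<le> ennreal (exp (B * t\<^sup>2 * (vec_l2 b)\<^sup>2 * (vec_l2 v)\<^sup>2))"
proof -
  interpret pp: product_sigma_finite "\<lambda>_. \<mu>" by (rule product_sigma_finite.intro) (rule sigma_finite_measure_axioms)
  have form: "scalar_prod b (mat n n x *\<^sub>v v) = (\<Sum>ij\<in>indices n. b $ fst ij * v $ snd ij * x ij)" for x
  proof -
    have m: "mat n n x \<in> carrier_mat n n" by simp
    have "scalar_prod b (mat n n x *\<^sub>v v) = (\<Sum>i<n. b $ i * (mat n n x *\<^sub>v v) $ i)"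
      by (simp add: scalar_prod_def atLeast0LessThan)
    also have "\<dots> = (\<Sum>i<n. \<Sum>j<n. b $ i * v $ j * x (i,j))"
      by (intro sum.cong refl) (subst mult_mat_vec_nth[OF m v], auto simp: sum_distrib_left mult_ac)
    finally show ?thesis by (simp add: sum.cartesian_product case_prod_unfold)
  qed
  have "(\<integral>\<^sup>+ x. ennreal (exp (t * Re (scalar_prod b (mat n n x *\<^sub>v v)))) \<partial>Pi\<^sub>M (indices n) (\<lambda>_. \<mu>))
    = (\<integral>\<^sup>+ x. (\<Prod>ij\<in>indices n. ennreal (exp (Re ((of_real t * b $ fst ij * v $ snd ij) * x ij)))) \<partial>Pi\<^sub>M (indices n) (\<lambda>_. \<mu>))"
    unfolding form by (simp add: prod_ennreal exp_sum[symmetric] sum_distrib_left mult.assoc)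
  also have "\<dots> = (\<Prod>ij\<in>indices n. \<integral>\<^sup>+ y. ennreal (exp (Re ((of_real t * b $ fst ij * v $ snd ij) * y))) \<partial>\<mu>)"
    by (rule pp.product_nn_integral_prod) (auto)
  also have "\<dots> \<le> (\<Prod>ij\<in>indices n. ennreal (exp (B * (cmod (of_real t * b $ fst ij * v $ snd ij))\<^sup>2)))"
    by (intro prod_mono_ennreal B)
  also have "\<dots> = ennreal (exp (\<Sum>ij\<in>indices n. B * (cmod (of_real t * b $ fst ij * v $ snd ij))\<^sup>2))"
    by (simp add: prod_ennreal exp_sum)
  also have "(\<Sum>ij\<in>indices n. B * (cmod (of_real t * b $ fst ij * v $ snd ij))\<^sup>2) = B * t\<^sup>2 * ((vec_l2 b)\<^sup>2 * (vec_l2 v)\<^sup>2)"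
  proof -
    have "(vec_l2 b)\<^sup>2 * (vec_l2 v)\<^sup>2 = (\<Sum>ij\<in>indices n. (cmod (b $ fst ij))\<^sup>2 * (cmod (v $ snd ij))\<^sup>2)"
      unfolding vec_l2_sq[OF b] vec_l2_sq[OF v] by (simp add: sum_product sum.cartesian_product case_prod_unfold)
    then show ?thesis
      by (simp only: sum_distrib_left) (intro sum.cong refl, simp add: norm_mult power_mult_distrib mult_ac)
  qed
  finally show ?thesis by (simp add: mult_ac)
qed

text \<open>A union bound over pairs of net points, with the Chernoff bound at parameter sqrt n.  The
  exceptional set is exhibited as a measurable set so that it can be combined with others.\<close>
lemma op_norm_bound_whp:
  "\<exists>\<tau>>0. \<forall>n\<ge>1. \<exists>Bad\<in>sets (Pi\<^sub>M (indices n) (\<lambda>_. \<mu>)).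
     emeasure (Pi\<^sub>M (indices n) (\<lambda>_. \<mu>)) Bad \<le> ennreal (1/4) \<and>
     (\<forall>x\<in>space (Pi\<^sub>M (indices n) (\<lambda>_. \<mu>)) - Bad. op_norm (mat n n x) \<le> \<tau> * sqrt (real n))"
proof -
  obtain B where B: "B > 0" "\<And>w. (\<integral>\<^sup>+ y. ennreal (exp (Re (w * y))) \<partial>\<mu>) \<le> ennreal (exp (B * (cmod w)\<^sup>2))"
    using linear_mgf_bound by blast
  \<comment> \<open>The two nets cost 104 each, the moment bound costs (5/4)^4 B, which is below 3 B, and
    the remaining 2 makes the final probability at most exp (-2).\<close>
  define \<tau> where "\<tau> = 210 + 3 * B"
  show ?thesis
  proof (intro exI[of _ "16 / 7 * \<tau>"] conjI allI impI)
    show "16 / 7 * \<tau> > 0" using B by (simp add: \<tau>_def)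
    fix n :: nat assume n: "n \<ge> 1"
    let ?P = "Pi\<^sub>M (indices n) (\<lambda>_. \<mu>)"
    let ?N = "lattice_net n"
    define q where "q kl x = Re (scalar_prod (lattice_point n (snd kl)) (mat n n x *\<^sub>v lattice_point n (fst kl)))"
      for kl :: "(nat \<Rightarrow> int \<times> int) \<times> (nat \<Rightarrow> int \<times> int)" and x
    define bad where "bad kl = {x \<in> space ?P. 1 \<le> ennreal (exp (- (\<tau> * real n))) * ennreal (exp (sqrt (real n) * q kl x))}" for kl
    have q_sum: "q kl x = (\<Sum>i<n. \<Sum>j<n. Re (lattice_point n (snd kl) $ i * (x (i,j) * lattice_point n (fst kl) $ j)))" for kl x
    proof -
      have m: "mat n n x \<in> carrier_mat n n" by simp
      have "scalar_prod (lattice_point n (snd kl)) (mat n n x *\<^sub>v lattice_point n (fst kl)) =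
        (\<Sum>i<n. lattice_point n (snd kl) $ i * (mat n n x *\<^sub>v lattice_point n (fst kl)) $ i)"
        by (simp add: scalar_prod_def atLeast0LessThan)
      also have "\<dots> = (\<Sum>i<n. \<Sum>j<n. lattice_point n (snd kl) $ i * (x (i,j) * lattice_point n (fst kl) $ j))"
        by (intro sum.cong refl) (subst mult_mat_vec_nth[OF m lattice_point_carrier], auto simp: sum_distrib_left)
      finally show ?thesis by (simp add: q_def)
    qed
    have q_meas: "q kl \<in> borel_measurable ?P" for kl
      unfolding q_sum[abs_def]
    proof (intro borel_measurable_sum)
      fix i j assume "i \<in> {..<n}" "j \<in> {..<n}"
      then have "(\<lambda>x. x (i,j)) \<in> measurable ?P \<mu>" by (intro measurable_component_singleton) auto
      then have "(\<lambda>x. x (i,j)) \<in> borel_measurable ?P" using sets_eq measurable_cong_sets by blast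
      then show "(\<lambda>x. Re (lattice_point n (snd kl) $ i * (x (i,j) * lattice_point n (fst kl) $ j))) \<in> borel_measurable ?P"
        by measurable
    qed
    have bad_sets: "bad kl \<in> sets ?P" for kl
      unfolding bad_def using q_meas[of kl] by measurable
    have bad_le: "emeasure ?P (bad kl) \<le> ennreal (exp (- (210 * real n)))" if kl: "kl \<in> ?N \<times> ?N" for kl
    proof -
      have "emeasure ?P (bad kl) \<le> ennreal (exp (- (\<tau> * real n))) *
          (\<integral>\<^sup>+ x. ennreal (exp (sqrt (real n) * q kl x)) * indicator (space ?P) x \<partial>?P)"
        unfolding bad_def by (rule nn_integral_Markov_inequality) (use q_meas[of kl] in measurable)
      also have "(\<integral>\<^sup>+ x. ennreal (exp (sqrt (real n) * q kl x)) * indicator (space ?P) x \<partial>?P) =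
          (\<integral>\<^sup>+ x. ennreal (exp (sqrt (real n) * q kl x)) \<partial>?P)"
        by (rule nn_integral_cong) simp
      also have "\<dots> \<le> ennreal (exp (B * (sqrt (real n))\<^sup>2 * (vec_l2 (lattice_point n (snd kl)))\<^sup>2 * (vec_l2 (lattice_point n (fst kl)))\<^sup>2))"
        unfolding q_def by (rule bilinear_mgf_bound[OF B(2)]) auto
      also have "\<dots> \<le> ennreal (exp (3 * B * real n))"
      proof -
        have "(vec_l2 (lattice_point n k))\<^sup>2 \<le> (5/4)\<^sup>2" if "k \<in> ?N" for k
          using lattice_net_norm[OF n that] vec_l2_nonneg by (intro power_mono) auto
        then have "(vec_l2 (lattice_point n (snd kl)))\<^sup>2 * (vec_l2 (lattice_point n (fst kl)))\<^sup>2 \<le> (5/4)\<^sup>2 * (5/4)\<^sup>2"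
          using kl by (intro mult_mono) auto
        then have "(vec_l2 (lattice_point n (snd kl)))\<^sup>2 * (vec_l2 (lattice_point n (fst kl)))\<^sup>2 \<le> 3"
          by (simp add: power2_eq_square)
        then have "B * real n * ((vec_l2 (lattice_point n (snd kl)))\<^sup>2 * (vec_l2 (lattice_point n (fst kl)))\<^sup>2) \<le> B * real n * 3"
          using B by (intro mult_left_mono) auto
        then show ?thesis by (intro ennreal_leI) (simp add: mult_ac)
      qed
      finally have "emeasure ?P (bad kl) \<le> ennreal (exp (- (\<tau> * real n))) * ennreal (exp (3 * B * real n))"
        by (simp add: mult_left_mono)
      also have "\<dots> = ennreal (exp (- (210 * real n)))"
        by (simp add: \<tau>_def algebra_simps flip: ennreal_mult exp_add)
      finally show ?thesis .
    qed
    define Bad where "Bad = (\<Union>kl\<in>?N \<times> ?N. bad kl)"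
    have fN: "finite (?N \<times> ?N)" using finite_lattice_net by blast
    show "\<exists>Bad\<in>sets ?P. emeasure ?P Bad \<le> ennreal (1/4) \<and>
      (\<forall>x\<in>space ?P - Bad. op_norm (mat n n x) \<le> 16 / 7 * \<tau> * sqrt (real n))"
    proof (intro bexI[of _ Bad] conjI ballI)
      show "Bad \<in> sets ?P" unfolding Bad_def using fN bad_sets by auto
      have "emeasure ?P Bad \<le> (\<Sum>kl\<in>?N \<times> ?N. emeasure ?P (bad kl))"
        unfolding Bad_def by (rule emeasure_subadditive_finite[OF fN]) (use bad_sets in auto)
      also have "\<dots> \<le> (\<Sum>kl\<in>?N \<times> ?N. ennreal (exp (- (210 * real n))))" by (intro sum_mono bad_le)
      also have "\<dots> = ennreal (real (card ?N) * real (card ?N) * exp (- (210 * real n)))"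
        by (subst sum_ennreal) (auto simp: card_cartesian_product)
      also have "\<dots> \<le> ennreal (exp (104 * real n) * exp (104 * real n) * exp (- (210 * real n)))"
        by (intro ennreal_leI mult_right_mono mult_mono card_lattice_net) auto
      also have "exp (104 * real n) * exp (104 * real n) * exp (- (210 * real n)) = exp (- (2 * real n))"
        by (simp flip: exp_add)
      also have "exp (- (2 * real n)) \<le> 1 / 4"
      proof -
        have "(2::real) \<le> exp 1" using exp_ge_add_one_self[of "1::real"] by simp
        then have "(2::real) ^ 2 \<le> exp 1 ^ 2" by (rule power_mono) simp
        then have "4 \<le> exp (2::real)" by (simp flip: exp_of_nat_mult)
        then have "exp (-2) \<le> (1 / 4 :: real)" by (simp add: exp_minus field_simps)
        moreover have "exp (- (2 * real n)) \<le> exp (-2)" using n by simp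
        ultimately show ?thesis by linarith
      qed
      finally show "emeasure ?P Bad \<le> ennreal (1/4)" by (simp add: ennreal_leI)
      fix x assume x: "x \<in> space ?P - Bad"
      have "op_norm (mat n n x) \<le> 16 / 7 * (\<tau> * sqrt (real n))"
      proof (rule op_norm_le_net_sup[OF n])
        fix k l assume kl: "k \<in> ?N" "l \<in> ?N"
        have "\<not> 1 \<le> ennreal (exp (- (\<tau> * real n))) * ennreal (exp (sqrt (real n) * q (k,l) x))"
          using x kl unfolding Bad_def bad_def by auto
        then have "exp (- (\<tau> * real n)) * exp (sqrt (real n) * q (k,l) x) < 1"
          by (simp flip: ennreal_mult)
        then have "exp (- (\<tau> * real n) + sqrt (real n) * q (k,l) x) < 1"
          by (simp only: exp_add)
        then have "sqrt (real n) * q (k,l) x < \<tau> * real n" by simp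
        then have "sqrt (real n) * q (k,l) x < sqrt (real n) * (\<tau> * sqrt (real n))"
          by (simp add: mult_ac)
        then show "Re (scalar_prod (lattice_point n l) (mat n n x *\<^sub>v lattice_point n k)) \<le> \<tau> * sqrt (real n)"
          using n by (simp add: q_def)
      qed simp
      then show "op_norm (mat n n x) \<le> 16 / 7 * \<tau> * sqrt (real n)" by simp
    qed
  qed
qed

end

section \<open>Measurability of the eigenvector condition number\<close>

text \<open>For fixed size, a bound on all entries and a bound c on the product of the two norms, the
  diagonalizations form a compact set, so the matrices they produce form a closed set.  The matrices
  with condition number at most B are obtained from such sets by a countable intersection over c
  decreasing to B and a countable union over the entry bounds.\<close>
definition entry_box :: "nat \<Rightarrow> real \<Rightarrow> (nat \<times> nat \<Rightarrow> complex) set" where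
  "entry_box n R = {x. \<forall>ij. x ij \<in> (if ij \<in> indices n then cball 0 R else {0})}"

lemma compact_entry_box: "compact (entry_box n R)"
proof -
  have "entry_box n R = Pi\<^sub>E UNIV (\<lambda>ij. if ij \<in> indices n then cball 0 R else {0})"
    by (auto simp: entry_box_def PiE_def Pi_def extensional_def)
  then have "compactin (product_topology (\<lambda>_. euclidean) UNIV) (entry_box n R)"
    by (simp add: compactin_PiE)
  then show ?thesis by (simp add: euclidean_product_topology compactin_euclidean_iff)
qed

lemma continuous_on_entry:
  fixes f :: "'a :: topological_space \<Rightarrow> nat \<times> nat \<Rightarrow> complex"
  shows "continuous_on S f \<Longrightarrow> continuous_on S (\<lambda>w. f w ij)"
  by (rule continuous_on_product_then_coordinatewise)

lemma continuous_on_vec_l2_mult: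
  fixes f :: "'a :: topological_space \<Rightarrow> nat \<times> nat \<Rightarrow> complex"
  assumes f: "continuous_on S f" and v: "v \<in> carrier_vec n"
  shows "continuous_on S (\<lambda>w. vec_l2 (mat n n (f w) *\<^sub>v v))"
proof -
  have "vec_l2 (mat n n x *\<^sub>v v) = sqrt (\<Sum>i<n. (cmod (\<Sum>j<n. x (i,j) * v $ j))\<^sup>2)" for x
  proof -
    have m: "mat n n x \<in> carrier_mat n n" by simp
    have "vec_l2 (mat n n x *\<^sub>v v) = sqrt (\<Sum>i<n. (cmod ((mat n n x *\<^sub>v v) $ i))\<^sup>2)"
      by (simp add: vec_l2_def L2_set_def)
    also have "\<dots> = sqrt (\<Sum>i<n. (cmod (\<Sum>j<n. x (i,j) * v $ j))\<^sup>2)"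
      by (intro arg_cong[of _ _ sqrt] sum.cong refl) (subst mult_mat_vec_nth[OF m v], auto)
    finally show ?thesis .
  qed
  note eq = this
  show ?thesis unfolding eq by (intro continuous_intros continuous_on_entry[OF f])
qed

lemma closed_op_norm_le: "closed {x. op_norm (mat n n x) \<le> c}"
proof -
  have "{x. op_norm (mat n n x) \<le> c} = (\<Inter>v\<in>{v \<in> carrier_vec n. vec_l2 v \<le> 1}. {x. vec_l2 (mat n n x *\<^sub>v v) \<le> c})"
  proof (rule Set.set_eqI, rule iffI)
    fix x assume "x \<in> {x. op_norm (mat n n x) \<le> c}"
    then show "x \<in> (\<Inter>v\<in>{v \<in> carrier_vec n. vec_l2 v \<le> 1}. {x. vec_l2 (mat n n x *\<^sub>v v) \<le> c})"
      using op_norm_upper_unit[of "mat n n x" n n] by fastforce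
  next
    fix x assume "x \<in> (\<Inter>v\<in>{v \<in> carrier_vec n. vec_l2 v \<le> 1}. {x. vec_l2 (mat n n x *\<^sub>v v) \<le> c})"
    then show "x \<in> {x. op_norm (mat n n x) \<le> c}"
      using op_norm_le[of "mat n n x" n n c] by auto
  qed
  moreover have "closed {x. vec_l2 (mat n n x *\<^sub>v v) \<le> c}" if "v \<in> carrier_vec n" for v
    by (intro closed_Collect_le continuous_on_vec_l2_mult continuous_on_id that continuous_on_const)
  ultimately show ?thesis by auto
qed

definition l2_ball :: "nat \<Rightarrow> complex vec set" where
  "l2_ball n = {v \<in> carrier_vec n. vec_l2 v \<le> 1}"

text \<open>The product of operator norms is bounded by c if and only if all products of the norms of image
  vectors are, and the latter conditions are closed.\<close>
definition diagonalizations ::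
  "nat \<Rightarrow> real \<Rightarrow> real \<Rightarrow> ((nat \<times> nat \<Rightarrow> complex) \<times> (nat \<times> nat \<Rightarrow> complex) \<times> (nat \<times> nat \<Rightarrow> complex)) set" where
  "diagonalizations n R c = {(W, V, D). W \<in> entry_box n R \<and> V \<in> entry_box n R \<and> D \<in> entry_box n R \<and>
     (\<forall>i j. i < n \<longrightarrow> j < n \<longrightarrow> (\<Sum>k<n. W (i,k) * V (k,j)) = (if i = j then 1 else 0)) \<and>
     (\<forall>i j. i \<noteq> j \<longrightarrow> D (i,j) = 0) \<and>
     (\<forall>u\<in>l2_ball n. \<forall>v\<in>l2_ball n. vec_l2 (mat n n W *\<^sub>v u) * vec_l2 (mat n n V *\<^sub>v v) \<le> c)}"

lemma compact_diagonalizations: "compact (diagonalizations n R c)"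
proof -
  let ?Box = "entry_box n R \<times> entry_box n R \<times> entry_box n R"
  let ?W = "\<lambda>w :: (nat \<times> nat \<Rightarrow> complex) \<times> (nat \<times> nat \<Rightarrow> complex) \<times> (nat \<times> nat \<Rightarrow> complex). fst w"
  let ?V = "\<lambda>w :: (nat \<times> nat \<Rightarrow> complex) \<times> (nat \<times> nat \<Rightarrow> complex) \<times> (nat \<times> nat \<Rightarrow> complex). fst (snd w)"
  let ?D = "\<lambda>w :: (nat \<times> nat \<Rightarrow> complex) \<times> (nat \<times> nat \<Rightarrow> complex) \<times> (nat \<times> nat \<Rightarrow> complex). snd (snd w)"
  have cW: "continuous_on UNIV ?W" and cV: "continuous_on UNIV ?V" and cD: "continuous_on UNIV ?D"
    by (intro continuous_intros)+
  note c = continuous_on_entry[OF cW] continuous_on_entry[OF cV] continuous_on_entry[OF cD]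
  have "closed {w. \<forall>i j. i < n \<longrightarrow> j < n \<longrightarrow> (\<Sum>k<n. ?W w (i,k) * ?V w (k,j)) = (if i = j then 1 else 0)}"
    by (intro closed_Collect_all closed_Collect_imp open_Collect_const closed_Collect_eq continuous_on_sum continuous_on_mult continuous_on_const c)
  moreover have "closed {w. \<forall>i j. i \<noteq> j \<longrightarrow> ?D w (i,j) = 0}"
    by (intro closed_Collect_all closed_Collect_imp open_Collect_const closed_Collect_eq continuous_on_sum continuous_on_mult continuous_on_const c)
  moreover have "closed {w. \<forall>u\<in>l2_ball n. \<forall>v\<in>l2_ball n. vec_l2 (mat n n (?W w) *\<^sub>v u) * vec_l2 (mat n n (?V w) *\<^sub>v v) \<le> c}"
    unfolding Collect_ball_eq l2_ball_def
    by (intro closed_INT ballI closed_Collect_le continuous_on_mult continuous_on_const continuous_on_vec_l2_mult cW cV) auto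
  ultimately have "compact (?Box \<inter> ({w. \<forall>i j. i < n \<longrightarrow> j < n \<longrightarrow> (\<Sum>k<n. ?W w (i,k) * ?V w (k,j)) = (if i = j then 1 else 0)} \<inter>
     ({w. \<forall>i j. i \<noteq> j \<longrightarrow> ?D w (i,j) = 0} \<inter>
     {w. \<forall>u\<in>l2_ball n. \<forall>v\<in>l2_ball n. vec_l2 (mat n n (?W w) *\<^sub>v u) * vec_l2 (mat n n (?V w) *\<^sub>v v) \<le> c})))"
    by (intro compact_Int_closed compact_Times compact_entry_box closed_Int)
  also have "?Box \<inter> ({w. \<forall>i j. i < n \<longrightarrow> j < n \<longrightarrow> (\<Sum>k<n. ?W w (i,k) * ?V w (k,j)) = (if i = j then 1 else 0)} \<inter>
     ({w. \<forall>i j. i \<noteq> j \<longrightarrow> ?D w (i,j) = 0} \<inter>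
     {w. \<forall>u\<in>l2_ball n. \<forall>v\<in>l2_ball n. vec_l2 (mat n n (?W w) *\<^sub>v u) * vec_l2 (mat n n (?V w) *\<^sub>v v) \<le> c})) = diagonalizations n R c"
    by (rule Set.set_eqI) (simp add: diagonalizations_def case_prod_unfold mem_Times_iff)
  finally show ?thesis .
qed

definition conjugate_back ::
  "nat \<Rightarrow> (nat \<times> nat \<Rightarrow> complex) \<times> (nat \<times> nat \<Rightarrow> complex) \<times> (nat \<times> nat \<Rightarrow> complex) \<Rightarrow> nat \<times> nat \<Rightarrow> complex" where
  "conjugate_back n w ij = (if ij \<in> indices n
     then \<Sum>l<n. (\<Sum>k<n. fst w (fst ij, k) * snd (snd w) (k, l)) * fst (snd w) (l, snd ij) else 0)"

lemma closed_diagonalizable_image: "closed (conjugate_back n ` diagonalizations n R c)"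
proof -
  have "continuous_on UNIV (conjugate_back n)"
  proof (rule continuous_on_coordinatewise_then_product)
    fix ij :: "nat \<times> nat"
    show "continuous_on UNIV (\<lambda>w. conjugate_back n w ij)"
    proof (cases "ij \<in> indices n")
      case True
      have c: "continuous_on UNIV (\<lambda>w :: (nat \<times> nat \<Rightarrow> complex) \<times> (nat \<times> nat \<Rightarrow> complex) \<times> (nat \<times> nat \<Rightarrow> complex). fst w e)"
        "continuous_on UNIV (\<lambda>w :: (nat \<times> nat \<Rightarrow> complex) \<times> (nat \<times> nat \<Rightarrow> complex) \<times> (nat \<times> nat \<Rightarrow> complex). fst (snd w) e)"
        "continuous_on UNIV (\<lambda>w :: (nat \<times> nat \<Rightarrow> complex) \<times> (nat \<times> nat \<Rightarrow> complex) \<times> (nat \<times> nat \<Rightarrow> complex). snd (snd w) e)" for e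
        by (rule continuous_on_entry, intro continuous_intros)+
      show ?thesis using True unfolding conjugate_back_def
        by (simp only: if_True) (intro continuous_on_sum continuous_on_mult c)
    qed (simp add: conjugate_back_def del: mem_Sigma_iff)
  qed
  then have "continuous_on (diagonalizations n R c) (conjugate_back n)"
    by (rule continuous_on_subset) simp
  then show ?thesis using compact_diagonalizations compact_continuous_image compact_imp_closed by blast
qed

lemma mat_conjugate_back:
  "mat n n (conjugate_back n (W, V, D)) = mat n n W * mat n n D * mat n n V"
proof (rule eq_matI)
  fix i j assume "i < dim_row (mat n n W * mat n n D * mat n n V)" "j < dim_col (mat n n W * mat n n D * mat n n V)"
  then have ij: "i < n" "j < n" by auto
  have c: "mat n n W \<in> carrier_mat n n" "mat n n D \<in> carrier_mat n n" "mat n n V \<in> carrier_mat n n" by auto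
  have wd: "mat n n W * mat n n D \<in> carrier_mat n n" by (rule mult_carrier_mat[OF c(1,2)])
  have "(mat n n W * mat n n D * mat n n V) $$ (i,j) = (\<Sum>l<n. (mat n n W * mat n n D) $$ (i,l) * mat n n V $$ (l,j))"
    by (rule mult_mat_nth[OF wd c(3) ij])
  also have "\<dots> = (\<Sum>l<n. (\<Sum>k<n. W (i,k) * D (k,l)) * V (l,j))"
    using ij by (intro sum.cong refl) (subst mult_mat_nth[OF c(1,2)], auto)
  finally show "mat n n (conjugate_back n (W, V, D)) $$ (i,j) = (mat n n W * mat n n D * mat n n V) $$ (i,j)"
    using ij by (simp add: conjugate_back_def)
qed auto

lemma kappa_V_le_iff:
  assumes x0: "\<And>ij. ij \<notin> indices n \<Longrightarrow> x ij = 0"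
  shows "kappa_V (mat n n x) \<le> ereal B \<longleftrightarrow>
    (\<forall>m. \<exists>R::nat. x \<in> conjugate_back n ` diagonalizations n (real R) (B + 1 / real (Suc m)))"
proof
  assume le: "kappa_V (mat n n x) \<le> ereal B"
  show "\<forall>m. \<exists>R::nat. x \<in> conjugate_back n ` diagonalizations n (real R) (B + 1 / real (Suc m))"
  proof
    fix m
    have "kappa_V (mat n n x) < ereal (B + 1 / real (Suc m))"
      using le by (rule le_less_trans) simp
    then obtain W V D where W: "op_norm W * op_norm V < B + 1 / real (Suc m)"
      "similar_mat_wit (mat n n x) D W V" "diagonal_mat D"
      unfolding kappa_V_def Inf_less_iff by auto
    have mx: "mat n n x \<in> carrier_mat n n" by simp
    note s = similar_mat_witD2[OF mx W(2)]
    define ext where "ext C = (\<lambda>ij. if ij \<in> indices n then C $$ ij else 0)" for C :: "complex mat"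
    have ext: "mat n n (ext C) = C" if "C \<in> carrier_mat n n" for C
      using that by (intro eq_matI) (auto simp: ext_def)
    \<comment> \<open>Any common bound on the entries of the three matrices will do.\<close>
    define R where "R = nat \<lceil>\<Sum>ij\<in>indices n. cmod (W $$ ij) + cmod (V $$ ij) + cmod (D $$ ij)\<rceil>"
    have R: "cmod (W $$ ij) + cmod (V $$ ij) + cmod (D $$ ij) \<le> real R" if "ij \<in> indices n" for ij
    proof -
      have "cmod (W $$ ij) + cmod (V $$ ij) + cmod (D $$ ij) \<le> (\<Sum>ij\<in>indices n. cmod (W $$ ij) + cmod (V $$ ij) + cmod (D $$ ij))"
        using that by (intro member_le_sum[of ij "indices n" "\<lambda>ij. cmod (W $$ ij) + cmod (V $$ ij) + cmod (D $$ ij)"]) auto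
      also have "\<dots> \<le> real R" unfolding R_def by (rule real_nat_ceiling_ge)
      finally show ?thesis .
    qed
    have R': "cmod (W $$ ij) \<le> real R \<and> cmod (V $$ ij) \<le> real R \<and> cmod (D $$ ij) \<le> real R" if "ij \<in> indices n" for ij
      using R[OF that] norm_ge_zero[of "W $$ ij"] norm_ge_zero[of "V $$ ij"] norm_ge_zero[of "D $$ ij"] by linarith
    have box: "ext W \<in> entry_box n R" "ext V \<in> entry_box n R" "ext D \<in> entry_box n R"
      unfolding entry_box_def ext_def using R' by auto
    have "(ext W, ext V, ext D) \<in> diagonalizations n (real R) (B + 1 / real (Suc m))"
      unfolding diagonalizations_def
    proof (simp only: mem_Collect_eq case_prod_conv, intro conjI allI impI ballI box)
      fix i j assume ij: "i < n" "j < n"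
      have "(\<Sum>k<n. ext W (i,k) * ext V (k,j)) = (W * V) $$ (i,j)"
        using ij by (subst mult_mat_nth[OF s(6,7) ij]) (auto simp: ext_def)
      then show "(\<Sum>k<n. ext W (i,k) * ext V (k,j)) = (if i = j then 1 else 0)" using s(1) ij by simp
    next
      fix i j :: nat assume "i \<noteq> j"
      then show "ext D (i,j) = 0" using W(3) s(5) by (auto simp: ext_def diagonal_mat_def)
    next
      fix u v :: "complex vec" assume "u \<in> l2_ball n" "v \<in> l2_ball n"
      then have u: "u \<in> carrier_vec n" "v \<in> carrier_vec n" "vec_l2 u \<le> 1" "vec_l2 v \<le> 1" by (auto simp: l2_ball_def)
      have "vec_l2 (W *\<^sub>v u) * vec_l2 (V *\<^sub>v v) \<le> op_norm W * op_norm V"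
        using op_norm_upper_unit[OF s(6) u(1,3)] op_norm_upper_unit[OF s(7) u(2,4)] op_norm_nonneg[OF s(6)]
        by (intro mult_mono) (auto simp: vec_l2_nonneg)
      then show "vec_l2 (mat n n (ext W) *\<^sub>v u) * vec_l2 (mat n n (ext V) *\<^sub>v v) \<le> B + 1 / real (Suc m)"
        unfolding ext[OF s(6)] ext[OF s(7)] using W(1) by linarith
    qed
    moreover have "x = conjugate_back n (ext W, ext V, ext D)"
    proof (rule HOL.ext)
      fix ij
      have "mat n n x = mat n n (conjugate_back n (ext W, ext V, ext D))"
        unfolding mat_conjugate_back ext[OF s(5)] ext[OF s(6)] ext[OF s(7)] by (rule s(3))
      then have "mat n n x $$ ij = mat n n (conjugate_back n (ext W, ext V, ext D)) $$ ij" by simp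
      then show "x ij = conjugate_back n (ext W, ext V, ext D) ij"
        using x0[of ij] by (cases ij, cases "ij \<in> indices n") (auto simp: conjugate_back_def)
    qed
    ultimately show "\<exists>R::nat. x \<in> conjugate_back n ` diagonalizations n (real R) (B + 1 / real (Suc m))" by blast
  qed
next
  assume all: "\<forall>m. \<exists>R::nat. x \<in> conjugate_back n ` diagonalizations n (real R) (B + 1 / real (Suc m))"
  have le: "kappa_V (mat n n x) \<le> ereal (B + 1 / real (Suc m))" for m
  proof -
    obtain R :: nat and W V D where w: "(W, V, D) \<in> diagonalizations n (real R) (B + 1 / real (Suc m))"
      and x: "x = conjugate_back n (W, V, D)" using all by fastforce
    define c where "c = B + 1 / real (Suc m)"
    let ?W = "mat n n W" and ?V = "mat n n V" and ?D = "mat n n D"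
    have cW: "?W \<in> carrier_mat n n" and cV: "?V \<in> carrier_mat n n" and cD: "?D \<in> carrier_mat n n" by auto
    have bound: "vec_l2 (?W *\<^sub>v u) * vec_l2 (?V *\<^sub>v v) \<le> c"
      if "u \<in> carrier_vec n" "vec_l2 u \<le> 1" "v \<in> carrier_vec n" "vec_l2 v \<le> 1" for u v
      using w that unfolding diagonalizations_def l2_ball_def c_def by blast
    have WV: "?W * ?V = 1\<^sub>m n"
    proof (rule eq_matI)
      fix i j assume "i < dim_row (1\<^sub>m n :: complex mat)" "j < dim_col (1\<^sub>m n :: complex mat)"
      then have ij: "i < n" "j < n" by auto
      have "(\<Sum>k<n. W (i,k) * V (k,j)) = (if i = j then 1 else 0)" using w ij unfolding diagonalizations_def by blast
      then show "(?W * ?V) $$ (i,j) = 1\<^sub>m n $$ (i,j)" using ij by (subst mult_mat_nth[OF cW cV ij]) auto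
    qed auto
    have sim: "similar_mat_wit (mat n n x) ?D ?W ?V"
    proof (rule similar_mat_witI)
      show "?V * ?W = 1\<^sub>m n" by (rule mat_mult_left_right_inverse[OF cW cV WV])
      show "mat n n x = ?W * ?D * ?V" unfolding x by (rule mat_conjugate_back)
    qed (use WV in auto)
    have dg: "diagonal_mat ?D" using w by (auto simp: diagonal_mat_def diagonalizations_def)
    have "op_norm ?W * op_norm ?V \<le> c"
    proof -
      have 1: "op_norm ?W * vec_l2 (?V *\<^sub>v v) \<le> c" if v: "v \<in> carrier_vec n" "vec_l2 v \<le> 1" for v
      proof (cases "vec_l2 (?V *\<^sub>v v) = 0")
        case True
        then show ?thesis using bound[of "0\<^sub>v n" v] v by simp
      next
        case False
        then have pos: "vec_l2 (?V *\<^sub>v v) > 0" using vec_l2_nonneg[of "?V *\<^sub>v v"] by simp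
        have "op_norm ?W \<le> c / vec_l2 (?V *\<^sub>v v)"
          by (rule op_norm_le[OF cW]) (use bound v pos in \<open>simp add: pos_le_divide_eq\<close>)
        then show ?thesis using pos by (simp add: pos_le_divide_eq)
      qed
      show ?thesis
      proof (cases "op_norm ?W = 0")
        case True
        then show ?thesis using bound[of "0\<^sub>v n" "0\<^sub>v n"] 1[of "0\<^sub>v n"] by simp
      next
        case False
        then have pos: "op_norm ?W > 0" using op_norm_nonneg[OF cW] by simp
        have "op_norm ?V \<le> c / op_norm ?W"
          by (rule op_norm_le[OF cV]) (use 1 pos in \<open>simp add: pos_le_divide_eq mult.commute\<close>)
        then show ?thesis using pos by (simp add: pos_le_divide_eq mult.commute)
      qed
    qed
    moreover have "kappa_V (mat n n x) \<le> ereal (op_norm ?W * op_norm ?V)"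
      unfolding kappa_V_def by (rule Inf_lower) (use sim dg in blast)
    ultimately show ?thesis unfolding c_def by (meson ereal_less_eq(3) order_trans)
  qed
  show "kappa_V (mat n n x) \<le> ereal B"
  proof (rule ereal_le_epsilon2)
    fix e :: real assume "0 < e"
    then obtain m where "1 / real (Suc m) < e" using nat_approx_posE by blast
    then have "ereal (B + 1 / real (Suc m)) \<le> ereal B + ereal e" by simp
    then show "kappa_V (mat n n x) \<le> ereal B + ereal e" using le[of m] by (rule order_trans[rotated])
  qed
qed

lemma kappa_V_event_measurable:
  assumes X: "\<And>i j. i < n \<Longrightarrow> j < n \<Longrightarrow> (\<lambda>\<omega>. X \<omega> (i,j)) \<in> borel_measurable N"
  shows "{\<omega> \<in> space N. kappa_V (mat n n (X \<omega>)) \<le> ereal B} \<in> sets N"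
    and "{\<omega> \<in> space N. op_norm (mat n n (X \<omega>)) \<le> c} \<in> sets N"
proof -
  define Y where "Y \<omega> = (\<lambda>ij. if ij \<in> indices n then X \<omega> ij else 0)" for \<omega>
  have Y: "mat n n (X \<omega>) = mat n n (Y \<omega>)" for \<omega> by (rule eq_matI) (auto simp: Y_def)
  have mY: "Y \<in> borel_measurable N"
  proof (rule measurable_coordinatewise_then_product)
    fix ij :: "nat \<times> nat"
    show "(\<lambda>\<omega>. Y \<omega> ij) \<in> borel_measurable N"
      unfolding Y_def using X[of "fst ij" "snd ij"] by (cases "ij \<in> indices n") auto
  qed
  have meas: "{\<omega> \<in> space N. Y \<omega> \<in> S} \<in> sets N" if "S \<in> sets borel" for S
    using measurable_sets[OF mY that] by (simp add: vimage_def Int_def conj_commute)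
  have "{\<omega> \<in> space N. kappa_V (mat n n (X \<omega>)) \<le> ereal B} =
    {\<omega> \<in> space N. Y \<omega> \<in> (\<Inter>m. \<Union>R::nat. conjugate_back n ` diagonalizations n (real R) (B + 1 / real (Suc m)))}"
    unfolding Y by (subst kappa_V_le_iff) (auto simp: Y_def)
  also have "\<dots> \<in> sets N"
  proof (rule meas)
    have b: "conjugate_back n ` diagonalizations n (real R) (B + 1 / real (Suc m)) \<in> sets borel" for R m
      by (rule borel_closed[OF closed_diagonalizable_image])
    have u: "(\<Union>R::nat. conjugate_back n ` diagonalizations n (real R) (B + 1 / real (Suc m))) \<in> sets borel" for m
      using b by (intro sets.countable_UN) blast
    show "(\<Inter>m. \<Union>R::nat. conjugate_back n ` diagonalizations n (real R) (B + 1 / real (Suc m))) \<in> sets borel"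
      using u by (intro sets.countable_INT) blast+
  qed
  finally show "{\<omega> \<in> space N. kappa_V (mat n n (X \<omega>)) \<le> ereal B} \<in> sets N" .
  have "{\<omega> \<in> space N. op_norm (mat n n (X \<omega>)) \<le> c} = {\<omega> \<in> space N. Y \<omega> \<in> {x. op_norm (mat n n x) \<le> c}}"
    unfolding Y by simp
  also have "\<dots> \<in> sets N" by (rule meas) (intro borel_closed closed_op_norm_le)
  finally show "{\<omega> \<in> space N. op_norm (mat n n (X \<omega>)) \<le> c} \<in> sets N" .
qed

section \<open>The condition number of the perturbed matrix\<close>

context bounded_density_law
begin

text \<open>Each entry of the resolvent is a sum of simple poles with coefficients W_jk V_ki.  Summing the areas
  over all entries gives the sum of |W_jk|^2 |V_ki|^2, which collapses to the squared Frobenius norm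
  of V because the columns of W are unit vectors.\<close>
lemma area_density_lower_bound:
  assumes x: "x \<in> space (entries n)"
    and W: "W \<in> carrier_mat n n" and V: "V \<in> carrier_mat n n"
    and WV: "W * V = 1\<^sub>m n" and VW: "V * W = 1\<^sub>m n"
    and eq: "perturbed n A c x = W * mat_diag n l * V"
    and inj: "inj_on l {..<n}" and R: "\<And>k. k < n \<Longrightarrow> cmod (l k) < R"
    and un: "\<And>k. k < n \<Longrightarrow> vec_l2 (col W k) = 1"
  shows "ennreal (pi / 4 * (frob V)\<^sup>2) \<le> area_density n A c R x"
proof -
  define a where "a ij k = W $$ (snd ij, k) * V $$ (k, fst ij)" for ij :: "nat \<times> nat" and k
  define S where "S e ij = Pair x -` (near_singular n A c R e ij \<inter> (space (entries n) \<times> UNIV))" for e ij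
  have S_sets: "S e ij \<in> sets borel" if "ij \<in> indices n" for e ij
    using sets_Pair1[OF near_singular_measurable[OF that, of A c R e], of x] by (simp add: S_def)
  have "\<exists>e0>0. \<forall>e. 0 < e \<longrightarrow> e < e0 \<longrightarrow>
     ennreal (pi / 4 * e\<^sup>2 * (\<Sum>k<n. (cmod (a ij k))\<^sup>2)) \<le> emeasure lborel (S e ij)" if ij: "ij \<in> indices n" for ij
  proof -
    from pole_superlevel_area[OF inj R, of "a ij"] obtain e0 where e0: "e0 > 0"
      "\<And>e S. 0 < e \<Longrightarrow> e < e0 \<Longrightarrow> S \<in> sets borel \<Longrightarrow>
        (\<forall>z. cmod z < R \<longrightarrow> z \<notin> l ` {..<n} \<longrightarrow> 1 < e * cmod (\<Sum>k<n. a ij k / (l k - z)) \<longrightarrow> z \<in> S) \<Longrightarrow>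
        ennreal (pi / 4 * e\<^sup>2 * (\<Sum>k<n. (cmod (a ij k))\<^sup>2)) \<le> emeasure lborel S" by blast
    show ?thesis
    proof (intro exI[of _ e0] conjI allI impI e0(1))
      fix e assume e: "0 < e" "e < e0"
      show "ennreal (pi / 4 * e\<^sup>2 * (\<Sum>k<n. (cmod (a ij k))\<^sup>2)) \<le> emeasure lborel (S e ij)"
      proof (rule e0(2)[OF e S_sets[OF ij]], intro allI impI)
        fix z assume z: "cmod z < R" "z \<notin> l ` {..<n}" "1 < e * cmod (\<Sum>k<n. a ij k / (l k - z))"
        have zl: "\<And>k. k < n \<Longrightarrow> l k \<noteq> z" using z(2) by auto
        have ij': "fst ij < n" "snd ij < n" using ij by auto
        note r = cofactor_resolvent[OF W V WV VW eq zl ij', folded pencil_perturbed]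
        have cof: "cofactor (pencil n A c x z) (fst ij) (snd ij) = det (pencil n A c x z) * (\<Sum>k<n. a ij k / (l k - z))"
          using r(2) by (simp only: a_def)
        have "cmod (det (pencil n A c x z)) * 1 < cmod (det (pencil n A c x z)) * (e * cmod (\<Sum>k<n. a ij k / (l k - z)))"
          using z(3) r(1) by (intro mult_strict_left_mono) auto
        then have "cmod (det (pencil n A c x z)) < e * cmod (cofactor (pencil n A c x z) (fst ij) (snd ij))"
          by (simp add: cof norm_mult mult_ac)
        then show "z \<in> S e ij" using z(1) x by (simp add: S_def near_singular_def)
      qed
    qed
  qed
  then obtain e0 where e0: "\<And>ij. ij \<in> indices n \<Longrightarrow> e0 ij > 0"
    "\<And>ij e. ij \<in> indices n \<Longrightarrow> 0 < e \<Longrightarrow> e < e0 ij \<Longrightarrow>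
     ennreal (pi / 4 * e\<^sup>2 * (\<Sum>k<n. (cmod (a ij k))\<^sup>2)) \<le> emeasure lborel (S e ij)" by metis
  have total: "(\<Sum>ij\<in>indices n. \<Sum>k<n. (cmod (a ij k))\<^sup>2) = (frob V)\<^sup>2"
  proof -
    have colW: "(\<Sum>j<n. (cmod (W $$ (j,k)))\<^sup>2) = 1" if "k < n" for k
      using vec_l2_sq[of "col W k" n] un[OF that] W that by simp
    have "(\<Sum>ij\<in>indices n. \<Sum>k<n. (cmod (a ij k))\<^sup>2) = (\<Sum>k<n. \<Sum>ij\<in>indices n. (cmod (a ij k))\<^sup>2)"
      by (rule sum.swap)
    also have "\<dots> = (\<Sum>k<n. \<Sum>i<n. (cmod (V $$ (k,i)))\<^sup>2)"
    proof (rule sum.cong[OF refl])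
      fix k assume k: "k \<in> {..<n}"
      have "(\<Sum>ij\<in>indices n. (cmod (a ij k))\<^sup>2) = (\<Sum>i<n. \<Sum>j<n. (cmod (V $$ (k,i)))\<^sup>2 * (cmod (W $$ (j,k)))\<^sup>2)"
        by (simp add: sum.cartesian_product case_prod_unfold a_def norm_mult power_mult_distrib mult.commute)
      also have "\<dots> = (\<Sum>i<n. (cmod (V $$ (k,i)))\<^sup>2)"
        using colW k by (simp flip: sum_distrib_left)
      finally show "(\<Sum>ij\<in>indices n. (cmod (a ij k))\<^sup>2) = (\<Sum>i<n. (cmod (V $$ (k,i)))\<^sup>2)" .
    qed
    finally show ?thesis by (simp add: frob_sq[OF V])
  qed
  define e1 where "e1 = Min (insert 1 (e0 ` indices n))"
  have e1: "e1 > 0" "\<And>ij. ij \<in> indices n \<Longrightarrow> e1 \<le> e0 ij"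
    unfolding e1_def using e0(1) by (auto simp del: mem_Sigma_iff)
  have "eventually (\<lambda>m. 1 / real (Suc m) < e1) sequentially"
    using LIMSEQ_inverse_real_of_nat e1(1) by (simp add: order_tendsto_iff inverse_eq_divide)
  then have "eventually (\<lambda>m. ennreal (pi / 4 * (frob V)\<^sup>2) \<le>
    ennreal ((real (Suc m))\<^sup>2) * singular_area n A c R (1 / real (Suc m)) x) sequentially"
  proof eventually_elim
    case (elim m)
    define e where "e = 1 / real (Suc m)"
    have e: "e > 0" "e < e1" using elim by (auto simp: e_def)
    have se: "(real (Suc m))\<^sup>2 * e\<^sup>2 = 1" by (simp add: e_def power_divide)
    have "pi / 4 * (frob V)\<^sup>2 = (real (Suc m))\<^sup>2 * (\<Sum>ij\<in>indices n. pi / 4 * e\<^sup>2 * (\<Sum>k<n. (cmod (a ij k))\<^sup>2))"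
    proof -
      have "(\<Sum>ij\<in>indices n. pi / 4 * e\<^sup>2 * (\<Sum>k<n. (cmod (a ij k))\<^sup>2)) = pi / 4 * e\<^sup>2 * (frob V)\<^sup>2"
        by (simp only: sum_distrib_left[symmetric] total)
      then have "(real (Suc m))\<^sup>2 * (\<Sum>ij\<in>indices n. pi / 4 * e\<^sup>2 * (\<Sum>k<n. (cmod (a ij k))\<^sup>2)) = ((real (Suc m))\<^sup>2 * e\<^sup>2) * (pi / 4 * (frob V)\<^sup>2)"
        by (simp only: mult_ac)
      then show ?thesis by (simp only: se mult_1_left)
    qed
    then have "ennreal (pi / 4 * (frob V)\<^sup>2) = ennreal ((real (Suc m))\<^sup>2) * (\<Sum>ij\<in>indices n. ennreal (pi / 4 * e\<^sup>2 * (\<Sum>k<n. (cmod (a ij k))\<^sup>2)))"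
      by (subst sum_ennreal) (auto simp: ennreal_mult[symmetric] sum_nonneg)
    also have "\<dots> \<le> ennreal ((real (Suc m))\<^sup>2) * (\<Sum>ij\<in>indices n. emeasure lborel (S e ij))"
      by (intro mult_left_mono sum_mono e0(2)) (use e e1(2) in \<open>auto intro: less_le_trans simp del: mem_Sigma_iff\<close>)
    finally show ?case by (simp add: singular_area_def S_def e_def)
  qed
  then show ?thesis unfolding area_density_def by (rule Liminf_bounded)
qed

lemma kappa_V_bound:
  assumes x: "x \<in> space (entries n)" and disc: "spectral_disc (perturbed n A c x) \<noteq> 0"
    and op: "op_norm (perturbed n A c x) < R"
    and area: "area_density n A c R x < ennreal T" and T: "T \<ge> 0"
  shows "kappa_V (perturbed n A c x) \<le> ereal (sqrt (real n) * sqrt (4 * T / pi))"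
proof -
  let ?M = "perturbed n A c x"
  have M: "?M \<in> carrier_mat n n" by simp
  obtain W V l where W: "W \<in> carrier_mat n n" and V: "V \<in> carrier_mat n n" and WV: "W * V = 1\<^sub>m n"
    and VW: "V * W = 1\<^sub>m n" and inj: "inj_on l {..<n}" and eq: "?M = W * mat_diag n l * V"
    and un: "\<And>k. k < n \<Longrightarrow> vec_l2 (col W k) = 1"
    using simple_spectrum_diagonalization[OF M disc] by metis
  have R: "cmod (l k) < R" if "k < n" for k
    using diagonalization_eigenvalue_le[OF M W V VW eq that un[OF that]] op by linarith
  have "ennreal (pi / 4 * (frob V)\<^sup>2) < ennreal T"
    using area_density_lower_bound[OF x W V WV VW eq inj R un] area by (rule le_less_trans)
  then have "pi / 4 * (frob V)\<^sup>2 < T" using T by (simp add: ennreal_less_iff)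
  then have "(frob V)\<^sup>2 \<le> 4 * T / pi" by (simp add: field_simps)
  then have fV: "frob V \<le> sqrt (4 * T / pi)" by (rule real_le_rsqrt)
  have fW: "frob W = sqrt (real n)"
  proof -
    have "(frob W)\<^sup>2 = (\<Sum>j<n. \<Sum>k<n. (cmod (W $$ (j,k)))\<^sup>2)" by (rule frob_sq[OF W])
    also have "\<dots> = (\<Sum>k<n. \<Sum>j<n. (cmod (W $$ (j,k)))\<^sup>2)" by (rule sum.swap)
    also have "\<dots> = (\<Sum>k<n. 1)"
    proof (rule sum.cong[OF refl])
      fix k assume "k \<in> {..<n}"
      then show "(\<Sum>j<n. (cmod (W $$ (j,k)))\<^sup>2) = 1"
        using vec_l2_sq[of "col W k" n] un[of k] W by simp
    qed
    finally have "(frob W)\<^sup>2 = real n" by simp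
    then show ?thesis using frob_nonneg[of W] by (metis real_sqrt_unique)
  qed
  have "similar_mat_wit ?M (mat_diag n l) W V"
    by (rule similar_mat_witI[OF WV VW eq M mat_diag_dim W V])
  moreover have "diagonal_mat (mat_diag n l)" by (auto simp: diagonal_mat_def mat_diag_def)
  ultimately have "kappa_V ?M \<le> ereal (frob W * frob V)" by (rule kappa_V_le_frob)
  also have "\<dots> \<le> ereal (sqrt (real n) * sqrt (4 * T / pi))"
    unfolding fW using fV by (simp add: mult_left_mono)
  finally show ?thesis .
qed

end

theorem proposition3p1:
  fixes M :: "'a measure" and \<xi> :: "'a \<Rightarrow> complex"
  assumes "prob_space M"
    and "\<xi> \<in> borel_measurable M"
    and "sub_gaussian M \<xi>"
    and "has_bounded_density M \<xi>"
    and "prob_space.expectation M \<xi> = 0"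
  shows "\<exists>C1 C2 :: real. C1 > 0 \<and> C2 > 0 \<and>
    (\<forall>(n :: nat) (A :: complex mat) (\<delta> :: real) (N :: 'b measure) (G :: 'b \<Rightarrow> complex mat).
      n \<ge> 1 \<longrightarrow> A \<in> carrier_mat n n \<longrightarrow> op_norm A = 1 \<longrightarrow> 0 < \<delta> \<longrightarrow> \<delta> < 1 \<longrightarrow>
      prob_space N \<longrightarrow> scaled_iid_matrix M \<xi> n N G \<longrightarrow>
      measure N {\<omega> \<in> space N.
          kappa_V (A + complex_of_real \<delta> \<cdot>\<^sub>m G \<omega>) \<le> ereal (C1 * (real n)\<^sup>2 / \<delta>) \<and>
          op_norm (complex_of_real \<delta> \<cdot>\<^sub>m G \<omega>) \<le> C2 * \<delta>} \<ge> 1 / 2)"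
proof -
  interpret M: prob_space M by (rule assms(1))
  note xi [measurable] = assms(2)
  define \<mu> where "\<mu> = distr M borel \<xi>"
  have sets_mu: "sets \<mu> = sets borel" by (simp add: \<mu>_def)
  have prob_mu: "prob_space \<mu>" unfolding \<mu>_def by (rule M.prob_space_distr) simp
  obtain f K0 where f: "continuous_on UNIV f" "\<And>z. 0 \<le> f z \<and> f z \<le> K0"
    and dens: "distributed M lborel \<xi> (\<lambda>z. ennreal (f z))"
    using assms(4) unfolding has_bounded_density_def by blast
  \<comment> \<open>The maximum makes K positive, as needed to divide by the expected area.\<close>
  define K where "K = pi * (max K0 1)"
  have K: "K > 0" by (simp add: K_def)
  have bdl: "bounded_density_law \<mu> K"
  proof (intro bounded_density_law.intro bounded_density_law_axioms.intro prob_mu sets_mu)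
    show "K \<ge> 0" using K by simp
    fix a :: complex and r :: real assume r: "r \<ge> 0"
    have [measurable]: "f \<in> borel_measurable borel" using f(1) by (rule borel_measurable_continuous_onI)
    have "\<mu> = density lborel (\<lambda>z. ennreal (f z))"
    proof -
      have "\<mu> = distr M lborel \<xi>" unfolding \<mu>_def by (rule distr_cong) auto
      then show ?thesis using distributed_distr_eq_density[OF dens] by simp
    qed
    then have "emeasure \<mu> (ball a r) = (\<integral>\<^sup>+ z. ennreal (f z) * indicator (ball a r) z \<partial>lborel)"
      by (simp add: emeasure_density)
    also have "\<dots> \<le> (\<integral>\<^sup>+ z. ennreal (max K0 1) * indicator (ball a r) z \<partial>lborel)"
      by (intro nn_integral_mono mult_right_mono ennreal_leI) (use f(2) in \<open>auto simp: le_max_iff_disj\<close>)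
    also have "\<dots> = ennreal (max K0 1) * emeasure lborel (ball a r)"
      by (rule nn_integral_cmult_indicator) simp
    also have "\<dots> = ennreal (K * r\<^sup>2)"
      using r by (simp add: emeasure_ball_complex K_def mult_ac flip: ennreal_mult)
    finally show "emeasure \<mu> (ball a r) \<le> ennreal (K * r\<^sup>2)" .
  qed
  interpret L: bounded_density_law \<mu> K by (rule bdl)
  obtain a0 C0 where sg: "a0 > 0" "C0 > 0"
    "\<And>t. t \<ge> 0 \<Longrightarrow> measure M {\<omega> \<in> space M. cmod (\<xi> \<omega>) > t} \<le> C0 * exp (- a0 * t\<^sup>2)"
    using assms(3) unfolding sub_gaussian_def by blast
  have "sub_gaussian_law \<mu> a0 C0"
  proof (intro sub_gaussian_law.intro sub_gaussian_law_axioms.intro prob_mu sets_mu sg(1,2))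
    fix t :: real assume t: "t \<ge> 0"
    have "emeasure \<mu> {y. cmod y > t} = emeasure M (\<xi> -` {y. cmod y > t} \<inter> space M)"
      unfolding \<mu>_def by (rule emeasure_distr) measurable
    also have "\<xi> -` {y. cmod y > t} \<inter> space M = {\<omega> \<in> space M. cmod (\<xi> \<omega>) > t}" by auto
    also have "emeasure M \<dots> = ennreal (measure M {\<omega> \<in> space M. cmod (\<xi> \<omega>) > t})" by (rule M.emeasure_eq_measure)
    also have "\<dots> \<le> ennreal (C0 * exp (- a0 * t\<^sup>2))" by (intro ennreal_leI sg(3) t)
    finally show "emeasure \<mu> {y. cmod y > t} \<le> ennreal (C0 * exp (- a0 * t\<^sup>2))" .
  next
    show "(\<integral>y. y \<partial>\<mu>) = 0" unfolding \<mu>_def using assms(5) by (subst integral_distr) auto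
  qed
  then interpret S: sub_gaussian_law \<mu> a0 C0 .
  obtain \<tau> where tau: "\<tau> > 0" "\<And>n. n \<ge> 1 \<Longrightarrow> \<exists>Bad\<in>sets (L.entries n). emeasure (L.entries n) Bad \<le> ennreal (1/4) \<and>
     (\<forall>x\<in>space (L.entries n) - Bad. op_norm (mat n n x) \<le> \<tau> * sqrt (real n))"
    using S.op_norm_bound_whp by blast
  \<comment> \<open>The perturbed matrix will have norm at most 1 + \<tau> \<delta>, so its eigenvalues lie in the open disc
    of radius R.\<close>
  define R where "R = 2 + \<tau>"
  have R: "R > 0" using tau by (simp add: R_def)
  define C1 where "C1 = 4 * R * sqrt K"
  show ?thesis
  proof (rule exI[of _ C1], rule exI[of _ \<tau>], intro conjI allI impI)
    show "C1 > 0" "\<tau> > 0" using R K tau by (auto simp: C1_def)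
    fix n :: nat and A :: "complex mat" and \<delta> :: real and N :: "'b measure" and G :: "'b \<Rightarrow> complex mat"
    assume n: "n \<ge> 1" and A: "A \<in> carrier_mat n n" and opA: "op_norm A = 1" and d: "0 < \<delta>" "\<delta> < 1"
      and N: "prob_space N" and G: "scaled_iid_matrix M \<xi> n N G"
    interpret N: prob_space N by (rule N)
    let ?P = "L.entries n"
    \<comment> \<open>The scale of the perturbation in terms of the normalized entries sqrt n G.\<close>
    define c where "c = \<delta> / sqrt (real n)"
    have c: "c > 0" using d n by (simp add: c_def)
    define X where "X \<omega> = (\<lambda>ij\<in>indices n. complex_of_real (sqrt (real n)) * G \<omega> $$ ij)" for \<omega>
    have Gc: "G \<omega> \<in> carrier_mat n n" if "\<omega> \<in> space N" for \<omega> using G that by (simp add: scaled_iid_matrix_def)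
    have ind: "N.indep_vars (\<lambda>_. borel) (\<lambda>ij \<omega>. complex_of_real (sqrt (real n)) * G \<omega> $$ ij) (indices n)"
      and law: "\<And>ij. ij \<in> indices n \<Longrightarrow> distr N borel (\<lambda>\<omega>. complex_of_real (sqrt (real n)) * G \<omega> $$ ij) = \<mu>"
      using G unfolding scaled_iid_matrix_def \<mu>_def by blast+
    have rv: "(\<lambda>\<omega>. complex_of_real (sqrt (real n)) * G \<omega> $$ ij) \<in> borel_measurable N" if "ij \<in> indices n" for ij
      using ind that unfolding N.indep_vars_def by blast
    have X_borel: "X \<in> measurable N (Pi\<^sub>M (indices n) (\<lambda>_. borel))"
      unfolding X_def by (rule measurable_restrict) (rule rv)
    have sets_P: "sets ?P = sets (Pi\<^sub>M (indices n) (\<lambda>_. borel))"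
      by (rule sets_PiM_cong) (simp_all add: sets_mu)
    have X_meas: "X \<in> measurable N ?P" using X_borel sets_P measurable_cong_sets by blast
    have "(0,0) \<in> indices n" using n by auto
    then have ne: "indices n \<noteq> {}" by blast
    have "distr N (Pi\<^sub>M (indices n) (\<lambda>_. borel)) X = Pi\<^sub>M (indices n) (\<lambda>ij. distr N borel (\<lambda>\<omega>. complex_of_real (sqrt (real n)) * G \<omega> $$ ij))"
      unfolding X_def using N.indep_vars_iff_distr_eq_PiM'[OF ne, where M' = "\<lambda>_. borel" and X = "\<lambda>ij \<omega>. complex_of_real (sqrt (real n)) * G \<omega> $$ ij"] rv ind by blast
    also have "\<dots> = ?P" by (rule PiM_cong) (use law in auto)
    finally have X_law: "distr N ?P X = ?P" using sets_P by (subst distr_cong[OF refl sets_P refl]) auto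
    obtain Bad1 where Bad1: "Bad1 \<in> sets ?P" "emeasure ?P Bad1 \<le> ennreal (1/4)"
      "\<And>x. x \<in> space ?P \<Longrightarrow> x \<notin> Bad1 \<Longrightarrow> op_norm (mat n n x) \<le> \<tau> * sqrt (real n)"
      using tau(2)[OF n] by blast
    \<comment> \<open>Four times the bound on the expected area density.\<close>
    define T where "T = 4 * (real n)\<^sup>2 * K * pi * R\<^sup>2 / c\<^sup>2"
    have T: "T \<ge> 0" using K by (simp add: T_def)
    define Bad2 where "Bad2 = {x \<in> space ?P. ennreal T \<le> L.area_density n A c R x}"
    have Bad2: "Bad2 \<in> sets ?P" "emeasure ?P Bad2 \<le> ennreal (1/4)"
    proof -
      show "Bad2 \<in> sets ?P"
        unfolding Bad2_def by (rule borel_measurable_le[OF borel_measurable_const L.area_density_measurable])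
      show "emeasure ?P Bad2 \<le> ennreal (1/4)"
        unfolding Bad2_def T_def by (rule L.area_density_large_prob[OF c R K]) (use n in simp)
    qed
    obtain Bad3 where Bad3: "Bad3 \<in> null_sets ?P" "{x \<in> space ?P. \<not> spectral_disc (perturbed n A c x) \<noteq> 0} \<subseteq> Bad3"
      using L.AE_simple_spectrum[OF c, of n A] unfolding eventually_ae_filter by (elim bexE)
    let ?E = "{\<omega> \<in> space N. kappa_V (A + complex_of_real \<delta> \<cdot>\<^sub>m G \<omega>) \<le> ereal (C1 * (real n)\<^sup>2 / \<delta>) \<and>
          op_norm (complex_of_real \<delta> \<cdot>\<^sub>m G \<omega>) \<le> \<tau> * \<delta>}"
    have pert: "A + complex_of_real \<delta> \<cdot>\<^sub>m G \<omega> = perturbed n A c (X \<omega>)"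
      and scaled: "complex_of_real \<delta> \<cdot>\<^sub>m G \<omega> = complex_of_real c \<cdot>\<^sub>m mat n n (X \<omega>)" if w: "\<omega> \<in> space N" for \<omega>
    proof -
      have cs: "complex_of_real \<delta> = complex_of_real c * complex_of_real (sqrt (real n))"
        using n by (simp add: c_def)
      show "A + complex_of_real \<delta> \<cdot>\<^sub>m G \<omega> = perturbed n A c (X \<omega>)"
        using A Gc[OF w] by (intro eq_matI) (auto simp: perturbed_def X_def cs)
      show "complex_of_real \<delta> \<cdot>\<^sub>m G \<omega> = complex_of_real c \<cdot>\<^sub>m mat n n (X \<omega>)"
        using Gc[OF w] by (intro eq_matI) (auto simp: X_def cs)
    qed
    have X_comp: "(\<lambda>\<omega>. X \<omega> (i,j)) \<in> borel_measurable N" if "i < n" "j < n" for i j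
      using rv[of "(i,j)"] that by (simp add: X_def)
    have E_sets: "?E \<in> sets N"
    proof -
      have "?E = {\<omega> \<in> space N. kappa_V (mat n n ((\<lambda>ij. A $$ ij + complex_of_real c * X \<omega> ij))) \<le> ereal (C1 * (real n)\<^sup>2 / \<delta>)} \<inter>
         {\<omega> \<in> space N. op_norm (mat n n (\<lambda>ij. complex_of_real c * X \<omega> ij)) \<le> \<tau> * \<delta>}"
      proof -
        have "perturbed n A c (X \<omega>) = mat n n ((\<lambda>ij. A $$ ij + complex_of_real c * X \<omega> ij))" for \<omega>
          by (rule eq_matI) (auto simp: perturbed_def)
        moreover have "complex_of_real c \<cdot>\<^sub>m mat n n (X \<omega>) = mat n n (\<lambda>ij. complex_of_real c * X \<omega> ij)" for \<omega>
          by (rule eq_matI) auto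
        ultimately show ?thesis using pert scaled by auto
      qed
      also have "\<dots> \<in> sets N"
        by (intro sets.Int kappa_V_event_measurable borel_measurable_add borel_measurable_times borel_measurable_const X_comp)
      finally show ?thesis .
    qed
    let ?Bad = "Bad1 \<union> Bad2 \<union> Bad3"
    have Bad: "?Bad \<in> sets ?P" using Bad1 Bad2 Bad3 by auto
    have good: "\<omega> \<in> ?E" if w: "\<omega> \<in> space N" "X \<omega> \<notin> ?Bad" for \<omega>
    proof -
      have x: "X \<omega> \<in> space ?P" using measurable_space[OF X_meas w(1)] .
      have op: "op_norm (complex_of_real \<delta> \<cdot>\<^sub>m G \<omega>) \<le> \<tau> * \<delta>"
      proof -
        have "op_norm (complex_of_real \<delta> \<cdot>\<^sub>m G \<omega>) \<le> c * op_norm (mat n n (X \<omega>))"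
          unfolding scaled[OF w(1)] using op_norm_smult_le[of "mat n n (X \<omega>)" n n "complex_of_real c"] c by simp
        also have "\<dots> \<le> c * (\<tau> * sqrt (real n))" using Bad1(3)[OF x] w(2) c by (intro mult_left_mono) auto
        also have "\<dots> = \<tau> * \<delta>" using n by (simp add: c_def)
        finally show ?thesis .
      qed
      have dG: "complex_of_real \<delta> \<cdot>\<^sub>m G \<omega> \<in> carrier_mat n n" using Gc[OF w(1)] by simp
      have "op_norm (perturbed n A c (X \<omega>)) \<le> 1 + \<tau> * \<delta>"
        using op_norm_add[OF A dG] op opA by (simp add: pert[OF w(1)])
      also have "\<dots> < R" using mult_strict_left_mono[OF d(2) tau(1)] by (simp add: R_def)
      finally have opR: "op_norm (perturbed n A c (X \<omega>)) < R" .
      have "L.area_density n A c R (X \<omega>) < ennreal T" using w(2) x by (auto simp: Bad2_def not_le)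
      moreover have "spectral_disc (perturbed n A c (X \<omega>)) \<noteq> 0" using Bad3(2) x w(2) by blast
      ultimately have "kappa_V (perturbed n A c (X \<omega>)) \<le> ereal (sqrt (real n) * sqrt (4 * T / pi))"
        using L.kappa_V_bound[OF x _ opR _ T] by blast
      also have "sqrt (real n) * sqrt (4 * T / pi) = C1 * (real n)\<^sup>2 / \<delta>"
      proof -
        have c2: "c\<^sup>2 = \<delta>\<^sup>2 / real n" using n by (simp add: c_def power_divide)
        have "real n * (4 * T / pi) = K * (4 * R * (real n)\<^sup>2 / \<delta>)\<^sup>2"
          unfolding T_def c2 using n d by (simp add: power2_eq_square field_simps)
        then have "sqrt (real n) * sqrt (4 * T / pi) = sqrt (K * (4 * R * (real n)\<^sup>2 / \<delta>)\<^sup>2)"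
          by (simp only: real_sqrt_mult[symmetric])
        also have "\<dots> = sqrt K * (4 * R * (real n)\<^sup>2 / \<delta>)" using R d by (simp add: real_sqrt_mult)
        finally show ?thesis by (simp add: C1_def)
      qed
      finally show ?thesis using op w(1) by (simp add: pert)
    qed
    have "emeasure N (space N - ?E) \<le> emeasure N (X -` ?Bad \<inter> space N)"
      by (rule emeasure_mono) (use good measurable_sets[OF X_meas Bad] in auto)
    also have "\<dots> = emeasure ?P ?Bad" using emeasure_distr[OF X_meas Bad] X_law by simp
    also have "\<dots> \<le> emeasure ?P Bad1 + emeasure ?P Bad2 + emeasure ?P Bad3"
      using Bad1 Bad2 Bad3 by (intro order_trans[OF emeasure_subadditive] add_mono order_refl emeasure_subadditive) auto
    also have "\<dots> \<le> ennreal (1/4) + ennreal (1/4) + 0"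
      using Bad1 Bad2 Bad3 by (intro add_mono) auto
    also have "\<dots> = ennreal (1/2)" by (simp flip: ennreal_plus)
    finally have "ennreal (measure N (space N - ?E)) \<le> ennreal (1/2)" unfolding N.emeasure_eq_measure .
    then have "measure N (space N - ?E) \<le> 1/2" by (subst (asm) ennreal_le_iff) auto
    then show "measure N ?E \<ge> 1/2" using N.prob_compl[OF E_sets] by linarith
  qed
qed

end
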